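(* Fix $\omega>0$. For every constriction $(B_0,A_0)$ there exists $\varepsilon>0$ such that the punctured vertical segment $\{B_0\}\times\big([A_0-\varepsilon,A_0+\varepsilon]\setminus\{A_0\}\big)$ either lies entirely in the interior of a phase-lock area (the constriction is then called positive), or lies entirely outside the union of all phase-lock areas (the constriction is then called negative).
   Context: Fix $\omega>0$. For parameters $(B,A)\in\mathbb R^2$ consider the equation $\frac{d\phi}{dt}=-\sin\phi+B+A\cos\omega t$. With $\tau=\omega t$, $l=B/\omega$, $\mu=A/(2\omega)$ it becomes $\frac{d\phi}{d\tau}=-\frac{\sin\phi}{\omega}+l+2\mu\cos\tau$, an equation on the torus $\mathbb R^2/2\pi\mathbb Z^2$ with coordinates $(\phi,\tau)$. Its rotation number is $\rho(B,A)=\lim_{k\to+\infty}\frac{\phi(2\pi k)}{2\pi k}$ for any real solution $\phi(\tau)$ (independent of the solution). For $r\in\mathbb R$ the level set $L_r=\{(B,A):\rho(B,A)=r\}$ is called the $r$-th phase-lock area if it has nonempty interior (this happens only for $r\in\mathbb Z$). It is known that each phase-lock area is a chain ("garland") of infinitely many bounded domains going to infinity in the vertical ($A$) direction, any two consecutive domains being separated by a single point; such a separating point that does not lie on the axis $\{A=0\}$ is called a constriction. (Equivalently, as is known, a point $(B,A)$ with $A\neq0$ is a constriction iff $B/\omega\in\mathbb Z$ and the linear system $u'=z^{-2}(-(lz+\mu(1+z^2))u+\frac{z}{2i\omega}v)$, $v'=\frac{1}{2i\omega z}u$ has trivial monodromy around $0$.) *)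

theory Defs
  imports "HOL-Analysis.Analysis"
begin

text \<open>Solutions of d phi / d tau = - sin phi / omega + l + 2 mu cos tau,
  with l = B / omega and mu = A / (2 omega), defined for all real tau.\<close>
definition jos_solution :: "real \<Rightarrow> real \<Rightarrow> real \<Rightarrow> (real \<Rightarrow> real) \<Rightarrow> bool" where
  "jos_solution \<omega> B A \<phi> \<longleftrightarrow>
     (\<forall>\<tau>. (\<phi> has_real_derivative
             (- sin (\<phi> \<tau>) / \<omega> + B / \<omega> + 2 * (A / (2 * \<omega>)) * cos \<tau>)) (at \<tau>))"

text \<open>rho(B,A) = r : the rotation number of the equation equals r,
  i.e. phi(2 pi k)/(2 pi k) tends to r for a (equivalently, any) real solution.\<close>
definition has_rotation_number :: "real \<Rightarrow> real \<Rightarrow> real \<Rightarrow> real \<Rightarrow> bool" where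
  "has_rotation_number \<omega> B A r \<longleftrightarrow>
     (\<exists>\<phi>. jos_solution \<omega> B A \<phi> \<and>
          (\<lambda>k::nat. \<phi> (2 * pi * real k) / (2 * pi * real k)) \<longlonglongrightarrow> r)"

definition level_set :: "real \<Rightarrow> real \<Rightarrow> (real \<times> real) set" where
  "level_set \<omega> r = {(B, A). has_rotation_number \<omega> B A r}"

definition is_phase_lock_area :: "real \<Rightarrow> real \<Rightarrow> bool" where
  "is_phase_lock_area \<omega> r \<longleftrightarrow> interior (level_set \<omega> r) \<noteq> {}"

definition phase_lock_union :: "real \<Rightarrow> (real \<times> real) set" where
  "phase_lock_union \<omega> = (\<Union>r\<in>{r. is_phase_lock_area \<omega> r}. level_set \<omega> r)"

text \<open>A constriction: a point off the axis A = 0 that separates two (consecutive)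
  domains of a phase-lock area, i.e. lies in the closures of two distinct
  connected components of the interior of that phase-lock area.\<close>
definition constriction :: "real \<Rightarrow> real \<Rightarrow> real \<Rightarrow> bool" where
  "constriction \<omega> B A \<longleftrightarrow> A \<noteq> 0 \<and>
     (\<exists>r. is_phase_lock_area \<omega> r \<and> (B, A) \<in> level_set \<omega> r \<and>
        (\<exists>p q. p \<in> interior (level_set \<omega> r) \<and> q \<in> interior (level_set \<omega> r) \<and>
           connected_component_set (interior (level_set \<omega> r)) p \<noteq>
           connected_component_set (interior (level_set \<omega> r)) q \<and>
           (B, A) \<in> closure (connected_component_set (interior (level_set \<omega> r)) p) \<and>
           (B, A) \<in> closure (connected_component_set (interior (level_set \<omega> r)) q)))"

end

theory Submission
  imports Defs
begin

text \<open>The ratio of the two components of a planar linear system solves the equation, so the Poincare map is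
  the lift of the circle Moebius transformation with matrix entries \<open>\<alpha>\<close>, \<open>\<beta>\<close>, where \<open>\<beta>\<close> is real and
  \<open>|\<alpha>|\<^sup>2 - \<beta>\<^sup>2 = 1\<close>.  A point is outside the phase-lock areas when the matrix is elliptic,
  \<open>|\<beta>| < |Im \<alpha>|\<close>; if \<open>|Im \<alpha>| < |\<beta>|\<close>, the displacement \<open>\<phi>(2 \<pi>) - \<phi>(0) - 2 \<pi> r\<close> takes both signs and the
  point is interior.  By monotonicity in \<open>B\<close>, two components of the interior can only meet where the
  displacement vanishes identically, that is, where the monodromy is trivial; then all solutions are
  quasi-periodic, and a Casoratian of their Fourier coefficients shows that \<open>l\<close> is an integer.

  Fix \<open>l\<close> and let \<open>\<mu>\<close> tend to the value at the constriction.  A solution \<open>v\<close> of the perturbed system is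
  periodic up to a jump of the size of \<open>|Im \<alpha>| + |\<beta>|\<close>.  Pairing the three-term recurrence for its
  Fourier coefficients with that of a one-sided solution \<open>w\<close> of the limit system (Green's formula)
  gives, up to smaller terms, one complex linear relation between \<open>Im \<alpha>\<close> and \<open>\<beta>\<close> with coefficients
  depending only on the limit system.  These coefficients do not degenerate, because the limit system has no
  polynomial solutions.  So the ratio \<open>Im \<alpha> : \<beta>\<close> tends to a limit other than \<open>\<plusminus>1\<close> along the punctured vertical line,
  and the sign of \<open>\<beta>\<^sup>2 - (Im \<alpha>)\<^sup>2\<close> is constant near the constriction.\<close>

subsection \<open>The linear system\<close>

text \<open>Nothing is known about the speed at which the monodromy becomes trivial along the
  vertical line: Im \<alpha> and \<beta> may vanish to a high order at the constriction, so a
  derivative in \<open>m\<close> need not decide the sign. What can be controlled is the direction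
  of the pair: every error is bounded by |m - m0| times |Im \<alpha>| + |\<beta>| itself. This
  requires a solution that is small, together with its jump, on a whole half-line of frequencies. It
  is the solution whose coefficient at frequency 1 vanishes, chosen anew for each \<open>m\<close>:
  the coefficient at frequency 0 is a multiple of the jump, so both starting values of the
  recurrence on the half-line are of the size of the jump. The limit relation would degenerate only
  if the initial vector (x, y) of a one-sided solution were isotropic, x^2 + y^2 = 0. Such a
  solution is proportional to its own conjugate, so its two components are one-sided in opposite
  directions, and that is a polynomial solution in disguise.\<close>

definition hh :: "real \<Rightarrow> real \<Rightarrow> real \<Rightarrow> complex" where
  "hh l m t = cis (l * t + 2 * m * sin t)"

text \<open>For \<open>a = 1 / (2 * \<omega>)\<close> the quotient \<open>hh * P / Q\<close>
  satisfies the Riccati equation of \<open>cis \<phi>\<close>. The phase \<open>hh\<close> is placed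
  in the coefficients, which leaves a matrix without diagonal whose entries have constant
  modulus.\<close>

definition lin_sol :: "real \<Rightarrow> real \<Rightarrow> real \<Rightarrow> (real \<Rightarrow> complex) \<Rightarrow> (real \<Rightarrow> complex) \<Rightarrow> bool" where
  "lin_sol a l m P Q \<longleftrightarrow>
     (\<forall>t. (P has_vector_derivative (complex_of_real a * cnj (hh l m t) * Q t)) (at t) \<and>
          (Q has_vector_derivative (complex_of_real a * hh l m t * P t)) (at t))"

lemma norm_hh [simp]: "norm (hh l m t) = 1"
  by (simp add: hh_def)

lemma hh_cnj_mult [simp]: "hh l m t * cnj (hh l m t) = 1" "cnj (hh l m t) * hh l m t = 1"
  by (simp_all add: hh_def cis_cnj cis_mult)

lemma hh_nonzero [simp]: "hh l m t \<noteq> 0"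
  using norm_hh[of l m t] by (metis norm_zero zero_neq_one)

lemma hh_0 [simp]: "hh l m 0 = 1"
  by (simp add: hh_def)

lemma hh_minus: "hh l m (- t) = cnj (hh l m t)"
  by (simp add: hh_def cis_cnj)

lemma hh_neg: "hh (- l) (- m) t = cnj (hh l m t)"
  by (simp add: hh_def cis_cnj)

lemma hh_shift: "hh l m (t + 2 * pi) = cis (2 * pi * l) * hh l m t"
proof -
  have "l * (t + 2 * pi) + 2 * m * sin (t + 2 * pi) = 2 * pi * l + (l * t + 2 * m * sin t)"
    unfolding sin_periodic by (simp add: algebra_simps)
  then show ?thesis
    by (simp only: hh_def cis_mult)
qed

lemma has_vector_derivative_cis:
  assumes "(g has_real_derivative g') (at t)"
  shows "((\<lambda>t. cis (g t)) has_vector_derivative (\<i> * of_real g' * cis (g t))) (at t)"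
proof -
  have "((\<lambda>t. \<i> * complex_of_real (g t)) has_vector_derivative (\<i> * of_real g')) (at t)"
    using assms by (auto intro!: derivative_eq_intros simp: has_real_derivative_iff_has_vector_derivative)
  from field_vector_diff_chain_at[OF this DERIV_exp] show ?thesis
    by (simp add: cis_conv_exp o_def)
qed

lemma hh_deriv:
  "(hh l m has_vector_derivative (\<i> * of_real (l + 2 * m * cos t) * hh l m t)) (at t)"
proof -
  have "((\<lambda>t. l * t + 2 * m * sin t) has_real_derivative (l + 2 * m * cos t)) (at t)"
    by (auto intro!: derivative_eq_intros)
  from has_vector_derivative_cis[OF this] show ?thesis
    by (simp add: hh_def[abs_def])
qed

lemma continuous_on_hh: "continuous_on S (hh l m)"
  by (meson hh_deriv continuous_at_imp_continuous_on has_vector_derivative_continuous)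

lemma continuous_antiderivative:
  fixes f :: "real \<Rightarrow> 'a::euclidean_space"
  assumes "continuous_on UNIV f"
  shows "\<exists>F. F 0 = 0 \<and> (\<forall>t. (F has_vector_derivative f t) (at t))"
proof -
  have "\<And>x. isCont f x"
    using assms continuous_on_eq_continuous_at open_UNIV by blast
  then obtain F where F: "\<And>x. (F has_vector_derivative f x) (at x)"
    using einterval_antiderivative[of "-\<infinity>" "\<infinity>" f] by auto
  have "((\<lambda>t. F t - F 0) has_vector_derivative f t) (at t)" for t
    by (auto intro!: derivative_eq_intros F)
  then show ?thesis
    by (intro exI[of _ "\<lambda>t. F t - F 0"]) simp
qed

text \<open>One step of Picard iteration: integrating the n-th term of an exponential majorant gives
  the next term. Negative times follow by reflection.\<close>

lemma norm_le_power_fact: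
  fixes F :: "real \<Rightarrow> complex"
  assumes F0: "F 0 = 0" and a: "a \<ge> 0"
    and F: "\<And>t. (F has_vector_derivative f t) (at t)"
    and f: "\<And>t. norm (f t) \<le> a * ((a * \<bar>t\<bar>) ^ n / fact n)"
  shows "norm (F t) \<le> (a * \<bar>t\<bar>) ^ Suc n / fact (Suc n)"
proof -
  have pos: "norm (G t) \<le> (a * t) ^ Suc n / fact (Suc n)"
    if G0: "G 0 = 0" and G: "\<And>t. (G has_vector_derivative g t) (at t)"
      and g: "\<And>t. norm (g t) \<le> a * ((a * \<bar>t\<bar>) ^ n / fact n)" and t: "t \<ge> 0"
    for G g :: "real \<Rightarrow> complex" and t
  proof (cases "t = 0")
    case False
    then have "0 < t" using t by simp
    have phi: "((\<lambda>t. (a * t) ^ Suc n / fact (Suc n)) has_vector_derivative a * ((a * x) ^ n / fact n)) (at x)"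
      for x
    proof -
      have "((\<lambda>t. (a * t) ^ Suc n) has_real_derivative (real (Suc n) * (a * x) ^ n * a)) (at x)"
      proof -
        have "((\<lambda>t. a * t) has_real_derivative a) (at x)"
          by (auto intro!: derivative_eq_intros)
        from DERIV_power[OF this, of "Suc n"] show ?thesis
          by (simp add: mult_ac del: power_Suc of_nat_Suc)
      qed
      from DERIV_cdivide[OF this, of "fact (Suc n)"]
      show ?thesis
        by (simp add: has_real_derivative_iff_has_vector_derivative field_simps del: of_nat_Suc)
    qed
    have "norm (G t - G 0) \<le> (a * t) ^ Suc n / fact (Suc n) - (a * 0) ^ Suc n / fact (Suc n)"
    proof (rule differentiable_bound_general[OF \<open>0 < t\<close>, where f' = g and \<phi>' = "\<lambda>x. a * ((a * x) ^ n / fact n)"])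
      show "continuous_on {0..t} G"
        by (meson G continuous_at_imp_continuous_on has_vector_derivative_continuous)
      show "continuous_on {0..t} (\<lambda>t. (a * t) ^ Suc n / fact (Suc n))"
        by (intro continuous_intros) simp
    qed (use G phi g in \<open>auto\<close>, metis abs_of_pos g)
    then show ?thesis using G0 by simp
  qed (use G0 in simp)
  show ?thesis
  proof (cases "t \<ge> 0")
    case True
    then show ?thesis using pos[OF F0 F f] by simp
  next
    case False
    have "((\<lambda>t. F (- t)) has_vector_derivative (- f (- t))) (at t)" for t
      using vector_derivative_diff_chain_within[of "uminus" "-1" t UNIV F "\<lambda>h. h *\<^sub>R f (-t)"]
        F[of "-t"]
      by (auto simp: o_def has_vector_derivative_def intro!: derivative_eq_intros
          elim: has_derivative_at_withinI)
    from pos[of "\<lambda>t. F (- t)", OF _ this, of "-t"] show ?thesis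
      using False F0 f[of "- x" for x] by simp
  qed
qed

text \<open>Picard iteration from the constant 1. The iterated integrals alternate between the two
  components: the even ones sum to \<open>P\<close>, the odd ones to \<open>Q\<close>. The
  exponential series dominates both and also gives the growth bound.\<close>

lemma lin_sol_exists:
  assumes a: "a \<ge> 0"
  shows "\<exists>P Q. lin_sol a l m P Q \<and> P 0 = 1 \<and> Q 0 = 0 \<and>
      (\<forall>t. norm (P t) \<le> exp (a * \<bar>t\<bar>)) \<and> (\<forall>t. norm (Q t) \<le> exp (a * \<bar>t\<bar>))"
proof -
  define c where "c n t = (if even n then hh l m t else cnj (hh l m t))" for n :: nat and t
  have c_cont: "continuous_on UNIV (c n)" for n
    by (cases "even n") (auto simp: c_def[abs_def] intro!: continuous_intros continuous_on_hh)
  have norm_c: "norm (c n t) = 1" for n t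
    by (simp add: c_def)
  define anti where "anti f = (SOME F. F 0 = 0 \<and> (\<forall>t. (F has_vector_derivative f t) (at t)))"
    for f :: "real \<Rightarrow> complex"
  have anti: "anti f 0 = 0 \<and> (\<forall>t. (anti f has_vector_derivative f t) (at t))"
    if "continuous_on UNIV f" for f
    unfolding anti_def by (rule someI_ex[OF continuous_antiderivative[OF that]])
  define g where "g = rec_nat (\<lambda>t. 1) (\<lambda>n gn. anti (\<lambda>t. of_real a * c n t * gn t))"
  have g_0: "g 0 = (\<lambda>t. 1)" and g_Suc: "\<And>n. g (Suc n) = anti (\<lambda>t. of_real a * c n t * g n t)"
    by (simp_all add: g_def)
  have g_cont: "continuous_on UNIV (g n)" for n
  proof (induction n)
    case (Suc n)
    have "continuous_on UNIV (\<lambda>t. of_real a * c n t * g n t)"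
      by (intro continuous_intros c_cont Suc)
    from anti[OF this] show ?case
      unfolding g_Suc by (meson continuous_at_imp_continuous_on has_vector_derivative_continuous)
  qed (simp add: g_0)
  have cg_cont: "continuous_on UNIV (\<lambda>t. of_real a * c n t * g n t)" for n
    by (intro continuous_intros c_cont g_cont)
  have g0: "g (Suc n) 0 = 0" for n
    unfolding g_Suc using anti[OF cg_cont] by blast
  have gd: "(g (Suc n) has_vector_derivative (of_real a * c n t * g n t)) (at t)" for n t
    unfolding g_Suc using anti[OF cg_cont] by blast
  have gb: "norm (g n t) \<le> (a * \<bar>t\<bar>) ^ n / fact n" for n t
  proof (induction n arbitrary: t)
    case (Suc n)
    show ?case
    proof (rule norm_le_power_fact[OF g0 a gd])
      show "norm (of_real a * c n t * g n t) \<le> a * ((a * \<bar>t\<bar>) ^ n / fact n)" for t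
        using mult_left_mono[OF Suc[of t] a] a by (simp add: norm_mult norm_c)
    qed
  qed (simp add: g_0)
  have exp_sum: "summable (\<lambda>n. x ^ n / fact n)" and exp_eq: "(\<Sum>n. x ^ n / fact n) = exp x" for x :: real
    using exp_converges[of x] by (auto simp: sums_iff divide_inverse_commute exp_def)
  have bnd: "norm (f n t) \<le> (a * R) ^ n / fact n"
    if "\<And>n. norm (f n t) \<le> (a * \<bar>t\<bar>) ^ n / fact n" "\<bar>t\<bar> \<le> R"
    for f :: "nat \<Rightarrow> real \<Rightarrow> complex" and n t R
    by (rule order_trans[OF that(1)]) (auto intro!: divide_right_mono power_mono mult_left_mono simp: a that)
  \<comment> \<open>Termwise derivatives of \<open>gp\<close>; the term with index 0 is constant and
    contributes 0.\<close>
  define D where "D par n t = (if n = 0 then 0 else if even n = par then of_real a * c (n - 1) t * g (n - 1) t else 0)"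
    for par :: bool and n t
  define gp where "gp par n t = (if even n = par then g n t else 0)" for par :: bool and n t
  have gpd: "(gp par n has_vector_derivative D par n t) (at t)" for par n t
  proof (cases n)
    case 0
    then show ?thesis by (cases par) (auto simp: gp_def[abs_def] D_def g_0)
  next
    case (Suc k)
    then show ?thesis using gd[of k t] by (auto simp: gp_def[abs_def] D_def)
  qed
  have gpb: "norm (gp par n t) \<le> (a * \<bar>t\<bar>) ^ n / fact n" for par n t
    using gb[of n t] a by (auto simp: gp_def)
  have gps: "summable (\<lambda>n. gp par n t)" for par t
    by (rule summable_comparison_test'[OF exp_sum[of "a * \<bar>t\<bar>"], of 0]) (use gpb in auto)
  define G where "G par t = (\<Sum>n. gp par n t)" for par t
  have GB: "norm (G par t) \<le> exp (a * \<bar>t\<bar>)" for par t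
    unfolding G_def exp_eq[symmetric]
    by (rule norm_suminf_le[OF gpb exp_sum])
  have DB: "norm (D par (Suc n) t) \<le> a * ((a * \<bar>t\<bar>) ^ n / fact n)" for par n t
    using mult_left_mono[OF gb[of n t] a] a by (auto simp: D_def norm_mult norm_c)
  have Dsum: "(\<lambda>n. D par n t) sums (of_real a * (if par then cnj (hh l m t) else hh l m t) * G (\<not> par) t)" for par t
  proof -
    have "(\<lambda>n. of_real a * (if par then cnj (hh l m t) else hh l m t) * gp (\<not> par) n t) sums
       (of_real a * (if par then cnj (hh l m t) else hh l m t) * G (\<not> par) t)"
      unfolding G_def by (intro sums_mult summable_sums gps)
    moreover have "of_real a * (if par then cnj (hh l m t) else hh l m t) * gp (\<not> par) n t = D par (Suc n) t" for n
      by (auto simp: gp_def D_def c_def)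
    ultimately have "(\<lambda>n. D par (Suc n) t) sums
       (of_real a * (if par then cnj (hh l m t) else hh l m t) * G (\<not> par) t)"
      by (simp only:)
    from sums_Suc[OF this] show ?thesis
      by (simp add: D_def)
  qed
  have Gd: "(G par has_vector_derivative (of_real a * (if par then cnj (hh l m t) else hh l m t) * G (\<not> par) t)) (at t)"
    for par t
  proof -
    define R where "R = \<bar>t\<bar> + 1"
    have "\<exists>gg. \<forall>x\<in>{-R<..<R}. (\<lambda>n. gp par n x) sums gg x \<and>
        (gg has_derivative (\<lambda>h. h *\<^sub>R (of_real a * (if par then cnj (hh l m x) else hh l m x) * G (\<not> par) x))) (at x within {-R<..<R})"
    proof (rule has_derivative_series[where f' = "\<lambda>n x h. h *\<^sub>R D par n x" and x = 0])
      show "(gp par n has_derivative (\<lambda>h. h *\<^sub>R D par n x)) (at x within {-R<..<R})" for n x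
        using gpd[of par n x] by (auto simp: has_vector_derivative_def intro: has_derivative_at_withinI)
      have "uniform_limit {-R<..<R} (\<lambda>n x. \<Sum>i<n. D par i x)
          (\<lambda>x. \<Sum>i. D par i x) sequentially"
      proof (rule Weierstrass_m_test[where M = "\<lambda>n. if n = 0 then 0 else a * ((a * R) ^ (n-1) / fact (n-1))"])
        show "norm (D par n x) \<le> (if n = 0 then 0 else a * ((a * R) ^ (n-1) / fact (n-1)))" if "x \<in> {-R<..<R}" for n x
        proof (cases n)
          case (Suc k)
          have "norm (D par (Suc k) x) \<le> a * ((a * \<bar>x\<bar>) ^ k / fact k)" by (rule DB)
          also have "\<dots> \<le> a * ((a * R) ^ k / fact k)"
            using that a by (intro mult_left_mono divide_right_mono power_mono) auto
          finally show ?thesis using Suc by simp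
        qed (simp add: D_def)
        show "summable (\<lambda>n. if n = 0 then 0 else a * ((a * R) ^ (n-1) / fact (n-1)))"
          by (subst summable_Suc_iff[symmetric]) (use summable_mult[OF exp_sum[of "a * R"], of a] in simp)
      qed
      then have ul: "uniform_limit {-R<..<R} (\<lambda>n x. \<Sum>i<n. D par i x)
          (\<lambda>x. of_real a * (if par then cnj (hh l m x) else hh l m x) * G (\<not> par) x) sequentially"
        using Dsum by (simp add: sums_iff)
      show "\<forall>\<^sub>F n in sequentially. \<forall>x\<in>{-R<..<R}. \<forall>h.
          norm ((\<Sum>i<n. h *\<^sub>R D par i x) - h *\<^sub>R (of_real a * (if par then cnj (hh l m x) else hh l m x) * G (\<not> par) x)) \<le> e * norm h"
        if "e > 0" for e
        using uniform_limitD[OF ul that]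
      proof eventually_elim
        case (elim n)
        then show ?case
        proof (intro ballI allI)
          fix x h :: real assume x: "x \<in> {-R<..<R}"
          have "(\<Sum>i<n. h *\<^sub>R D par i x) - h *\<^sub>R (of_real a * (if par then cnj (hh l m x) else hh l m x) * G (\<not> par) x)
             = h *\<^sub>R ((\<Sum>i<n. D par i x) - (of_real a * (if par then cnj (hh l m x) else hh l m x) * G (\<not> par) x))"
            by (simp add: scaleR_right_diff_distrib scaleR_sum_right)
          then show "norm ((\<Sum>i<n. h *\<^sub>R D par i x) - h *\<^sub>R (of_real a * (if par then cnj (hh l m x) else hh l m x) * G (\<not> par) x)) \<le> e * norm h"
            using elim[rule_format, OF x]
            by (simp add: dist_norm mult.commute[of e] mult_left_mono less_imp_le)
        qed
      qed
      show "(\<lambda>n. gp par n 0) sums G par 0"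
        unfolding G_def by (intro summable_sums gps)
    qed (auto simp: R_def)
    then obtain gg where gg: "\<And>x. x\<in>{-R<..<R} \<Longrightarrow> (\<lambda>n. gp par n x) sums gg x"
      and gg': "\<And>x. x\<in>{-R<..<R} \<Longrightarrow> (gg has_vector_derivative (of_real a * (if par then cnj (hh l m x) else hh l m x) * G (\<not> par) x)) (at x within {-R<..<R})"
      unfolding has_vector_derivative_def by blast
    have ggG: "gg x = G par x" if "x\<in>{-R<..<R}" for x
      using gg[OF that] by (simp add: sums_iff G_def)
    have tR: "t \<in> {-R<..<R}" by (auto simp: R_def)
    have "(gg has_vector_derivative (of_real a * (if par then cnj (hh l m t) else hh l m t) * G (\<not> par) t)) (at t)"
      using gg'[OF tR] has_vector_derivative_within_open[OF tR open_greaterThanLessThan] by blast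
    then show ?thesis
      by (rule has_vector_derivative_transform_within_open[OF _ _ tR]) (use ggG in auto)
  qed
  have "G True 0 = 1"
  proof -
    have "gp True n 0 = (if n = 0 then 1 else 0)" for n
      by (cases n) (auto simp: gp_def g_0 g0)
    then show ?thesis using suminf_finite[of "{0}" "\<lambda>n. gp True n 0"] by (simp add: G_def)
  qed
  moreover have "G False 0 = 0"
  proof -
    have "gp False n 0 = 0" for n
      by (cases n) (auto simp: gp_def g_0 g0)
    then show ?thesis by (simp add: G_def)
  qed
  moreover have "lin_sol a l m (G True) (G False)"
    unfolding lin_sol_def using Gd[of True] Gd[of False] by simp
  ultimately show ?thesis using GB by blast
qed

text \<open>This real structure completes one solution to a fundamental system and puts the
  fundamental matrix into SU(1,1).\<close>

lemma lin_sol_cnj: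
  "lin_sol a l m P Q \<Longrightarrow> lin_sol a l m (\<lambda>t. cnj (Q t)) (\<lambda>t. cnj (P t))"
  unfolding lin_sol_def by (auto intro!: derivative_eq_intros)

lemma lin_sol_swap:
  "lin_sol a l m P Q \<Longrightarrow> lin_sol a (- l) (- m) Q P"
  unfolding lin_sol_def by (auto simp: hh_neg)

lemma lin_sol_comb:
  assumes "lin_sol a l m P Q" "lin_sol a l m P' Q'"
  shows "lin_sol a l m (\<lambda>t. x * P t + y * P' t) (\<lambda>t. x * Q t + y * Q' t)"
  using assms unfolding lin_sol_def
  by (auto intro!: derivative_eq_intros simp: algebra_simps)

lemma has_vector_derivative_compose_real:
  fixes f :: "real \<Rightarrow> 'a::real_normed_vector"
  assumes "(f has_vector_derivative f') (at (g t))" "(g has_real_derivative g') (at t)"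
  shows "((\<lambda>t. f (g t)) has_vector_derivative (g' *\<^sub>R f')) (at t)"
  using vector_diff_chain_at[of g g' t f f'] assms
  by (simp add: o_def has_real_derivative_iff_has_vector_derivative)

text \<open>Time reversal, from the oddness of the phase of \<open>hh\<close>. It is the source of
  the reality of the off-diagonal monodromy entry.\<close>

lemma lin_sol_reflect:
  assumes "lin_sol a l m P Q"
  shows "lin_sol a l m (\<lambda>t. Q (- t)) (\<lambda>t. - P (- t))"
proof -
  have d: "((\<lambda>t. - t) has_real_derivative (-1)) (at t)" for t :: real
    by (auto intro!: derivative_eq_intros)
  have P: "(P has_vector_derivative complex_of_real a * cnj (hh l m t) * Q t) (at t)"
    and Q: "(Q has_vector_derivative complex_of_real a * hh l m t * P t) (at t)" for t
    using assms by (auto simp: lin_sol_def)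
  show ?thesis
    unfolding lin_sol_def
    using has_vector_derivative_compose_real[OF P d] has_vector_derivative_compose_real[OF Q d]
    by (auto simp: hh_minus intro!: derivative_eq_intros)
qed

text \<open>A shift by one period multiplies \<open>hh\<close> by \<open>cis (2 * pi * l)\<close>.
  Splitting this factor into square roots of opposite exponent on the two components restores the
  system for every real \<open>l\<close>.\<close>

lemma lin_sol_shift:
  assumes "lin_sol a l m P Q"
  shows "lin_sol a l m (\<lambda>t. cis (pi * l) * P (t + 2 * pi)) (\<lambda>t. cis (- (pi * l)) * Q (t + 2 * pi))"
proof -
  have d: "((\<lambda>t. t + 2 * pi) has_real_derivative 1) (at t)" for t :: real
    by (auto intro!: derivative_eq_intros)
  have P: "(P has_vector_derivative complex_of_real a * cnj (hh l m t) * Q t) (at t)"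
    and Q: "(Q has_vector_derivative complex_of_real a * hh l m t * P t) (at t)" for t
    using assms by (auto simp: lin_sol_def)
  note 1 = has_vector_derivative_compose_real[OF Q d]
  note 2 = has_vector_derivative_compose_real[OF P d]
  have c: "cis (- (pi * l)) * cis (2 * pi * l) = cis (pi * l)" "cis (pi * l) * cnj (cis (2 * pi * l)) = cis (- (pi * l))"
    by (simp_all add: cis_mult cis_cnj)
  show ?thesis
    unfolding lin_sol_def
  proof (intro allI conjI)
    fix t
    show "((\<lambda>t. cis (pi * l) * P (t + 2 * pi)) has_vector_derivative
          complex_of_real a * cnj (hh l m t) * (cis (- (pi * l)) * Q (t + 2 * pi))) (at t)"
      by (rule has_vector_derivative_eq_rhs[OF has_vector_derivative_mult_right[OF 2]])
         (simp only: scaleR_one hh_shift c(2)[symmetric] complex_cnj_mult, simp only: mult_ac)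
    show "((\<lambda>t. cis (- (pi * l)) * Q (t + 2 * pi)) has_vector_derivative
          complex_of_real a * hh l m t * (cis (pi * l) * P (t + 2 * pi))) (at t)"
      by (rule has_vector_derivative_eq_rhs[OF has_vector_derivative_mult_right[OF 1]])
         (simp only: scaleR_one hh_shift c(1)[symmetric], simp only: mult_ac)
  qed
qed

text \<open>The two solutions may belong to different parameters; only the difference of the
  coefficients remains. This serves both the conservation of the Wronskian and the Lipschitz
  estimates in \<open>m\<close>.\<close>

lemma wronskian_deriv:
  assumes "lin_sol a l m P Q" "lin_sol a l' m' P' Q'"
  shows "((\<lambda>t. P t * Q' t - Q t * P' t) has_vector_derivative
     (of_real a * ((hh l' m' t - hh l m t) * P t * P' t - cnj (hh l' m' t - hh l m t) * Q t * Q' t))) (at t)"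
  using assms unfolding lin_sol_def
  by (auto intro!: derivative_eq_intros simp: algebra_simps)

lemma constant_if_zero_deriv:
  fixes f :: "real \<Rightarrow> 'a::real_normed_vector"
  assumes "\<And>t. (f has_vector_derivative 0) (at t)"
  shows "f s = f t"
proof -
  obtain c where "\<And>x. x \<in> UNIV \<Longrightarrow> f x = c"
    by (rule has_vector_derivative_zero_constant[of UNIV f]) (use assms in auto)
  then show ?thesis by simp
qed

lemma wronskian_const:
  assumes "lin_sol a l m P Q" "lin_sol a l m P' Q'"
  shows "P t * Q' t - Q t * P' t = P 0 * Q' 0 - Q 0 * P' 0"
  by (rule constant_if_zero_deriv) (use wronskian_deriv[OF assms] in simp)

lemma reflected_product_const:
  assumes "lin_sol a l m P Q" "lin_sol a l m P' Q'"
  shows "P (- t) * P' t + Q (- t) * Q' t = P 0 * P' 0 + Q 0 * Q' 0"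
  using wronskian_const[OF lin_sol_reflect[OF assms(1)] assms(2), of t] by (simp add: algebra_simps)

definition fund :: "real \<Rightarrow> real \<Rightarrow> real \<Rightarrow> (real \<Rightarrow> complex) \<times> (real \<Rightarrow> complex)" where
  "fund a l m = (SOME (P, Q). lin_sol a l m P Q \<and> P 0 = 1 \<and> Q 0 = 0 \<and>
      (\<forall>t. norm (P t) \<le> exp (a * \<bar>t\<bar>)) \<and> (\<forall>t. norm (Q t) \<le> exp (a * \<bar>t\<bar>)))"

definition fundP where "fundP a l m = fst (fund a l m)"
definition fundQ where "fundQ a l m = snd (fund a l m)"

lemma fund:
  assumes "a \<ge> 0"
  shows "lin_sol a l m (fundP a l m) (fundQ a l m)" "fundP a l m 0 = 1" "fundQ a l m 0 = 0"
    "norm (fundP a l m t) \<le> exp (a * \<bar>t\<bar>)" "norm (fundQ a l m t) \<le> exp (a * \<bar>t\<bar>)"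
proof -
  have "case fund a l m of (P, Q) \<Rightarrow> lin_sol a l m P Q \<and> P 0 = 1 \<and> Q 0 = 0 \<and>
      (\<forall>t. norm (P t) \<le> exp (a * \<bar>t\<bar>)) \<and> (\<forall>t. norm (Q t) \<le> exp (a * \<bar>t\<bar>))"
    unfolding fund_def by (rule someI_ex) (use lin_sol_exists[OF assms, of l m] in simp)
  then show "lin_sol a l m (fundP a l m) (fundQ a l m)" "fundP a l m 0 = 1" "fundQ a l m 0 = 0"
    "norm (fundP a l m t) \<le> exp (a * \<bar>t\<bar>)" "norm (fundQ a l m t) \<le> exp (a * \<bar>t\<bar>)"
    by (auto simp: fundP_def fundQ_def split: prod.splits)
qed

lemma fund_det:
  assumes "a \<ge> 0"
  shows "fundP a l m t * cnj (fundP a l m t) - fundQ a l m t * cnj (fundQ a l m t) = 1"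
  using wronskian_const[OF fund(1)[OF assms] lin_sol_cnj[OF fund(1)[OF assms]], of l m t]
    fund(2,3)[OF assms, of l m] by simp

text \<open>Cramer's rule: the coordinates are the constant Wronskians against the fundamental
  solution and its conjugate.\<close>

lemma lin_sol_repr:
  assumes a: "a \<ge> 0" and X: "lin_sol a l m X Y"
  shows "X t = X 0 * fundP a l m t + Y 0 * cnj (fundQ a l m t)"
    "Y t = X 0 * fundQ a l m t + Y 0 * cnj (fundP a l m t)"
proof -
  let ?P = "fundP a l m t" and ?Q = "fundQ a l m t"
  have 1: "?P * Y t - ?Q * X t = Y 0"
    using wronskian_const[OF fund(1)[OF a] X, of t] fund(2,3)[OF a, of l m] by simp
  have 2: "cnj ?Q * Y t - cnj ?P * X t = - X 0"
    using wronskian_const[OF lin_sol_cnj[OF fund(1)[OF a]] X, of t] fund(2,3)[OF a, of l m] by simp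
  note d = fund_det[OF a, of l m t]
  have "X t = (?P * cnj ?P - ?Q * cnj ?Q) * X t" "Y t = (?P * cnj ?P - ?Q * cnj ?Q) * Y t"
    by (simp_all add: d)
  moreover have "(?P * cnj ?P - ?Q * cnj ?Q) * X t
      = cnj ?Q * (?P * Y t - ?Q * X t) - ?P * (cnj ?Q * Y t - cnj ?P * X t)"
    and "(?P * cnj ?P - ?Q * cnj ?Q) * Y t
      = cnj ?P * (?P * Y t - ?Q * X t) - ?Q * (cnj ?Q * Y t - cnj ?P * X t)"
    by (simp_all add: algebra_simps)
  ultimately show "X t = X 0 * ?P + Y 0 * cnj ?Q" "Y t = X 0 * ?Q + Y 0 * cnj ?P"
    unfolding 1 2 by (simp_all add: algebra_simps)
qed

lemma norm_hh_diff_le: "norm (hh l m' t - hh l m t) \<le> 2 * \<bar>m' - m\<bar>"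
proof -
  have "norm (cis x - cis y) \<le> 1 * norm (x - y)" for x y
  proof (rule differentiable_bound[where S = UNIV])
    fix t :: real
    show "(cis has_derivative (\<lambda>h. h *\<^sub>R (\<i> * cis t))) (at t within UNIV)"
      using has_vector_derivative_cis[OF DERIV_ident, of t] by (simp add: has_vector_derivative_def)
    show "onorm (\<lambda>h. h *\<^sub>R (\<i> * cis t)) \<le> 1"
      by (intro onorm_bound) (auto simp: norm_mult)
  qed auto
  then have "norm (hh l m' t - hh l m t) \<le> \<bar>2 * (m' - m) * sin t\<bar>"
    unfolding hh_def by (rule order_trans) (simp add: algebra_simps)
  also have "\<dots> \<le> 2 * \<bar>m' - m\<bar>"
    using mult_left_mono[OF abs_sin_le_one[of t], of "2 * \<bar>m' - m\<bar>"] by (simp only: abs_mult) simp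
  finally show ?thesis .
qed

text \<open>With M = \<open>exp (2 * pi * a)\<close>: \<open>4 * a\<close> times M^2 bounds the rate
  of change of a Wronskian per unit of |m' - m|, \<open>2 * pi\<close> is the length of the period,
  and 2 M is the cost of passing from Wronskians back to components.\<close>

definition lipC :: "real \<Rightarrow> real" where
  "lipC a = 2 * exp (2 * pi * a) * (2 * pi * (4 * a * exp (2 * pi * a) ^ 2))"

text \<open>Variation of constants. The quantities \<open>c1\<close> and \<open>c2\<close> are the
  Wronskians of the solution for \<open>m'\<close> against the basis for \<open>m\<close>, minus
  their initial values; they drift only at the rate of the coefficient difference.\<close>

lemma fund_lipschitz:
  assumes a: "a \<ge> 0" and t: "0 \<le> t" "t \<le> 2 * pi"
  shows "norm (fundP a l m' t - fundP a l m t) \<le> lipC a * \<bar>m' - m\<bar>"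
    "norm (fundQ a l m' t - fundQ a l m t) \<le> lipC a * \<bar>m' - m\<bar>"
proof -
  define M where "M = exp (2 * pi * a)"
  define K where "K = 4 * a * M ^ 2 * \<bar>m' - m\<bar>"
  let ?P = "fundP a l m" and ?Q = "fundQ a l m"
  let ?X = "fundP a l m'" and ?Y = "fundQ a l m'"
  have M: "norm (?P s) \<le> M" "norm (?Q s) \<le> M" "norm (?X s) \<le> M" "norm (?Y s) \<le> M"
    if "s \<in> {0..2*pi}" for s
  proof -
    have "exp (a * \<bar>s\<bar>) \<le> M" using that a by (auto simp: M_def mult.commute[of _ a] intro!: mult_left_mono)
    then show "norm (?P s) \<le> M" "norm (?Q s) \<le> M" "norm (?X s) \<le> M" "norm (?Y s) \<le> M"
      using fund(4,5)[OF a] order_trans by blast+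
  qed
  have M0: "M \<ge> 0" by (simp add: M_def)
  have K0: "K \<ge> 0" using a by (simp add: K_def)
  have bound: "norm ((U t * ?Y t - V t * ?X t) - (U 0 * ?Y 0 - V 0 * ?X 0)) \<le> K * (2 * pi)"
    if UV: "lin_sol a l m U V" "\<And>s. s \<in> {0..2*pi} \<Longrightarrow> norm (U s) \<le> M" "\<And>s. s \<in> {0..2*pi} \<Longrightarrow> norm (V s) \<le> M"
    for U V
  proof -
    have "norm ((U t * ?Y t - V t * ?X t) - (U 0 * ?Y 0 - V 0 * ?X 0)) \<le> K * norm (t - 0)"
    proof (rule differentiable_bound[where S = "{0..2*pi}"])
      fix s :: real assume s: "s \<in> {0..2*pi}"
      show "((\<lambda>t. U t * ?Y t - V t * ?X t) has_derivative
        (\<lambda>x. x *\<^sub>R (of_real a * ((hh l m' s - hh l m s) * U s * ?X s - cnj (hh l m' s - hh l m s) * V s * ?Y s))))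
        (at s within {0..2*pi})"
        using wronskian_deriv[OF UV(1) fund(1)[OF a], of l m' s]
        unfolding has_vector_derivative_def by (rule has_derivative_at_withinI)
      have d: "norm (hh l m' s - hh l m s) \<le> 2 * \<bar>m' - m\<bar>" by (rule norm_hh_diff_le)
      have 1: "norm ((hh l m' s - hh l m s) * U s * ?X s) \<le> 2 * \<bar>m' - m\<bar> * M * M"
        unfolding norm_mult using UV(2)[OF s] M(3)[OF s] d M0
        by (intro mult_mono) auto
      have 2: "norm (cnj (hh l m' s - hh l m s) * V s * ?Y s) \<le> 2 * \<bar>m' - m\<bar> * M * M"
        unfolding norm_mult complex_mod_cnj using UV(3)[OF s] M(4)[OF s] d M0
        by (intro mult_mono) auto
      have "norm (of_real a * ((hh l m' s - hh l m s) * U s * ?X s - cnj (hh l m' s - hh l m s) * V s * ?Y s))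
        \<le> a * (2 * \<bar>m' - m\<bar> * M * M + 2 * \<bar>m' - m\<bar> * M * M)"
        unfolding norm_mult[of "of_real a"] using a
        by (intro mult_mono order_trans[OF norm_triangle_ineq4 add_mono[OF 1 2]]) auto
      also have "\<dots> = K" by (simp add: K_def power2_eq_square)
      finally have "norm (of_real a * ((hh l m' s - hh l m s) * U s * ?X s - cnj (hh l m' s - hh l m s) * V s * ?Y s)) \<le> K" .
      then show "onorm (\<lambda>x. x *\<^sub>R (of_real a * ((hh l m' s - hh l m s) * U s * ?X s - cnj (hh l m' s - hh l m s) * V s * ?Y s))) \<le> K"
        by (simp add: onorm_scaleR_left_lemma onorm_scaleR_left onorm_id)
    qed (use t in auto)
    also have "\<dots> \<le> K * (2 * pi)" using K0 t by (intro mult_left_mono) auto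
    finally show ?thesis .
  qed
  define c1 where "c1 = ?P t * ?Y t - ?Q t * ?X t"
  define c2 where "c2 = cnj (?Q t) * ?Y t - cnj (?P t) * ?X t + 1"
  have c1: "norm c1 \<le> K * (2 * pi)"
    using bound[OF fund(1)[OF a] M(1,2)] fund(2,3)[OF a, of l] by (simp add: c1_def)
  have c2: "norm c2 \<le> K * (2 * pi)"
    using bound[OF lin_sol_cnj[OF fund(1)[OF a]]] M fund(2,3)[OF a, of l] by (simp add: c2_def)
  note d = fund_det[OF a, of l m t]
  have ts: "t \<in> {0..2*pi}" using t by simp
  have "?X t = (?P t * cnj (?P t) - ?Q t * cnj (?Q t)) * ?X t" "?Y t = (?P t * cnj (?P t) - ?Q t * cnj (?Q t)) * ?Y t"
    by (simp_all add: d)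
  then have "?X t - ?P t = cnj (?Q t) * c1 - ?P t * c2" "?Y t - ?Q t = cnj (?P t) * c1 - ?Q t * c2"
    by (simp_all add: c1_def c2_def algebra_simps)
  moreover have "norm (u * c1 - v * c2) \<le> lipC a * \<bar>m' - m\<bar>" if "norm u \<le> M" "norm v \<le> M" for u v
  proof -
    have "norm (u * c1 - v * c2) \<le> norm (u * c1) + norm (v * c2)" by (rule norm_triangle_ineq4)
    also have "\<dots> \<le> M * (K * (2 * pi)) + M * (K * (2 * pi))"
      unfolding norm_mult using that c1 c2 M0 by (intro add_mono mult_mono) auto
    also have "\<dots> = lipC a * \<bar>m' - m\<bar>" by (simp add: lipC_def K_def M_def)
    finally show ?thesis .
  qed
  ultimately show "norm (?X t - ?P t) \<le> lipC a * \<bar>m' - m\<bar>" "norm (?Y t - ?Q t) \<le> lipC a * \<bar>m' - m\<bar>"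
    using M[OF ts] by simp_all
qed

text \<open>With \<open>monb\<close>, the entries of the monodromy matrix after correction by the
  phases of \<open>lin_sol_shift\<close>. Without this correction the off-diagonal entry need not be
  real.\<close>

definition mona :: "real \<Rightarrow> real \<Rightarrow> real \<Rightarrow> complex" where
  "mona a l m = cis (pi * l) * fundP a l m (2 * pi)"

definition monb :: "real \<Rightarrow> real \<Rightarrow> real \<Rightarrow> real" where
  "monb a l m = Re (cis (- (pi * l)) * fundQ a l m (2 * pi))"

text \<open>The conserved product of the shifted solution, reflected, with the conjugate solution
  equals this entry at time 0 and its conjugate at time \<open>2 * pi\<close>. So time reversal
  forces the entry to be real.\<close>

lemma monb:
  assumes a: "a \<ge> 0"
  shows "cis (- (pi * l)) * fundQ a l m (2 * pi) = of_real (monb a l m)"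
proof -
  let ?b = "cis (- (pi * l)) * fundQ a l m (2 * pi)"
  have "cnj ?b = ?b"
    using reflected_product_const[OF lin_sol_shift[OF fund(1)[OF a]] lin_sol_cnj[OF fund(1)[OF a]], of l m "2 * pi"]
      fund(2,3)[OF a, of l m]
    by (simp add: cis_cnj)
  then have "?b \<in> \<real>" by (simp only: Reals_cnj_iff)
  then show ?thesis
    unfolding monb_def by (metis of_real_Re)
qed

lemma monodromy_det:
  assumes a: "a \<ge> 0"
  shows "(norm (mona a l m))\<^sup>2 - (monb a l m)\<^sup>2 = 1"
proof -
  have "(norm (fundP a l m (2 * pi)))\<^sup>2 - (norm (fundQ a l m (2 * pi)))\<^sup>2 = 1"
    using arg_cong[OF fund_det[OF a, of l m "2 * pi"], of Re]
    by (simp add: complex_norm_square[symmetric] del: of_real_power of_real_diff)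
  moreover have "norm (fundQ a l m (2 * pi)) = \<bar>monb a l m\<bar>"
    using arg_cong[OF monb[OF a, of l m], of norm] by (simp add: norm_mult)
  ultimately show ?thesis
    by (simp add: mona_def norm_mult)
qed

lemma lin_sol_monodromy:
  assumes a: "a \<ge> 0" and X: "lin_sol a l m X Y"
  shows "cis (pi * l) * X (2 * pi) = mona a l m * X 0 + of_real (monb a l m) * Y 0"
    "cis (- (pi * l)) * Y (2 * pi) = of_real (monb a l m) * X 0 + cnj (mona a l m) * Y 0"
proof -
  have c: "cis (pi * l) * cnj (fundQ a l m (2 * pi)) = of_real (monb a l m)"
    using arg_cong[OF monb[OF a, of l m], of cnj] by (simp add: cis_cnj)
  show "cis (pi * l) * X (2 * pi) = mona a l m * X 0 + of_real (monb a l m) * Y 0"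
    unfolding lin_sol_repr(1)[OF a X, of "2 * pi"] c[symmetric] by (simp add: mona_def algebra_simps)
  show "cis (- (pi * l)) * Y (2 * pi) = of_real (monb a l m) * X 0 + cnj (mona a l m) * Y 0"
    unfolding lin_sol_repr(2)[OF a X, of "2 * pi"] monb[OF a, symmetric]
    by (simp add: mona_def cis_cnj algebra_simps)
qed

subsection \<open>The Poincare map\<close>

locale josephson =
  fixes w :: real
  assumes w_pos: "w > 0"
begin

lemma jos_solution_iff:
  "jos_solution w B A \<phi> \<longleftrightarrow>
     (\<forall>t. (\<phi> has_real_derivative (B / w + A / w * cos t - sin (\<phi> t) / w)) (at t))"
  unfolding jos_solution_def using w_pos by (simp add: algebra_simps)

text \<open>Initial values that are conjugate to each other keep \<open>Y\<close> conjugate to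
  \<open>X\<close> for all times. Hence \<open>hh * X / Y\<close> stays on the unit circle, and the
  Riccati equation there is the equation for \<phi>.\<close>

lemma jos_solution_exists:
  "\<exists>\<phi> X Y. jos_solution w B A \<phi> \<and> \<phi> 0 = x \<and>
      lin_sol (1 / (2 * w)) (B / w) (A / (2 * w)) X Y \<and> X 0 = cis (x / 2) \<and> Y 0 = cis (- (x / 2)) \<and>
      (\<forall>t. cis (\<phi> t) * Y t = hh (B / w) (A / (2 * w)) t * X t)"
proof -
  define a l m where "a = 1 / (2 * w)" and "l = B / w" and "m = A / (2 * w)"
  have a: "a \<ge> 0" using w_pos by (simp add: a_def)
  define X where "X t = cis (x / 2) * fundP a l m t + cis (- (x / 2)) * cnj (fundQ a l m t)" for t
  define Y where "Y t = cis (x / 2) * fundQ a l m t + cis (- (x / 2)) * cnj (fundP a l m t)" for t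
  have XY: "lin_sol a l m X Y"
    unfolding X_def[abs_def] Y_def[abs_def]
    by (intro lin_sol_comb lin_sol_cnj fund(1) a)
  have X0: "X 0 = cis (x / 2)" and Y0: "Y 0 = cis (- (x / 2))"
    using fund(2,3)[OF a, of l m] by (simp_all add: X_def Y_def)
  have YX: "Y t = cnj (X t)" for t
    by (simp add: X_def Y_def cis_cnj)
  have Xnz: "X t \<noteq> 0" for t
  proof
    assume "X t = 0"
    then have "cis (x / 2) * fundP a l m t = - (cis (- (x / 2)) * cnj (fundQ a l m t))"
      by (simp add: X_def eq_neg_iff_add_eq_0)
    from arg_cong[OF this, of norm] have "norm (fundP a l m t) = norm (fundQ a l m t)"
      by (simp add: norm_mult)
    then show False
      using fund_det[OF a, of l m t] by (simp add: complex_norm_square[symmetric])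
  qed
  have Xd: "(X has_vector_derivative (of_real a * cnj (hh l m t) * Y t)) (at t)"
    and Yd: "(Y has_vector_derivative (of_real a * hh l m t * X t)) (at t)" for t
    using XY by (auto simp: lin_sol_def)
  define Ph where "Ph t = hh l m t * X t * inverse (Y t)" for t
  have Ynz: "Y t \<noteq> 0" for t by (simp add: YX Xnz)
  have iY: "((\<lambda>t. inverse (Y t)) has_vector_derivative (- (of_real a * hh l m t * X t) * inverse (Y t) ^ 2)) (at t)" for t
    using field_vector_diff_chain_at[OF Yd DERIV_inverse[OF Ynz]]
    by (simp add: o_def power2_eq_square)
  have Phd: "(Ph has_vector_derivative (\<i> * of_real (l + 2 * m * cos t) * Ph t + of_real a - of_real a * Ph t ^ 2)) (at t)" for t
  proof -
    define f H X' Y' Z where "f = complex_of_real (l + 2 * m * cos t)" and "H = hh l m t"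
      and "X' = X t" and "Y' = Y t" and "Z = inverse (Y t)"
    have "H * (of_real a * cnj H * Y') * Z = of_real a * (H * cnj H) * (Y' * Z)"
      by (simp only: mult_ac)
    also have "\<dots> = of_real a"
      using Ynz[of t] by (simp add: H_def Y'_def Z_def)
    finally have e: "H * (of_real a * cnj H * Y') * Z = of_real a" .
    have "H * X' * (- (of_real a * H * X') * Z ^ 2) + (H * (of_real a * cnj H * Y') + \<i> * f * H * X') * Z
       = \<i> * f * (H * X' * Z) + H * (of_real a * cnj H * Y') * Z - of_real a * (H * X' * Z) ^ 2"
      by (simp add: distrib_left distrib_right power2_eq_square mult_ac)
    also have "\<dots> = \<i> * f * (H * X' * Z) + of_real a - of_real a * (H * X' * Z) ^ 2"
      unfolding e ..
    finally have eq: "H * X' * (- (of_real a * H * X') * Z ^ 2) + (H * (of_real a * cnj H * Y') + \<i> * f * H * X') * Z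
       = \<i> * f * (H * X' * Z) + of_real a - of_real a * (H * X' * Z) ^ 2" .
    show ?thesis
      unfolding Ph_def[abs_def]
      by (rule has_vector_derivative_eq_rhs[OF has_vector_derivative_mult[OF has_vector_derivative_mult[OF hh_deriv Xd] iY]])
        (rule eq[unfolded H_def X'_def Y'_def Z_def f_def])
  qed
  have Ph_cont: "continuous_on UNIV Ph"
    by (meson Phd continuous_at_imp_continuous_on has_vector_derivative_continuous)
  have nPh: "Ph t * cnj (Ph t) = 1" for t
  proof -
    have "norm (Ph t) = 1" using Xnz[of t] by (simp add: Ph_def norm_mult norm_inverse YX)
    then show ?thesis by (simp add: complex_norm_square[symmetric])
  qed
  \<comment> \<open>The lift is not obtained by choosing an argument of \<open>Ph\<close>. It is an
    antiderivative of the right-hand side in which \<open>Im (Ph t)\<close> stands for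
    \<open>sin (\<phi> t)\<close>; that \<open>Ph * cis (- \<phi>)\<close> has derivative 0 then
    identifies the two.\<close>
  have "continuous_on UNIV (\<lambda>t. l + 2 * m * cos t - 2 * a * Im (Ph t))"
    by (intro continuous_intros Ph_cont)
  from continuous_antiderivative[OF this] obtain G where G: "G 0 = 0"
    "\<And>t. (G has_vector_derivative (l + 2 * m * cos t - 2 * a * Im (Ph t))) (at t)" by blast
  define \<phi> where "\<phi> t = x + G t" for t
  have \<phi>d: "(\<phi> has_real_derivative (l + 2 * m * cos t - 2 * a * Im (Ph t))) (at t)" for t
    unfolding \<phi>_def[abs_def] using G(2)[of t]
    by (auto intro!: derivative_eq_intros simp: has_real_derivative_iff_has_vector_derivative)
  have "((\<lambda>t. Ph t * cis (- \<phi> t)) has_vector_derivative 0) (at t)" for t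
  proof -
    have "((\<lambda>t. - \<phi> t) has_real_derivative (- (l + 2 * m * cos t - 2 * a * Im (Ph t)))) (at t)"
      by (intro DERIV_minus \<phi>d)
    note d = has_vector_derivative_mult[OF Phd[of t] has_vector_derivative_cis[OF this]]
    have im: "2 * \<i> * of_real (Im (Ph t)) = Ph t - cnj (Ph t)"
      by (simp add: complex_eq_iff)
    have "Ph t * (\<i> * of_real (- (l + 2 * m * cos t - 2 * a * Im (Ph t)))) +
        (\<i> * of_real (l + 2 * m * cos t) * Ph t + of_real a - of_real a * Ph t ^ 2)
        = of_real a * Ph t * (2 * \<i> * of_real (Im (Ph t))) + of_real a - of_real a * Ph t ^ 2"
      by (simp add: algebra_simps)
    also have "\<dots> = of_real a - of_real a * (Ph t * cnj (Ph t))"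
      unfolding im by (simp add: algebra_simps power2_eq_square)
    also have "\<dots> = 0" by (simp add: nPh)
    finally have z: "Ph t * (\<i> * of_real (- (l + 2 * m * cos t - 2 * a * Im (Ph t)))) +
        (\<i> * of_real (l + 2 * m * cos t) * Ph t + of_real a - of_real a * Ph t ^ 2) = 0" .
    show ?thesis
      by (rule has_vector_derivative_eq_rhs[OF d])
         (use arg_cong[OF z, of "\<lambda>z. z * cis (- \<phi> t)"] in \<open>simp only: distrib_right mult_zero_left mult.assoc\<close>)
  qed
  then have "Ph t * cis (- \<phi> t) = Ph 0 * cis (- \<phi> 0)" for t
    by (rule constant_if_zero_deriv)
  moreover have "Ph 0 * cis (- \<phi> 0) = 1"
    by (simp add: Ph_def X0 Y0 \<phi>_def G(1) cis_inverse cis_mult)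
  ultimately have "Ph t * cis (- \<phi> t) * cis (\<phi> t) = cis (\<phi> t)" for t by simp
  then have Ph: "Ph t = cis (\<phi> t)" for t
    by (simp add: mult.assoc cis_mult)
  have "jos_solution w B A \<phi>"
    unfolding jos_solution_iff using \<phi>d w_pos
    by (auto simp: Ph a_def l_def m_def)
  moreover have "cis (\<phi> t) * Y t = hh l m t * X t" for t
    using Ynz[of t] by (simp add: Ph[symmetric] Ph_def)
  moreover have "\<phi> 0 = x" by (simp add: \<phi>_def G)
  ultimately show ?thesis
    using XY X0 Y0 unfolding a_def l_def m_def by blast
qed

lemma abs_sin_diff_le: "\<bar>sin x - sin y\<bar> \<le> \<bar>x - y :: real\<bar>"
proof -
  have "\<bar>sin x - sin y\<bar> = 2 * \<bar>sin ((x - y) / 2)\<bar> * \<bar>cos ((x + y) / 2)\<bar>"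
    by (simp add: sin_diff_sin abs_mult)
  also have "\<dots> \<le> 2 * \<bar>(x - y) / 2\<bar> * 1"
    by (intro mult_mono abs_sin_x_le_abs_x abs_cos_le_one) auto
  finally show ?thesis by simp
qed

text \<open>Gronwall for the square of the difference, which is differentiable where the absolute
  value is not. Adding the constant \<open>e\<^sup>2\<close> absorbs the inhomogeneity from the
  change of parameters.\<close>

lemma jos_gronwall:
  assumes \<phi>: "jos_solution w B A \<phi>" and \<psi>: "jos_solution w B' A' \<psi>" and st: "s \<le> t"
  shows "(\<phi> t - \<psi> t)\<^sup>2 \<le> ((\<phi> s - \<psi> s)\<^sup>2 + ((\<bar>B - B'\<bar> + \<bar>A - A'\<bar>) / w)\<^sup>2) * exp ((2 / w + 1) * (t - s))"
proof -
  define e where "e = (\<bar>B - B'\<bar> + \<bar>A - A'\<bar>) / w"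
  define K where "K = 2 / w + 1"
  define D where "D t = \<phi> t - \<psi> t" for t
  define D' where "D' t = (B - B') / w + (A - A') / w * cos t - (sin (\<phi> t) - sin (\<psi> t)) / w" for t
  have Dd: "(D has_real_derivative D' t) (at t)" for t
    unfolding D_def[abs_def] D'_def
    using \<phi>[unfolded jos_solution_iff, rule_format, of t] \<psi>[unfolded jos_solution_iff, rule_format, of t]
    by (auto intro!: derivative_eq_intros simp: diff_divide_distrib algebra_simps)
  have D'b: "\<bar>D' t\<bar> \<le> \<bar>D t\<bar> / w + e" for t
  proof -
    have "\<bar>D' t\<bar> \<le> \<bar>(B - B') / w\<bar> + \<bar>(A - A') / w * cos t\<bar> + \<bar>(sin (\<phi> t) - sin (\<psi> t)) / w\<bar>"
      unfolding D'_def by linarith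
    also have "\<dots> \<le> \<bar>B - B'\<bar> / w + \<bar>A - A'\<bar> / w * 1 + \<bar>D t\<bar> / w"
      using w_pos abs_sin_diff_le[of "\<phi> t" "\<psi> t"] mult_left_mono[OF abs_cos_le_one[of t], of "\<bar>A - A'\<bar> / w"]
      by (intro add_mono) (auto simp: abs_mult D_def intro!: divide_right_mono)
    finally show ?thesis by (simp add: e_def add_divide_distrib)
  qed
  have key: "2 * D t * D' t \<le> K * (D t ^ 2 + e ^ 2)" for t
  proof -
    have "2 * D t * D' t \<le> 2 * \<bar>D t\<bar> * \<bar>D' t\<bar>"
      by (metis abs_ge_self abs_mult abs_numeral)
    also have "\<dots> \<le> 2 * \<bar>D t\<bar> * (\<bar>D t\<bar> / w + e)"
      by (intro mult_left_mono D'b) auto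
    also have "\<dots> = 2 / w * D t ^ 2 + 2 * \<bar>D t\<bar> * e"
      by (simp add: algebra_simps power2_eq_square)
    also have "\<dots> \<le> 2 / w * D t ^ 2 + (D t ^ 2 + e ^ 2)"
      using sum_squares_bound[of "\<bar>D t\<bar>" e] by simp
    also have "\<dots> \<le> K * (D t ^ 2 + e ^ 2)"
      using w_pos by (simp add: K_def algebra_simps)
    finally show ?thesis .
  qed
  define E where "E t = (D t ^ 2 + e ^ 2) * exp (- K * t)" for t
  have "E t \<le> E s"
  proof (rule DERIV_nonpos_imp_nonincreasing[OF st])
    fix x
    have "(E has_real_derivative (2 * D x * D' x - K * (D x ^ 2 + e ^ 2)) * exp (- K * x)) (at x)"
      unfolding E_def[abs_def]
      by (auto intro!: derivative_eq_intros Dd simp: algebra_simps)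
    moreover have "(2 * D x * D' x - K * (D x ^ 2 + e ^ 2)) * exp (- K * x) \<le> 0"
      using key[of x] by (intro mult_nonpos_nonneg) auto
    ultimately show "\<exists>y. (E has_real_derivative y) (at x) \<and> y \<le> 0" by blast
  qed
  then have "E t * exp (K * t) \<le> E s * exp (K * t)" by simp
  moreover have "E t * exp (K * t) = D t ^ 2 + e ^ 2" "E s * exp (K * t) = (D s ^ 2 + e ^ 2) * exp (K * (t - s))"
    by (simp_all add: E_def mult.assoc exp_add[symmetric]) (simp add: algebra_simps)
  ultimately have "D t ^ 2 + e ^ 2 \<le> (D s ^ 2 + e ^ 2) * exp (K * (t - s))"
    by simp
  moreover have "0 \<le> e ^ 2" by simp
  ultimately have "D t ^ 2 \<le> (D s ^ 2 + e ^ 2) * exp (K * (t - s))" by linarith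
  then show ?thesis by (simp add: D_def e_def K_def)
qed

lemma jos_unique:
  assumes "jos_solution w B A \<phi>" "jos_solution w B A \<psi>" "\<phi> s = \<psi> s" "s \<le> t"
  shows "\<phi> t = \<psi> t"
  using jos_gronwall[OF assms(1,2,4)] assms(3) by simp

lemma jos_add:
  assumes "jos_solution w B A \<phi>"
  shows "jos_solution w B A (\<lambda>t. \<phi> t + 2 * pi * of_int n)"
proof -
  have "sin (x + 2 * pi * of_int n) = sin x" for x :: real
    using sin_add[of x "2 * pi * of_int n"] by (simp add: sin_integer_2pi cos_integer_2pi)
  then show ?thesis
    using assms unfolding jos_solution_iff by (auto intro!: derivative_eq_intros)
qed

lemma jos_shift:
  assumes "jos_solution w B A \<phi>"
  shows "jos_solution w B A (\<lambda>t. \<phi> (t + 2 * pi))"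
  unfolding jos_solution_iff
proof
  fix t
  have "((\<lambda>t. t + 2 * pi) has_real_derivative 1) (at t)"
    by (auto intro!: derivative_eq_intros)
  from DERIV_chain2[where f = \<phi> and g = "\<lambda>t. t + 2 * pi",
      OF assms[unfolded jos_solution_iff, rule_format, of "t + 2 * pi"] this]
  show "((\<lambda>t. \<phi> (t + 2 * pi)) has_real_derivative B / w + A / w * cos t - sin (\<phi> (t + 2 * pi)) / w) (at t)"
    by simp
qed

lemma jos_continuous: "jos_solution w B A \<phi> \<Longrightarrow> continuous_on S \<phi>"
  unfolding jos_solution_iff by (meson DERIV_continuous continuous_at_imp_continuous_on)

section \<open>The Poincare map: order, dependence on the parameters, Moebius form\<close>

definition flow :: "real \<Rightarrow> real \<Rightarrow> real \<Rightarrow> real \<Rightarrow> real" where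
  "flow B A x = (SOME \<phi>. jos_solution w B A \<phi> \<and> \<phi> 0 = x)"

definition pmap :: "real \<Rightarrow> real \<Rightarrow> real \<Rightarrow> real" where
  "pmap B A x = flow B A x (2 * pi)"

lemma flow: "jos_solution w B A (flow B A x)" "flow B A x 0 = x"
proof -
  have "jos_solution w B A (flow B A x) \<and> flow B A x 0 = x"
    unfolding flow_def by (rule someI_ex[of "\<lambda>\<phi>. jos_solution w B A \<phi> \<and> \<phi> 0 = x"]) (use jos_solution_exists[of B A x] in blast)
  then show "jos_solution w B A (flow B A x)" "flow B A x 0 = x" by auto
qed

lemma pmap_eq:
  assumes "jos_solution w B A \<phi>"
  shows "\<phi> (2 * pi) = pmap B A (\<phi> 0)"
  unfolding pmap_def by (rule jos_unique[OF assms flow(1), of 0]) (auto simp: flow(2))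

lemma jos_iterate:
  assumes "jos_solution w B A \<phi>"
  shows "\<phi> (2 * pi * real k) = (pmap B A ^^ k) (\<phi> 0)"
  using assms
proof (induction k arbitrary: \<phi>)
  case (Suc k)
  show ?case
    using Suc.IH[OF jos_shift[OF Suc.prems]] pmap_eq[OF Suc.prems]
    by (simp add: algebra_simps funpow_swap1)
qed simp

lemma has_rotation_number_iff:
  "has_rotation_number w B A r \<longleftrightarrow>
     (\<exists>x. (\<lambda>k. (pmap B A ^^ k) x / (2 * pi * real k)) \<longlonglongrightarrow> r)"
proof
  assume "has_rotation_number w B A r"
  then obtain \<phi> where \<phi>: "jos_solution w B A \<phi>"
    and lim: "(\<lambda>k. \<phi> (2 * pi * real k) / (2 * pi * real k)) \<longlonglongrightarrow> r"
    unfolding has_rotation_number_def by blast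
  show "\<exists>x. (\<lambda>k. (pmap B A ^^ k) x / (2 * pi * real k)) \<longlonglongrightarrow> r"
    by (rule exI[of _ "\<phi> 0"]) (use lim in \<open>simp only: jos_iterate[OF \<phi>]\<close>)
next
  assume "\<exists>x. (\<lambda>k. (pmap B A ^^ k) x / (2 * pi * real k)) \<longlonglongrightarrow> r"
  then obtain x where lim: "(\<lambda>k. (pmap B A ^^ k) x / (2 * pi * real k)) \<longlonglongrightarrow> r" by blast
  show "has_rotation_number w B A r"
    unfolding has_rotation_number_def
    by (rule exI[of _ "flow B A x"])
       (use lim in \<open>simp only: jos_iterate[OF flow(1)] flow simp_thms\<close>)
qed

lemma pmap_add: "pmap B A (x + 2 * pi * of_int n) = pmap B A x + 2 * pi * of_int n"
  using pmap_eq[OF jos_add[OF flow(1)[of B A x], of n]]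
  by (simp only: flow(2) pmap_def[of B A x, symmetric])

text \<open>Solutions cannot cross: a change of order would produce a common value, and from there
  on the two solutions agree.\<close>

lemma pmap_mono:
  assumes "x \<le> y"
  shows "pmap B A x \<le> pmap B A y"
proof (rule ccontr)
  assume less: "\<not> pmap B A x \<le> pmap B A y"
  define D where "D t = flow B A y t - flow B A x t" for t
  have "continuous_on {0..2*pi} D"
    unfolding D_def[abs_def]
    by (intro continuous_intros jos_continuous[OF flow(1)])
  moreover have "D (2 * pi) \<le> 0" "0 \<le> D 0"
    unfolding D_def flow(2) pmap_def[symmetric] using less assms by simp_all
  ultimately have "\<exists>s\<ge>0. s \<le> 2 * pi \<and> D s = 0"
    by (intro IVT2') simp_all
  then obtain s where s: "0 \<le> s" "s \<le> 2 * pi" "D s = 0"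
    by blast
  have "flow B A x (2 * pi) = flow B A y (2 * pi)"
    by (rule jos_unique[OF flow(1)[of B A x] flow(1)[of B A y] _ s(2)]) (use s(3) in \<open>simp add: D_def\<close>)
  then show False using less by (simp add: pmap_def)
qed

text \<open>At its first zero after time 0 the function would arrive from positive values, against
  its positive derivative there.\<close>

lemma pos_if_deriv_pos_at_zeros:
  fixes g :: "real \<Rightarrow> real"
  assumes d: "\<And>t. (g has_real_derivative g' t) (at t)" and g0: "g 0 = 0"
    and pos: "\<And>t. g t = 0 \<Longrightarrow> g' t > 0" and t: "0 < t"
  shows "g t > 0"
proof (rule ccontr)
  assume "\<not> g t > 0"
  then have gt: "g t \<le> 0" by simp
  obtain e where e: "e > 0" "\<And>h. 0 < h \<Longrightarrow> h < e \<Longrightarrow> g 0 < g (0 + h)"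
    using DERIV_pos_inc_right[OF d[of 0] pos[OF g0]] by blast
  \<comment> \<open>Starting at \<open>e / 2\<close>, where the function is already positive, keeps
    the zero at 0 out of \<open>S\<close>, so the least element is a genuine first return.\<close>
  define S where "S = {s \<in> {e/2..t}. g s \<le> 0}"
  have cont: "continuous_on UNIV g"
    by (meson d DERIV_continuous continuous_at_imp_continuous_on)
  have te: "t \<ge> e" using e(2)[of t] t gt g0 by (cases "t < e") auto
  have "S = {e/2..t} \<inter> {s. g s \<le> 0}" by (auto simp: S_def)
  then have "closed S"
    by (simp add: closed_Int closed_Collect_le cont)
  moreover have "bounded S" unfolding S_def by (rule bounded_subset[of "{e/2..t}"]) auto
  ultimately have "compact S" using compact_eq_bounded_closed by blast
  moreover have "t \<in> S" using gt te e by (auto simp: S_def)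
  ultimately obtain s where s: "s \<in> S" "\<And>u. u \<in> S \<Longrightarrow> s \<le> u"
    using compact_attains_inf[of S] by blast
  have "g (e / 2) > 0" using e(2)[of "e / 2"] e(1) g0 by simp
  then have "s \<noteq> e / 2" using s(1) by (auto simp: S_def)
  then have s2: "e / 2 < s" using s(1) by (simp add: S_def)
  have lt: "g u > 0" if "e / 2 \<le> u" "u < s" for u
    using s(2)[of u] s(1) that by (auto simp: S_def not_le[symmetric])
  have "g s = 0"
  proof (rule ccontr)
    assume "g s \<noteq> 0"
    then have "g s < 0" using s(1) by (simp add: S_def)
    moreover have "g (e/2) > 0" using lt s2 by simp
    moreover have "continuous_on {e/2..s} g"
      by (rule continuous_on_subset[OF cont]) simp
    ultimately have "\<exists>u\<ge>e/2. u \<le> s \<and> g u = 0"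
      using s2 by (intro IVT2') simp_all
    then obtain u where "e/2 \<le> u" "u \<le> s" "g u = 0"
      by blast
    then show False using lt[of u] \<open>g s < 0\<close> by (cases "u = s") auto
  qed
  from DERIV_pos_inc_left[OF d[of s] pos[OF this]] obtain f where f: "f > 0"
    "\<And>h. 0 < h \<Longrightarrow> h < f \<Longrightarrow> g (s - h) < g s" by blast
  define h where "h = min (f / 2) (s - e / 2)"
  have "0 < h" "h < f" "e / 2 \<le> s - h" "s - h < s" using f(1) s2 by (auto simp: h_def min_def)
  then show False using f(2)[of h] lt[of "s - h"] \<open>g s = 0\<close> by force
qed

text \<open>Wherever the two solutions meet, their slopes differ by \<open>(B' - B) / w\<close>, so
  the solution for the larger parameter can only cross upwards.\<close>

lemma pmap_strict_mono_B:
  assumes "B < B'"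
  shows "pmap B A x < pmap B' A x"
proof -
  define \<phi> \<psi> where "\<phi> = flow B A x" and "\<psi> = flow B' A x"
  define g where "g t = \<psi> t - \<phi> t" for t
  define g' where "g' t = (B' - B) / w - (sin (\<psi> t) - sin (\<phi> t)) / w" for t
  have "g (2 * pi) > 0"
  proof (rule pos_if_deriv_pos_at_zeros[where g = g and g' = g'])
    fix t
    show "(g has_real_derivative g' t) (at t)"
      unfolding g_def[abs_def] g'_def \<phi>_def \<psi>_def
      using flow(1)[of B A x, unfolded jos_solution_iff, rule_format, of t]
         flow(1)[of B' A x, unfolded jos_solution_iff, rule_format, of t]
      by (auto intro!: derivative_eq_intros simp: diff_divide_distrib)
    show "g' t > 0" if "g t = 0"
      using that assms w_pos by (simp add: g_def g'_def)
  qed (simp_all add: g_def \<phi>_def \<psi>_def flow(2))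
  then show ?thesis by (simp add: g_def \<phi>_def \<psi>_def pmap_def)
qed

definition lipF :: real where
  "lipF = sqrt (exp ((2 / w + 1) * (2 * pi))) * (1 + 1 / w)"

lemma lipF_pos: "lipF > 0"
  unfolding lipF_def using w_pos by (auto intro!: mult_pos_pos add_pos_pos)

lemma pmap_lipschitz:
  "\<bar>pmap B A x - pmap B' A' x'\<bar> \<le> lipF * (\<bar>x - x'\<bar> + \<bar>B - B'\<bar> + \<bar>A - A'\<bar>)"
proof -
  define E where "E = exp ((2 / w + 1) * (2 * pi))"
  define e where "e = (\<bar>B - B'\<bar> + \<bar>A - A'\<bar>) / w"
  have e0: "e \<ge> 0" using w_pos by (simp add: e_def)
  have "(pmap B A x - pmap B' A' x')\<^sup>2 \<le> ((x - x')\<^sup>2 + e\<^sup>2) * E"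
    using jos_gronwall[OF flow(1)[of B A x] flow(1)[of B' A' x'], of 0 "2 * pi"]
    by (simp add: flow(2) pmap_def E_def e_def)
  also have "\<dots> \<le> (\<bar>x - x'\<bar> + e)\<^sup>2 * E"
    using e0 by (intro mult_right_mono) (auto simp: power2_sum E_def)
  also have "\<dots> = ((\<bar>x - x'\<bar> + e) * sqrt E)\<^sup>2"
    by (simp add: power_mult_distrib E_def)
  finally have "\<bar>pmap B A x - pmap B' A' x'\<bar> \<le> (\<bar>x - x'\<bar> + e) * sqrt E"
    using e0 by (subst (asm) abs_le_square_iff[symmetric]) (simp add: E_def)
  also have "\<dots> \<le> ((1 + 1 / w) * (\<bar>x - x'\<bar> + \<bar>B - B'\<bar> + \<bar>A - A'\<bar>)) * sqrt E"
    using w_pos by (intro mult_right_mono) (auto simp: e_def E_def algebra_simps add_divide_distrib)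
  finally show ?thesis by (simp add: lipF_def E_def mult_ac)
qed

lemma tendsto_pmap:
  assumes "(f \<longlongrightarrow> B) F" "(g \<longlongrightarrow> A) F" "(h \<longlongrightarrow> x) F"
  shows "((\<lambda>n. pmap (f n) (g n) (h n)) \<longlongrightarrow> pmap B A x) F"
proof (rule tendsto_dist_iff[THEN iffD2], rule tendsto_sandwich[OF always_eventually always_eventually])
  show "\<forall>n. 0 \<le> dist (pmap (f n) (g n) (h n)) (pmap B A x)" by simp
  show "\<forall>n. dist (pmap (f n) (g n) (h n)) (pmap B A x) \<le> lipF * (\<bar>h n - x\<bar> + \<bar>f n - B\<bar> + \<bar>g n - A\<bar>)"
    using pmap_lipschitz by (simp add: dist_real_def)
  have "((\<lambda>n. lipF * (\<bar>h n - x\<bar> + \<bar>f n - B\<bar> + \<bar>g n - A\<bar>)) \<longlongrightarrow> lipF * (\<bar>x - x\<bar> + \<bar>B - B\<bar> + \<bar>A - A\<bar>)) F"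
    by (intro tendsto_intros assms)
  then show "((\<lambda>n. lipF * (\<bar>h n - x\<bar> + \<bar>f n - B\<bar> + \<bar>g n - A\<bar>)) \<longlongrightarrow> 0) F" by simp
qed simp

lemma continuous_on_pmap:
  assumes "continuous_on S f" "continuous_on S g" "continuous_on S h"
  shows "continuous_on S (\<lambda>x. pmap (f x) (g x) (h x))"
  using assms unfolding continuous_on_def by (auto intro!: tendsto_pmap)

definition al :: "real \<Rightarrow> real \<Rightarrow> complex" where
  "al B A = mona (1 / (2 * w)) (B / w) (A / (2 * w))"

definition be :: "real \<Rightarrow> real \<Rightarrow> real" where
  "be B A = monb (1 / (2 * w)) (B / w) (A / (2 * w))"

text \<open>Denominator of the circle Moebius map. On the unit circle the numerator is
  \<open>cis x\<close> times the conjugate of the denominator, so the displacement of the Poincare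
  map is, modulo full turns, minus twice an argument of \<open>mden\<close>.\<close>

definition mden :: "real \<Rightarrow> real \<Rightarrow> real \<Rightarrow> complex" where
  "mden B A x = of_real (be B A) * cis x + cnj (al B A)"

lemma a_nonneg: "1 / (2 * w) \<ge> 0"
  using w_pos by simp

lemma al_be: "(norm (al B A))\<^sup>2 - (be B A)\<^sup>2 = 1"
  unfolding al_def be_def by (rule monodromy_det[OF a_nonneg])

lemma mden_nonzero: "mden B A x \<noteq> 0"
proof
  assume "mden B A x = 0"
  then have "norm (of_real (be B A) * cis x) = norm (cnj (al B A))"
    unfolding mden_def by (metis add_eq_0_iff2 norm_minus_cancel)
  then have "\<bar>be B A\<bar> = norm (al B A)" by (simp add: norm_mult)
  then have "(be B A)\<^sup>2 = (norm (al B A))\<^sup>2" by (metis power2_abs)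
  then show False using al_be[of B A] by simp
qed

lemma pmap_moebius: "cis (pmap B A x - x) * mden B A x = cnj (mden B A x)"
proof -
  define l where "l = B / w"
  obtain \<phi> X Y where \<phi>: "jos_solution w B A \<phi>" "\<phi> 0 = x"
    and XY: "lin_sol (1 / (2 * w)) (B / w) (A / (2 * w)) X Y" and X0: "X 0 = cis (x / 2)" and Y0: "Y 0 = cis (- (x / 2))"
    and r: "\<And>t. cis (\<phi> t) * Y t = hh (B / w) (A / (2 * w)) t * X t"
    using jos_solution_exists[of B A x] by blast
  have "\<phi> (2 * pi) = pmap B A x" using pmap_eq[OF \<phi>(1)] \<phi>(2) by simp
  then have "cis (pmap B A x) * Y (2 * pi) = cis (2 * pi * l) * X (2 * pi)"
    using r[of "2 * pi"] hh_shift[of "B / w" "A / (2 * w)" 0] by (simp add: l_def)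
  then have "cis (pmap B A x) * (cis (- (pi * l)) * Y (2 * pi)) = cis (- (pi * l)) * cis (2 * pi * l) * X (2 * pi)"
    by (simp only: mult_ac)
  also have "cis (- (pi * l)) * cis (2 * pi * l) = cis (pi * l)" by (simp add: cis_mult)
  finally have e: "cis (pmap B A x) * (of_real (be B A) * cis (x / 2) + cnj (al B A) * cis (- (x / 2)))
      = al B A * cis (x / 2) + of_real (be B A) * cis (- (x / 2))"
    using lin_sol_monodromy[OF a_nonneg XY] by (simp add: l_def al_def be_def X0 Y0)
  have c: "cis (x / 2) * cis (x / 2) = cis x" "cis (- (x / 2)) * cis (x / 2) = 1" "cis (- (x/2)) * cis (- (x / 2)) = cis (- x)"
    by (simp_all add: cis_mult)
  have "cis (pmap B A x - x) * mden B A x = cis (pmap B A x) * (cis (- (x/2)) * cis (- (x / 2))) * (of_real (be B A) * (cis (x / 2) * cis (x / 2)) + cnj (al B A) * (cis (- (x / 2)) * cis (x / 2)))"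
    unfolding c mden_def by (simp add: cis_mult)
  also have "\<dots> = (cis (- (x / 2)) * cis (x / 2)) * (cis (- (x / 2))) * (cis (pmap B A x) * (of_real (be B A) * cis (x / 2) + cnj (al B A) * cis (- (x / 2))))"
    by (simp only: distrib_left mult_ac)
  also have "\<dots> = al B A * (cis (- (x / 2)) * cis (x / 2)) + of_real (be B A) * (cis (- (x/2)) * cis (- (x / 2)))"
    unfolding e c(2) using c(2) by (simp add: algebra_simps)
  also have "\<dots> = cnj (mden B A x)"
    unfolding c mden_def by (simp add: cis_cnj)
  finally show ?thesis .
qed

end

subsection \<open>Rotation numbers and phase-lock areas\<close>

context josephson
begin

lemma pmap_iter_add:
  "(pmap B A ^^ k) (x + 2 * pi * of_int n) = (pmap B A ^^ k) x + 2 * pi * of_int n"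
  by (induction k) (simp_all add: pmap_add)

lemma pmap_iter_mono: "x \<le> y \<Longrightarrow> (pmap B A ^^ k) x \<le> (pmap B A ^^ k) y"
  by (induction k) (simp_all add: pmap_mono)

text \<open>The point \<open>y\<close> lies between two translates of \<open>x\<close> by multiples
  of the period, and iteration preserves this order.\<close>

lemma pmap_iter_close:
  "\<exists>C. \<forall>k. \<bar>(pmap B A ^^ k) y - (pmap B A ^^ k) x\<bar> \<le> C"
proof -
  define n where "n = \<lfloor>(y - x) / (2 * pi)\<rfloor>"
  have "of_int n \<le> (y - x) / (2 * pi)" "(y - x) / (2 * pi) < of_int (n + 1)"
    by (simp_all add: n_def)
  then have "x + 2 * pi * of_int n \<le> y" "y \<le> x + 2 * pi * of_int (n + 1)"
    using pi_gt_zero by (simp_all add: field_simps)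
  then have lo: "(pmap B A ^^ k) x + 2 * pi * of_int n \<le> (pmap B A ^^ k) y"
    and hi: "(pmap B A ^^ k) y \<le> (pmap B A ^^ k) x + 2 * pi * of_int (n + 1)" for k
    unfolding pmap_iter_add[symmetric] by (simp_all only: pmap_iter_mono)
  have "\<bar>(pmap B A ^^ k) y - (pmap B A ^^ k) x\<bar> \<le> \<bar>2 * pi * of_int n\<bar> + \<bar>2 * pi * of_int (n + 1)\<bar>" for k
    using lo[of k] hi[of k] by linarith
  then show ?thesis by blast
qed

lemma bounded_over_k:
  fixes f :: "nat \<Rightarrow> real"
  assumes "\<And>k. \<bar>f k\<bar> \<le> C"
  shows "(\<lambda>k. f k / (2 * pi * real k)) \<longlonglongrightarrow> 0"
proof (rule Lim_null_comparison)
  show "\<forall>\<^sub>F k in sequentially. norm (f k / (2 * pi * real k)) \<le> C / (2 * pi) * (1 / real k)"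
  proof (rule eventually_sequentiallyI[of 1])
    fix k :: nat assume "1 \<le> k"
    then show "norm (f k / (2 * pi * real k)) \<le> C / (2 * pi) * (1 / real k)"
      using assms[of k] divide_right_mono[of "\<bar>f k\<bar>" C "2 * pi * real k"] by (simp add: abs_mult)
  qed
  have "(\<lambda>k. C / (2 * pi) * (1 / real k)) \<longlonglongrightarrow> C / (2 * pi) * 0"
    by (intro tendsto_intros lim_1_over_n)
  then show "(\<lambda>k. C / (2 * pi) * (1 / real k)) \<longlonglongrightarrow> 0" by simp
qed

lemma rotation_limit_cong:
  fixes f g :: "nat \<Rightarrow> real"
  assumes "(\<lambda>k. f k / (2 * pi * real k)) \<longlonglongrightarrow> r" and "\<And>k. \<bar>g k - f k\<bar> \<le> C"
  shows "(\<lambda>k. g k / (2 * pi * real k)) \<longlonglongrightarrow> r"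
proof -
  have "(\<lambda>k. f k / (2 * pi * real k) + (g k - f k) / (2 * pi * real k)) \<longlonglongrightarrow> r + 0"
    by (intro tendsto_add assms(1) bounded_over_k[OF assms(2)])
  then show ?thesis by (simp add: add_divide_distrib[symmetric])
qed

lemma linear_rotation_limit: "(\<lambda>k. (x + real k * c) / (2 * pi * real k)) \<longlonglongrightarrow> c / (2 * pi)"
proof (rule rotation_limit_cong[where f = "\<lambda>k. real k * c" and C = "\<bar>x\<bar>"])
  have "\<forall>\<^sub>F k in sequentially. c / (2 * pi) = real k * c / (2 * pi * real k)"
    by (rule eventually_sequentiallyI[of 1]) auto
  then show "(\<lambda>k. real k * c / (2 * pi * real k)) \<longlonglongrightarrow> c / (2 * pi)"
    using tendsto_cong[THEN iffD1, OF _ tendsto_const] by fast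
qed simp

lemma rotation_limit_all:
  assumes "has_rotation_number w B A r"
  shows "(\<lambda>k. (pmap B A ^^ k) x / (2 * pi * real k)) \<longlonglongrightarrow> r"
proof -
  obtain y where y: "(\<lambda>k. (pmap B A ^^ k) y / (2 * pi * real k)) \<longlonglongrightarrow> r"
    using assms unfolding has_rotation_number_iff by blast
  obtain C where "\<And>k. \<bar>(pmap B A ^^ k) x - (pmap B A ^^ k) y\<bar> \<le> C"
    using pmap_iter_close by blast
  from rotation_limit_cong[OF y this] show ?thesis .
qed

lemma has_rotation_number_unique:
  assumes "has_rotation_number w B A r" "has_rotation_number w B A r'"
  shows "r = r'"
  using LIMSEQ_unique[OF rotation_limit_all[OF assms(1), of 0] rotation_limit_all[OF assms(2)]] .

lemma fixed_point_rotation_number: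
  assumes "pmap B A x = x + 2 * pi * of_int n"
  shows "has_rotation_number w B A (of_int n)"
proof -
  have it: "(pmap B A ^^ k) x = x + real k * (2 * pi * of_int n)" for k
  proof (induction k)
    case (Suc k)
    have "(pmap B A ^^ Suc k) x = pmap B A (x + 2 * pi * of_int (int k * n))"
      using Suc by (simp add: algebra_simps)
    also have "\<dots> = x + real (Suc k) * (2 * pi * of_int n)"
      by (simp only: pmap_add assms) (simp add: algebra_simps)
    finally show ?case .
  qed simp
  show ?thesis
    unfolding has_rotation_number_iff
    by (rule exI[of _ x]) (use linear_rotation_limit[of x "2 * pi * of_int n"] in \<open>simp add: it\<close>)
qed

lemma Im_mden: "Im (mden B A x) = be B A * sin x - Im (al B A)"
  by (simp add: mden_def)

lemma cis_eq_1_iff: "cis x = 1 \<longleftrightarrow> (\<exists>n::int. x = 2 * pi * of_int n)"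
proof
  assume "cis x = 1"
  from arg_cong[OF this, of Re] have "cos x = 1" by simp
  then show "\<exists>n::int. x = 2 * pi * of_int n"
    unfolding cos_one_2pi_int by (metis mult.commute mult.left_commute)
next
  assume "\<exists>n::int. x = 2 * pi * of_int n"
  then show "cis x = 1"
    by (auto simp: complex_eq_iff cos_integer_2pi sin_integer_2pi)
qed

text \<open>By \<open>pmap_moebius\<close>, a point is fixed up to full turns exactly where
  \<open>mden\<close> is real.\<close>

lemma fixed_point_iff:
  "(\<exists>n::int. pmap B A x = x + 2 * pi * of_int n) \<longleftrightarrow> be B A * sin x = Im (al B A)"
proof -
  have "(\<exists>n::int. pmap B A x = x + 2 * pi * of_int n) \<longleftrightarrow> cis (pmap B A x - x) = 1"
    unfolding cis_eq_1_iff by (auto simp: algebra_simps)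
  also have "\<dots> \<longleftrightarrow> mden B A x = cnj (mden B A x)"
    using pmap_moebius[of B A x] mden_nonzero[of B A x]
    by (metis mult_cancel_right2)
  also have "\<dots> \<longleftrightarrow> Im (mden B A x) = 0"
    by (auto simp: complex_eq_iff)
  finally show ?thesis by (simp add: Im_mden)
qed

section \<open>Elliptic points lie outside the phase-lock areas\<close>

definition elliptic :: "real \<Rightarrow> real \<Rightarrow> bool" where
  "elliptic B A \<longleftrightarrow> \<bar>be B A\<bar> < \<bar>Im (al B A)\<bar>"

lemma elliptic_no_fixed_point:
  assumes "elliptic B A"
  shows "pmap B A x \<noteq> x + 2 * pi * of_int n"
proof
  assume "pmap B A x = x + 2 * pi * of_int n"
  then have "be B A * sin x = Im (al B A)" using fixed_point_iff by blast
  then have "\<bar>Im (al B A)\<bar> \<le> \<bar>be B A\<bar> * 1"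
    by (metis abs_mult abs_sin_le_one abs_ge_zero mult_left_mono)
  then show False using assms by (simp add: elliptic_def)
qed

lemma not_elliptic_fixed_point:
  assumes "\<not> elliptic B A"
  shows "\<exists>x n. pmap B A x = x + 2 * pi * of_int n"
proof (cases "be B A = 0")
  case True
  then have "be B A * sin 0 = Im (al B A)" using assms by (simp add: elliptic_def)
  then show ?thesis using fixed_point_iff[of B A 0] by blast
next
  case False
  have "\<bar>Im (al B A) / be B A\<bar> \<le> 1"
    using False assms by (simp add: elliptic_def)
  then have "sin (arcsin (Im (al B A) / be B A)) = Im (al B A) / be B A"
    by (intro sin_arcsin) linarith+
  then show ?thesis
    using fixed_point_iff[of B A "arcsin (Im (al B A) / be B A)"] False by auto
qed

lemma not_elliptic_rotation_number:
  assumes "\<not> elliptic B A" "has_rotation_number w B A r"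
  shows "\<exists>x n. r = of_int n \<and> pmap B A x = x + 2 * pi * of_int n"
  using not_elliptic_fixed_point[OF assms(1)] fixed_point_rotation_number
    has_rotation_number_unique[OF assms(2)] by metis

text \<open>In the elliptic case the Moebius transformation fixes the point \<open>\<i> * y\<close> of the unit disc;
  the disc automorphism moving it to the origin lifts to a map \<open>K\<close> that conjugates the Poincare
  map to a translation.\<close>

lemma elliptic_conjugacy:
  assumes "elliptic B A"
  shows "\<exists>K c \<delta>. \<delta> > 0 \<and> (\<forall>x z. x \<le> z \<longrightarrow> \<delta> * (z - x) \<le> K z - K x) \<and>
      (\<forall>x. \<bar>K x - x\<bar> \<le> pi) \<and> (\<forall>x (n::int). K (x + 2 * pi * of_int n) = K x + 2 * pi * of_int n) \<and>
      (\<forall>x. K (pmap B A x) = K x + c)"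
proof -
  define b \<eta> where "b = be B A" and "\<eta> = Im (al B A)"
  have be: "\<bar>b\<bar> < \<bar>\<eta>\<bar>" using assms by (simp add: elliptic_def b_def \<eta>_def)
  define q where "q = sqrt (\<eta>\<^sup>2 - b\<^sup>2)"
  have "b\<^sup>2 < \<eta>\<^sup>2" using be by (metis abs_ge_zero power2_abs power_strict_mono zero_less_numeral)
  then have q: "q > 0" "q\<^sup>2 = \<eta>\<^sup>2 - b\<^sup>2" by (auto simp: q_def)
  \<comment> \<open>\<open>y = b / d\<close> is the root of modulus less than 1 of
    \<open>b * y\<^sup>2 - 2 * \<eta> * y + b\<close>, written with the denominator of larger
    modulus so that \<open>b = 0\<close> is covered as well.\<close>
  define d where "d = \<eta> + sgn \<eta> * q"
  have d: "\<bar>\<eta>\<bar> < \<bar>d\<bar>" using q be by (cases "\<eta> > 0") (auto simp: d_def sgn_if)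
  define y where "y = b / d"
  have y1: "\<bar>y\<bar> < 1" using d be by (simp add: y_def)
  have yeq: "b * y\<^sup>2 - 2 * \<eta> * y + b = 0"
  proof -
    have "sgn \<eta> * sgn \<eta> = 1" using be by (auto simp: sgn_if)
    then have "(d - \<eta>)\<^sup>2 = q\<^sup>2" by (simp add: d_def power_mult_distrib power2_eq_square)
    then have "d\<^sup>2 - 2 * \<eta> * d + b\<^sup>2 = 0" using q(2) by (simp add: power2_diff mult_ac)
    then have "b * (d\<^sup>2 - 2 * \<eta> * d + b\<^sup>2) = 0" by simp
    moreover have "b * (d\<^sup>2 - 2 * \<eta> * d + b\<^sup>2) = (b * y\<^sup>2 - 2 * \<eta> * y + b) * d\<^sup>2"
      using d by (simp add: y_def field_simps power2_eq_square)
    ultimately show ?thesis using d by auto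
  qed
  \<comment> \<open>Real and imaginary part of \<open>1 + \<i> * y * cis x\<close>, which stays in
    the right half plane. So \<open>K\<close> below is a lift of the disc automorphism sending z to
    (z - i y) / (1 + i y z).\<close>
  define u v where "u x = 1 - y * sin x" and "v x = y * cos x" for x
  have u: "u x > 0" for x
  proof -
    have "\<bar>y * sin x\<bar> \<le> \<bar>y\<bar> * 1" unfolding abs_mult by (intro mult_left_mono) auto
    then show ?thesis using y1 by (simp add: u_def)
  qed
  define K where "K x = x - 2 * arctan (v x / u x)" for x
  \<comment> \<open>Lower bound of the derivative of \<open>K\<close>, which is the Poisson kernel
    \<open>(1 - y\<^sup>2) / (u x ^ 2 + v x ^ 2)\<close>.\<close>
  define \<delta> where "\<delta> = (1 - y\<^sup>2) / (1 + \<bar>y\<bar>)\<^sup>2"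
  have y2: "y\<^sup>2 < 1" using y1 by (simp add: abs_square_less_1)
  have \<delta>: "\<delta> > 0" using y2 by (simp add: \<delta>_def)
  have nn: "u x ^ 2 + v x ^ 2 = 1 - 2 * y * sin x + y\<^sup>2" for x
  proof -
    have "u x ^ 2 + v x ^ 2 = 1 - 2 * y * sin x + y\<^sup>2 * ((sin x)\<^sup>2 + (cos x)\<^sup>2)"
      unfolding u_def v_def by algebra
    then show ?thesis by simp
  qed
  have nn_pos: "u x ^ 2 + v x ^ 2 > 0" for x
    using u[of x] by (simp add: add_pos_nonneg)
  have Kd: "(K has_real_derivative ((1 - y\<^sup>2) / (u x ^ 2 + v x ^ 2))) (at x)" for x
  proof -
    have "((\<lambda>x. v x / u x) has_real_derivative ((- y * sin x * u x - v x * (- y * cos x)) / (u x * u x))) (at x)"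
      unfolding u_def[abs_def] v_def[abs_def]
      using u[of x] by (auto intro!: derivative_eq_intros simp: u_def)
    from DERIV_chain2[OF DERIV_arctan this]
    have "(K has_real_derivative (1 - 2 * (inverse (1 + (v x / u x)\<^sup>2) * ((- y * sin x * u x - v x * (- y * cos x)) / (u x * u x))))) (at x)"
      unfolding K_def[abs_def] by (intro DERIV_diff DERIV_ident DERIV_cmult)
    moreover have "inverse (1 + (v x / u x)\<^sup>2) = u x ^ 2 / (u x ^ 2 + v x ^ 2)"
      using u[of x] nn_pos[of x] by (simp add: field_simps)
    moreover have "- y * sin x * u x - v x * (- y * cos x) = y\<^sup>2 - y * sin x"
    proof -
      have "- y * sin x * u x - v x * (- y * cos x) = y\<^sup>2 * ((sin x)\<^sup>2 + (cos x)\<^sup>2) - y * sin x"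
        unfolding u_def v_def by algebra
      then show ?thesis by simp
    qed
    moreover have "1 - 2 * (u x ^ 2 / (u x ^ 2 + v x ^ 2) * ((y\<^sup>2 - y * sin x) / (u x * u x))) = (1 - y\<^sup>2) / (u x ^ 2 + v x ^ 2)"
    proof -
      have "u x ^ 2 / (u x ^ 2 + v x ^ 2) * ((y\<^sup>2 - y * sin x) / (u x * u x)) = (y\<^sup>2 - y * sin x) / (u x ^ 2 + v x ^ 2)"
        using u[of x] by (simp add: power2_eq_square)
      moreover have "1 - 2 * ((y\<^sup>2 - y * sin x) / (u x ^ 2 + v x ^ 2)) = ((u x ^ 2 + v x ^ 2) - 2 * (y\<^sup>2 - y * sin x)) / (u x ^ 2 + v x ^ 2)"
        using nn_pos[of x] u[of x] by (simp add: diff_divide_distrib)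
      ultimately show ?thesis by (simp add: nn)
    qed
    ultimately show ?thesis by simp
  qed
  have Kd_ge: "\<delta> \<le> (1 - y\<^sup>2) / (u x ^ 2 + v x ^ 2)" for x
  proof -
    have "\<bar>y * sin x\<bar> \<le> \<bar>y\<bar> * 1" unfolding abs_mult by (intro mult_left_mono) auto
    then have "u x ^ 2 + v x ^ 2 \<le> (1 + \<bar>y\<bar>)\<^sup>2"
      unfolding nn by (simp add: power2_sum)
    then show ?thesis
      unfolding \<delta>_def using y2 nn_pos[of x] by (intro divide_left_mono) auto
  qed
  have K_mono: "\<delta> * (z - x) \<le> K z - K x" if "x \<le> z" for x z
  proof -
    have "K x - \<delta> * x \<le> K z - \<delta> * z"
    proof (rule DERIV_nonneg_imp_nondecreasing[OF that])
      fix t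
      have "((\<lambda>x. K x - \<delta> * x) has_real_derivative ((1 - y\<^sup>2) / (u t ^ 2 + v t ^ 2) - \<delta>)) (at t)"
        by (auto intro!: derivative_eq_intros Kd)
      then show "\<exists>d. ((\<lambda>x. K x - \<delta> * x) has_real_derivative d) (at t) \<and> 0 \<le> d"
        using Kd_ge[of t] by (intro exI conjI) auto
    qed
    then show ?thesis by (simp add: algebra_simps)
  qed
  have K_close: "\<bar>K x - x\<bar> \<le> pi" for x
    using arctan_bounded[of "v x / u x"] by (simp add: K_def abs_le_iff)
  have K_per: "K (x + 2 * pi * of_int n) = K x + 2 * pi * of_int n" for x and n :: int
    by (simp add: K_def u_def v_def sin_add cos_add sin_integer_2pi cos_integer_2pi)
  have K_cis: "cis (K x) * (1 + \<i> * y * cis x) = cis x - \<i> * y" for x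
  proof -
    define t where "t = arctan (v x / u x)"
    have tan: "sin t * u x = cos t * v x"
      using tan_arctan[of "v x / u x"] cos_arctan_not_zero[of "v x / u x"] u[of x]
      by (simp add: t_def tan_def field_simps)
    have "cis (- t) * (complex_of_real (u x) + \<i> * v x) = cis t * (complex_of_real (u x) - \<i> * v x)"
      using tan by (simp add: complex_eq_iff)
    then have "cis (- t) * (cis (- t) * (complex_of_real (u x) + \<i> * v x)) = (cis (- t) * cis t) * (complex_of_real (u x) - \<i> * v x)"
      by (simp only: mult.assoc)
    then have c: "cis (- t) * (cis (- t) * (complex_of_real (u x) + \<i> * v x)) = complex_of_real (u x) - \<i> * v x"
      by (simp add: cis_mult)
    have e1: "1 + \<i> * y * cis x = complex_of_real (u x) + \<i> * v x"
      by (simp add: complex_eq_iff u_def v_def)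
    have e2: "cis x * (complex_of_real (u x) - \<i> * v x) = cis x - \<i> * y"
    proof -
      have "(sin x)\<^sup>2 + (cos x)\<^sup>2 = 1" by simp
      then have "y * (sin x * sin x) + y * (cos x * cos x) = y"
        by (simp add: power2_eq_square distrib_left[symmetric])
      then show ?thesis
        by (simp add: complex_eq_iff u_def v_def algebra_simps)
    qed
    have "cis (K x) = cis x * (cis (- t) * cis (- t))"
      by (simp add: K_def t_def cis_mult algebra_simps)
    then show ?thesis
      unfolding e1 e2[symmetric] c[symmetric] by (simp only: mult_ac)
  qed
  \<comment> \<open>The conjugated map is multiplication by \<open>cnj E / E\<close>. The equation
    \<open>fixeq2\<close> says that the Moebius map fixes \<open>\<i> * y\<close>, and
    \<open>fixeq\<close> is its conjugate.\<close>
  define E where "E = cnj (al B A) + \<i> * y * b"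
  have nE: "E \<noteq> 0"
  proof
    assume "E = 0"
    then have "cnj (al B A) = - (\<i> * y * b)" by (simp add: E_def eq_neg_iff_add_eq_0)
    from arg_cong[OF this, of norm] have "norm (al B A) = \<bar>y\<bar> * \<bar>b\<bar>"
      by (simp add: norm_mult)
    moreover have "\<bar>y\<bar> * \<bar>b\<bar> \<le> 1 * \<bar>b\<bar>" using y1 by (intro mult_right_mono) auto
    ultimately have "(norm (al B A))\<^sup>2 \<le> b\<^sup>2"
      by (metis abs_le_square_iff abs_norm_cancel mult_1)
    then show False using al_be[of B A] by (simp add: b_def)
  qed
  have n1: "1 + \<i> * y * cis x \<noteq> 0" for x
  proof
    assume "1 + \<i> * y * cis x = 0"
    then have "\<i> * y * cis x = -1" by (simp add: add_eq_0_iff)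
    from arg_cong[OF this, of norm] have "\<bar>y\<bar> = 1" by (simp add: norm_mult)
    then show False using y1 by simp
  qed
  have fixeq: "of_real b - \<i> * y * cnj (al B A) = - \<i> * y * cnj E"
    and fixeq2: "of_real b + \<i> * y * al B A = \<i> * y * E"
    using yeq by (simp_all add: E_def complex_eq_iff \<eta>_def[symmetric] power2_eq_square algebra_simps)
  have conj: "cis (K (pmap B A x) - K x) = cnj E / E" for x
  proof -
    define z z' D where "z = cis x" and "z' = cis (pmap B A x)" and "D = mden B A x"
    have D: "D = of_real b * z + cnj (al B A)" by (simp add: D_def mden_def z_def b_def)
    have D0: "D \<noteq> 0" by (simp add: D_def mden_nonzero)
    have z0: "z * cnj z = 1" by (simp add: z_def cis_cnj cis_mult)
    have "z' * D = z * (cis (pmap B A x - x) * D)"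
      by (simp add: z'_def z_def cis_mult mult.assoc[symmetric])
    also have "\<dots> = z * cnj D" using pmap_moebius[of B A x] by (simp add: D_def)
    also have "\<dots> = of_real b * (z * cnj z) + al B A * z" by (simp add: D algebra_simps)
    finally have z': "z' * D = al B A * z + of_real b" by (simp add: z0)
    have "cis (K (pmap B A x)) * (E * (1 + \<i> * y * z)) = cis (K (pmap B A x)) * (cnj (al B A) + \<i> * y * of_real b + z * (of_real b + \<i> * y * al B A))"
      unfolding fixeq2 by (simp add: E_def algebra_simps)
    also have "\<dots> = cis (K (pmap B A x)) * (D + \<i> * y * (al B A * z + of_real b))"
      by (simp add: D algebra_simps)
    also have "\<dots> = cis (K (pmap B A x)) * (D + \<i> * y * (z' * D))"
      by (simp only: z')
    also have "\<dots> = (cis (K (pmap B A x)) * (1 + \<i> * y * z')) * D"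
      by (simp add: algebra_simps)
    also have "\<dots> = z' * D - \<i> * y * D"
      unfolding z'_def K_cis by (simp add: algebra_simps)
    also have "\<dots> = z * cnj E + (of_real b - \<i> * y * cnj (al B A))"
      by (simp only: z', simp add: D E_def algebra_simps)
    also have "\<dots> = cnj E * (z - \<i> * y)"
      unfolding fixeq by (simp add: algebra_simps)
    also have "z - \<i> * y = cis (K x) * (1 + \<i> * y * z)"
      using K_cis[of x] by (simp add: z_def)
    finally have "(cis (K (pmap B A x)) * E) * (1 + \<i> * y * z) = (cnj E * cis (K x)) * (1 + \<i> * y * z)"
      by (simp only: mult_ac)
    then have "cis (K (pmap B A x)) * E = cnj E * cis (K x)"
      using n1[of x] by (simp add: z_def)
    then show ?thesis
      using nE by (simp add: cis_divide[symmetric] field_simps)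
  qed
  \<comment> \<open>The displacement of the conjugated map is continuous and takes values in a
    single coset of the multiples of \<open>2 * pi\<close>, hence it is constant.\<close>
  define g where "g x = K (pmap B A x) - K x" for x
  have K_cont: "continuous_on UNIV K"
    by (meson Kd DERIV_continuous continuous_at_imp_continuous_on)
  have "continuous_on UNIV g"
    unfolding g_def[abs_def]
    by (intro continuous_intros K_cont continuous_on_compose2[OF K_cont] continuous_on_pmap) auto
  moreover have "\<exists>e>0. \<forall>z. z \<in> UNIV \<and> g z \<noteq> g x \<longrightarrow> e \<le> norm (g z - g x)" for x
  proof (rule exI[of _ "2 * pi"], intro conjI allI impI)
    fix z assume z: "z \<in> UNIV \<and> g z \<noteq> g x"
    have "cis (g z - g x) = 1"
      using conj[of z] conj[of x] nE by (simp add: g_def[symmetric] cis_divide[symmetric])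
    then obtain n :: int where n: "g z - g x = 2 * pi * of_int n" using cis_eq_1_iff by blast
    with z have "\<bar>n\<bar> \<ge> 1" by (cases "n = 0") auto
    then have "\<bar>real_of_int n\<bar> \<ge> 1" by linarith
    then have "2 * pi * 1 \<le> 2 * pi * \<bar>real_of_int n\<bar>" by (intro mult_left_mono) auto
    then show "2 * pi \<le> norm (g z - g x)" unfolding n by (simp add: abs_mult)
  qed simp
  ultimately have "g constant_on UNIV"
    by (intro continuous_discrete_range_constant) auto
  then obtain c where "\<And>x. g x = c" by (auto simp: constant_on_def)
  then have "K (pmap B A x) = K x + c" for x
    by (simp add: g_def[symmetric] algebra_simps) (metis add.commute add_diff_cancel_left' diff_add_cancel g_def)
  then show ?thesis using \<delta> K_mono K_close K_per by blast
qed

text \<open>In the coordinate \<open>K\<close> the map is the translation by \<open>c\<close>, so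
  the rotation number is \<open>c / (2 * pi)\<close>. An integer value would give a point that is
  fixed up to full turns.\<close>

lemma elliptic_rotation_not_int:
  assumes e: "elliptic B A" and r: "has_rotation_number w B A r"
  shows "r \<notin> \<int>"
proof
  assume "r \<in> \<int>"
  then obtain n where n: "r = of_int n" by (rule Ints_cases)
  obtain K c \<delta> where \<delta>: "\<delta> > 0" and K: "\<And>x z. x \<le> z \<Longrightarrow> \<delta> * (z - x) \<le> K z - K x"
    "\<And>x. \<bar>K x - x\<bar> \<le> pi" "\<And>x (n::int). K (x + 2 * pi * of_int n) = K x + 2 * pi * of_int n"
    "\<And>x. K (pmap B A x) = K x + c"
    using elliptic_conjugacy[OF e] by metis
  have it: "K ((pmap B A ^^ k) x) = K x + real k * c" for k x
    by (induction k) (simp_all add: K(4) algebra_simps)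
  have "(\<lambda>k. (pmap B A ^^ k) 0 / (2 * pi * real k)) \<longlonglongrightarrow> c / (2 * pi)"
    by (rule rotation_limit_cong[OF linear_rotation_limit[of "K 0" c], where C = pi])
       (use K(2)[of "(pmap B A ^^ _) 0"] in \<open>simp add: it[symmetric] abs_minus_commute\<close>)
  then have "c / (2 * pi) = of_int n"
    using rotation_limit_all[OF r] n LIMSEQ_unique by blast
  then have c: "c = 2 * pi * of_int n" by (simp add: field_simps)
  have inj: "x = z" if "K x = K z" for x z
  proof (rule ccontr)
    assume "x \<noteq> z"
    then consider "x < z" | "z < x" by linarith
    then show False
    proof cases
      case 1
      then have "0 < \<delta> * (z - x)" using \<delta> by simp
      then show False using K(1)[of x z] 1 that by simp
    next
      case 2
      then have "0 < \<delta> * (x - z)" using \<delta> by simp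
      then show False using K(1)[of z x] 2 that by simp
    qed
  qed
  have "pmap B A 0 = 0 + 2 * pi * of_int n"
    by (rule inj) (simp only: K(3,4) c)
  then show False using elliptic_no_fixed_point[OF e] by blast
qed

text \<open>The strict inequality is uniform because the difference is continuous and periodic in
  \<open>x\<close>.\<close>

lemma pmap_gap:
  assumes "B < B'"
  shows "\<exists>\<epsilon>>0. \<forall>x. pmap B A x + \<epsilon> \<le> pmap B' A x"
proof -
  define g where "g x = pmap B' A x - pmap B A x" for x
  have "continuous_on {0..2*pi} g"
    unfolding g_def[abs_def] by (intro continuous_intros continuous_on_pmap)
  then obtain x0 where x0: "x0 \<in> {0..2*pi}" "\<And>x. x \<in> {0..2*pi} \<Longrightarrow> g x0 \<le> g x"
    using continuous_attains_inf[of "{0..2*pi}" g] by auto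
  have "g x0 \<le> g x" for x
  proof -
    define n where "n = \<lfloor>x / (2 * pi)\<rfloor>"
    have "of_int n \<le> x / (2 * pi)" "x / (2 * pi) < of_int n + 1"
      by (simp_all add: n_def)
    then have "x - 2 * pi * of_int n \<in> {0..2*pi}"
      using pi_gt_zero by (simp add: field_simps)
    from x0(2)[OF this] show ?thesis
      using pmap_add[of B A "x - 2 * pi * of_int n" n] pmap_add[of B' A "x - 2 * pi * of_int n" n]
      by (simp add: g_def)
  qed
  moreover have "g x0 > 0" using pmap_strict_mono_B[OF assms] by (simp add: g_def)
  ultimately show ?thesis
    by (intro exI[of _ "g x0"]) (auto simp: g_def algebra_simps)
qed

text \<open>Measured in the coordinate \<open>K\<close> of the elliptic map, the map for
  \<open>B'\<close> advances by at least \<open>c + \<delta> * \<epsilon>\<close> in each step. So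
  an elliptic point is never the left end of a horizontal segment of constant rotation
  number.\<close>

lemma elliptic_rotation_strict_mono:
  assumes e: "elliptic B A" and r: "has_rotation_number w B A r"
    and r': "has_rotation_number w B' A r'" and BB': "B < B'"
  shows "r < r'"
proof -
  obtain K c \<delta> where \<delta>: "\<delta> > 0" and K: "\<And>x z. x \<le> z \<Longrightarrow> \<delta> * (z - x) \<le> K z - K x"
    "\<And>x. \<bar>K x - x\<bar> \<le> pi" "\<And>x. K (pmap B A x) = K x + c"
    using elliptic_conjugacy[OF e] by metis
  obtain \<epsilon> where \<epsilon>: "\<epsilon> > 0" "\<And>x. pmap B A x + \<epsilon> \<le> pmap B' A x"
    using pmap_gap[OF BB'] by blast
  have it: "K ((pmap B A ^^ k) x) = K x + real k * c" for k x
    by (induction k) (simp_all add: K(3) algebra_simps)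
  have step: "K x + (c + \<delta> * \<epsilon>) \<le> K (pmap B' A x)" for x
  proof -
    have "\<delta> * \<epsilon> \<le> \<delta> * (pmap B' A x - pmap B A x)"
      using \<delta> \<epsilon>(2)[of x] by (intro mult_left_mono) auto
    also have "\<dots> \<le> K (pmap B' A x) - K (pmap B A x)"
      using \<epsilon>(1) \<epsilon>(2)[of x] by (intro K(1)) simp
    finally show ?thesis by (simp add: K(3))
  qed
  have it': "K x + real k * (c + \<delta> * \<epsilon>) \<le> K ((pmap B' A ^^ k) x)" for k x
  proof (induction k)
    case (Suc k)
    then show ?case using step[of "(pmap B' A ^^ k) x"] by (simp add: algebra_simps)
  qed simp
  have "(\<lambda>k. (pmap B A ^^ k) 0 / (2 * pi * real k)) \<longlonglongrightarrow> c / (2 * pi)"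
    by (rule rotation_limit_cong[OF linear_rotation_limit[of "K 0" c], where C = pi])
       (use K(2)[of "(pmap B A ^^ _) 0"] in \<open>simp add: it[symmetric] abs_minus_commute\<close>)
  then have rc: "r = c / (2 * pi)"
    using rotation_limit_all[OF r] LIMSEQ_unique by blast
  have "(c + \<delta> * \<epsilon>) / (2 * pi) \<le> r'"
  proof (rule LIMSEQ_le[OF linear_rotation_limit[of "K 0 - pi"] rotation_limit_all[OF r', of 0]], intro exI allI impI)
    fix k :: nat
    have "(K 0 - pi) + real k * (c + \<delta> * \<epsilon>) \<le> (pmap B' A ^^ k) 0"
      using it'[of 0 k] K(2)[of "(pmap B' A ^^ k) 0"] by linarith
    then show "((K 0 - pi) + real k * (c + \<delta> * \<epsilon>)) / (2 * pi * real k) \<le> (pmap B' A ^^ k) 0 / (2 * pi * real k)"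
      by (intro divide_right_mono) auto
  qed
  moreover have "c / (2 * pi) < (c + \<delta> * \<epsilon>) / (2 * pi)"
    using \<delta> \<epsilon> by (intro divide_strict_right_mono) auto
  ultimately show ?thesis using rc by simp
qed

lemma interior_level_right:
  assumes "(B, A) \<in> interior (level_set w r)"
  shows "\<exists>\<epsilon>>0. \<forall>d. \<bar>d\<bar> < \<epsilon> \<longrightarrow> (B + d, A) \<in> interior (level_set w r)"
proof -
  obtain \<epsilon> where "\<epsilon> > 0" and \<epsilon>: "ball (B, A) \<epsilon> \<subseteq> interior (level_set w r)"
    using open_contains_ball[of "interior (level_set w r)"] assms by auto
  then show ?thesis
    by (intro exI[of _ \<epsilon>]) (auto simp: subset_eq dist_Pair_Pair dist_real_def)
qed

text \<open>The rotation number at an elliptic point is not an integer. If its level set had an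
  interior point, that point would be elliptic too, and moving it to the right would change the
  rotation number.\<close>

lemma phase_lock_not_elliptic:
  assumes "is_phase_lock_area w r" and BA: "(B, A) \<in> level_set w r"
  shows "\<not> elliptic B A"
proof
  assume e: "elliptic B A"
  have nr: "r \<notin> \<int>"
    using elliptic_rotation_not_int[OF e] BA by (simp add: level_set_def)
  obtain B1 A1 where 1: "(B1, A1) \<in> interior (level_set w r)"
    using assms(1) unfolding is_phase_lock_area_def by (metis all_not_in_conv surj_pair)
  then obtain \<epsilon> where \<epsilon>: "\<epsilon> > 0" "\<And>d. \<bar>d\<bar> < \<epsilon> \<Longrightarrow> (B1 + d, A1) \<in> interior (level_set w r)"
    using interior_level_right by blast
  have r1: "has_rotation_number w B1 A1 r"
    using 1 interior_subset by (auto simp: level_set_def)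
  have r2: "has_rotation_number w (B1 + \<epsilon> / 2) A1 r"
    using \<epsilon>(2)[of "\<epsilon> / 2"] \<epsilon>(1) interior_subset by (auto simp: level_set_def)
  have "elliptic B1 A1"
    using not_elliptic_rotation_number[OF _ r1] nr Ints_of_int by metis
  from elliptic_rotation_strict_mono[OF this r1 r2] show False using \<epsilon>(1) by simp
qed

text \<open>The displacement minus \<open>2 * pi * n\<close> takes both signs. Stated through strict
  inequalities for the Poincare map this is visibly open; for a phase-lock area it is the interior
  of the level set.\<close>

definition lock_region :: "int \<Rightarrow> (real \<times> real) set" where
  "lock_region n = {(B, A). (\<exists>x. pmap B A x < x + 2 * pi * of_int n) \<and> (\<exists>y. pmap B A y > y + 2 * pi * of_int n)}"

lemma lock_region_subset: "lock_region n \<subseteq> level_set w (of_int n)"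
proof
  fix p assume "p \<in> lock_region n"
  then obtain B A x y where p: "p = (B, A)" and xy: "pmap B A x < x + 2 * pi * of_int n" "pmap B A y > y + 2 * pi * of_int n"
    by (auto simp: lock_region_def)
  define g where "g t = pmap B A t - t" for t
  have "connected (g ` UNIV)"
    unfolding g_def[abs_def]
    by (intro connected_continuous_image continuous_intros continuous_on_pmap connected_UNIV)
  moreover have "g x \<in> g ` UNIV" "g y \<in> g ` UNIV" by auto
  moreover have "g x \<le> 2 * pi * of_int n" "2 * pi * of_int n \<le> g y" using xy by (auto simp: g_def)
  ultimately have "2 * pi * of_int n \<in> g ` UNIV"
    by (meson connectedD_interval)
  then obtain t where "2 * pi * of_int n = pmap B A t - t" unfolding g_def by blast
  then have "pmap B A t = t + 2 * pi * of_int n" by simp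
  from fixed_point_rotation_number[OF this] show "p \<in> level_set w (of_int n)"
    by (simp add: p level_set_def)
qed

lemma open_lock_region: "open (lock_region n)"
proof -
  have "lock_region n = (\<Union>x. {p. pmap (fst p) (snd p) x < x + 2 * pi * of_int n}) \<inter>
      (\<Union>y. {p. y + 2 * pi * of_int n < pmap (fst p) (snd p) y})"
    by (auto simp: lock_region_def)
  then show ?thesis
    by (auto intro!: open_Int open_UN open_Collect_less continuous_on_pmap continuous_intros)
qed

lemma lock_region_subset_interior: "lock_region n \<subseteq> interior (level_set w (of_int n))"
  by (intro interior_maximal lock_region_subset open_lock_region)

text \<open>By strict monotonicity in \<open>B\<close>, a fixed point at
  \<open>B + \<epsilon> / 2\<close> becomes a point of too small displacement at \<open>B\<close>,
  and one at \<open>B - \<epsilon> / 2\<close> a point of too large displacement.\<close>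

lemma interior_level_set:
  assumes "is_phase_lock_area w r"
  shows "\<exists>n. r = of_int n \<and> interior (level_set w r) = lock_region n"
proof -
  have fixp: "\<exists>x n. r = of_int n \<and> pmap B A x = x + 2 * pi * of_int n"
    if "(B, A) \<in> level_set w r" for B A
    using not_elliptic_rotation_number[OF phase_lock_not_elliptic[OF assms that]] that by (simp add: level_set_def)
  obtain B1 A1 where 1: "(B1, A1) \<in> interior (level_set w r)"
    using assms unfolding is_phase_lock_area_def by (metis all_not_in_conv surj_pair)
  then obtain n where n: "r = of_int n"
    using fixp interior_subset by blast
  have "(B, A) \<in> lock_region n" if BA: "(B, A) \<in> interior (level_set w r)" for B A
  proof -
    obtain \<epsilon> where \<epsilon>: "\<epsilon> > 0" "\<And>d. \<bar>d\<bar> < \<epsilon> \<Longrightarrow> (B + d, A) \<in> interior (level_set w r)"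
      using interior_level_right[OF BA] by blast
    have "(B + \<epsilon> / 2, A) \<in> level_set w r" "(B + - (\<epsilon> / 2), A) \<in> level_set w r"
      using \<epsilon>(1) \<epsilon>(2)[of "\<epsilon> / 2"] \<epsilon>(2)[of "- (\<epsilon> / 2)"] interior_subset by force+
    then obtain x y where x: "pmap (B + \<epsilon> / 2) A x = x + 2 * pi * of_int n"
      and y: "pmap (B + - (\<epsilon> / 2)) A y = y + 2 * pi * of_int n"
      using fixp n by (metis of_int_eq_iff)
    have "pmap B A x < x + 2 * pi * of_int n"
      using pmap_strict_mono_B[of B "B + \<epsilon> / 2" A x] x \<epsilon>(1) by simp
    moreover have "pmap B A y > y + 2 * pi * of_int n"
      using pmap_strict_mono_B[of "B + - (\<epsilon> / 2)" B A y] y \<epsilon>(1) by simp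
    ultimately show ?thesis by (auto simp: lock_region_def)
  qed
  then have "interior (level_set w r) = lock_region n"
    using lock_region_subset_interior[of n] n by auto
  then show ?thesis using n by blast
qed

text \<open>The witness for too small displacement at \<open>B2\<close> and the one for too large
  displacement at \<open>B1\<close> both survive at \<open>B\<close>. Consequently a horizontal line
  meets at most one component.\<close>

lemma lock_region_convex:
  assumes "(B1, A) \<in> lock_region n" "(B2, A) \<in> lock_region n" "B1 \<le> B" "B \<le> B2"
  shows "(B, A) \<in> lock_region n"
proof -
  have mono: "pmap C A x \<le> pmap C' A x" if "C \<le> C'" for C C' x
    using pmap_strict_mono_B[of C C' A x] that by (cases "C = C'") auto
  show ?thesis
    using assms mono unfolding lock_region_def by (auto; meson le_less_trans less_le_trans)
qed

end

subsection \<open>Constrictions\<close>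

text \<open>Applied to the projection of a component to the \<open>A\<close> axis: an interval that
  accumulates at \<open>a\<close> without containing it lies on one side and reaches up to
  \<open>a\<close>.\<close>

lemma connected_touching_point:
  fixes I :: "real set"
  assumes I: "connected I" and a: "a \<notin> I" "a \<in> closure I"
  shows "(\<exists>b<a. {b<..<a} \<subseteq> I) \<or> (\<exists>b>a. {a<..<b} \<subseteq> I)"
proof -
  have "I \<noteq> {}" using a by auto
  then obtain b where b: "b \<in> I" by blast
  have near: "\<exists>c\<in>I. \<bar>c - a\<bar> < e" if "e > 0" for e
    using a(2) that unfolding closure_approachable by (simp add: dist_real_def)
  have ivl: "x \<in> I" if "u \<in> I" "v \<in> I" "u \<le> x" "x \<le> v" for u v x
    using connectedD_interval[OF I that(1,2)] that by blast
  consider "b < a" | "a < b" using b a(1) by (metis linorder_neqE_linordered_idom)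
  then show ?thesis
  proof cases
    case 1
    have "x \<in> I" if "b < x" "x < a" for x
    proof -
      obtain c where c: "c \<in> I" "\<bar>c - a\<bar> < a - x" using near[of "a - x"] \<open>x < a\<close> by auto
      then have "x \<le> c" by linarith
      then show ?thesis using ivl[OF b c(1)] that by simp
    qed
    then show ?thesis using 1 by (intro disjI1 exI[of _ b]) auto
  next
    case 2
    have "x \<in> I" if "a < x" "x < b" for x
    proof -
      obtain c where c: "c \<in> I" "\<bar>c - a\<bar> < x - a" using near[of "x - a"] \<open>a < x\<close> by auto
      then have "c \<le> x" by linarith
      then show ?thesis using ivl[OF c(1) b] that by simp
    qed
    then show ?thesis using 2 by (intro disjI2 exI[of _ b]) auto
  qed
qed

context josephson
begin

lemma lock_region_component:
  assumes "(B1, A) \<in> connected_component_set (lock_region n) s" and "(B2, A) \<in> lock_region n"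
  shows "connected_component_set (lock_region n) s = connected_component_set (lock_region n) (B2, A)"
proof -
  let ?T = "(\<lambda>B. (B, A)) ` {min B1 B2..max B1 B2}"
  have 1: "(B1, A) \<in> lock_region n"
    using assms(1) connected_component_subset by blast
  have "connected ?T"
    by (intro connected_continuous_image continuous_intros) auto
  moreover have "?T \<subseteq> lock_region n"
    using lock_region_convex[OF 1 assms(2)] lock_region_convex[OF assms(2) 1]
    by (auto simp: min_def max_def split: if_splits)
  ultimately have "connected_component (lock_region n) (B1, A) (B2, A)"
    unfolding connected_component_def by (intro exI[of _ ?T]) auto
  then have "(B2, A) \<in> connected_component_set (lock_region n) s"
    using assms(1) connected_component_trans by (metis mem_Collect_eq)
  then show ?thesis by (metis connected_component_eq)
qed

text \<open>The projections of the two components to the \<open>A\<close> axis are disjoint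
  intervals that accumulate at \<open>A0\<close>, hence from opposite sides. So all nearby
  horizontal lines meet the lock region while the line through the constriction does not, and the
  latter forces the displacement to vanish identically.\<close>

lemma constriction_geometry:
  assumes "constriction w B0 A0"
  shows "A0 \<noteq> 0 \<and> (\<exists>n. is_phase_lock_area w (of_int n) \<and> (\<forall>x. pmap B0 A0 x = x + 2 * pi * of_int n) \<and>
     (\<exists>\<epsilon>>0. \<forall>A. A \<noteq> A0 \<and> \<bar>A - A0\<bar> < \<epsilon> \<longrightarrow> (\<exists>B. (B, A) \<in> lock_region n)))"
proof -
  obtain r p q where A0: "A0 \<noteq> 0" and r: "is_phase_lock_area w r" and BA: "(B0, A0) \<in> level_set w r"
    and pq: "p \<in> interior (level_set w r)" "q \<in> interior (level_set w r)"
    and ne: "connected_component_set (interior (level_set w r)) p \<noteq> connected_component_set (interior (level_set w r)) q"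
    and cl: "(B0, A0) \<in> closure (connected_component_set (interior (level_set w r)) p)"
      "(B0, A0) \<in> closure (connected_component_set (interior (level_set w r)) q)"
    using assms unfolding constriction_def by blast
  obtain n where n: "r = of_int n" and W: "interior (level_set w r) = lock_region n"
    using interior_level_set[OF r] by blast
  define C where "C s = connected_component_set (lock_region n) s" for s
  note ne = ne[unfolded W, folded C_def] and cl = cl[unfolded W, folded C_def]
  have C_open: "open (C s)" for s
    unfolding C_def by (rule open_connected_component[OF open_lock_region])
  have C_sub: "C s \<subseteq> lock_region n" for s
    unfolding C_def by (rule connected_component_subset)
  have C_eq: "C s = C s'" if "(B1, A) \<in> C s" "(B2, A) \<in> C s'" for s s' B1 B2 A
  proof -
    have "(B2, A) \<in> lock_region n" using that(2) C_sub by blast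
    then have "C s = C (B2, A)" "C s' = C (B2, A)"
      using that lock_region_component unfolding C_def by metis+
    then show ?thesis by simp
  qed
  \<comment> \<open>A component that meets the horizontal line at height \<open>A0\<close> also
    meets all nearby horizontal lines, so it coincides with any component that accumulates at the
    constriction.\<close>
  have touch: "C s = C t" if "(B0, A0) \<in> closure (C s)" "(B, A0) \<in> C t" for s t B
  proof -
    have "open (snd ` C t)" using C_open by (rule open_image_snd)
    then have "open (snd -` (snd ` C t) :: (real \<times> real) set)" by (rule open_vimage_snd)
    moreover have "(B0, A0) \<in> snd -` (snd ` C t)" using that(2) by force
    ultimately have "snd -` (snd ` C t) \<inter> C s \<noteq> {}"
      using that(1) open_Int_closure_eq_empty[of "snd -` (snd ` C t)" "C s"] by blast
    then obtain B1 A1 B2 where "(B1, A1) \<in> C s" "(B2, A1) \<in> C t" by force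
    then show ?thesis by (rule C_eq)
  qed
  have empty: "(B, A0) \<notin> lock_region n" for B
  proof
    assume "(B, A0) \<in> lock_region n"
    then have "(B, A0) \<in> C (B, A0)" by (simp add: C_def)
    then have "C p = C q" using touch[OF cl(1)] touch[OF cl(2)] by metis
    then show False using ne by simp
  qed
  have side: "(\<exists>b<A0. {b<..<A0} \<subseteq> snd ` C s) \<or> (\<exists>b>A0. {A0<..<b} \<subseteq> snd ` C s)"
    if "(B0, A0) \<in> closure (C s)" for s
  proof (rule connected_touching_point)
    show "connected (snd ` C s)"
      unfolding C_def by (intro connected_continuous_image continuous_intros connected_connected_component)
    show "A0 \<notin> snd ` C s"
    proof
      assume "A0 \<in> snd ` C s"
      then obtain B where "(B, A0) \<in> C s" by force
      then show False using empty C_sub by blast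
    qed
    have "snd ` closure (C s) \<subseteq> closure (snd ` C s)"
      by (intro image_closure_subset closure_subset continuous_intros) auto
    then show "A0 \<in> closure (snd ` C s)" using that by force
  qed
  have disj: "A \<notin> snd ` C q" if "A \<in> snd ` C p" for A
  proof
    assume "A \<in> snd ` C q"
    then obtain B2 where 2: "(B2, A) \<in> C q" by force
    obtain B1 where 1: "(B1, A) \<in> C p" using \<open>A \<in> snd ` C p\<close> by force
    have "C p = C q" by (rule C_eq[OF 1 2])
    then show False using ne by simp
  qed
  have in_lock: "\<exists>B. (B, A) \<in> lock_region n" if "A \<in> snd ` C s" for A s
  proof -
    obtain B where "(B, A) \<in> C s" using \<open>A \<in> snd ` C s\<close> by force
    then show ?thesis using C_sub by blast
  qed
  have "\<exists>b c. b < A0 \<and> A0 < c \<and> (\<forall>A. A \<in> {b<..<A0} \<union> {A0<..<c} \<longrightarrow> (\<exists>B. (B, A) \<in> lock_region n))"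
  proof -
    consider (pl) b where "b < A0" "{b<..<A0} \<subseteq> snd ` C p" | (pr) b where "b > A0" "{A0<..<b} \<subseteq> snd ` C p"
      using side[OF cl(1)] by blast
    then show ?thesis
    proof cases
      case (pl b)
      have "\<not> (c < A0 \<and> {c<..<A0} \<subseteq> snd ` C q)" for c
      proof
        assume c: "c < A0 \<and> {c<..<A0} \<subseteq> snd ` C q"
        have "(max b c + A0) / 2 \<in> {b<..<A0}" "(max b c + A0) / 2 \<in> {c<..<A0}"
          using pl(1) c by (auto simp: max_def)
        then show False using disj pl(2) c by blast
      qed
      then obtain c where c: "A0 < c" "{A0<..<c} \<subseteq> snd ` C q"
        using side[OF cl(2)] by blast
      have "A \<in> snd ` C p \<union> snd ` C q" if "A \<in> {b<..<A0} \<union> {A0<..<c}" for A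
        using that pl(2) c(2) by blast
      then show ?thesis using pl(1) c(1) in_lock by (metis UnE)
    next
      case (pr b)
      have "\<not> (c > A0 \<and> {A0<..<c} \<subseteq> snd ` C q)" for c
      proof
        assume c: "c > A0 \<and> {A0<..<c} \<subseteq> snd ` C q"
        have "(min b c + A0) / 2 \<in> {A0<..<b}" "(min b c + A0) / 2 \<in> {A0<..<c}"
          using pr(1) c by (auto simp: min_def)
        then show False using disj pr(2) c by blast
      qed
      then obtain c where c: "c < A0" "{c<..<A0} \<subseteq> snd ` C q"
        using side[OF cl(2)] by blast
      have "A \<in> snd ` C p \<union> snd ` C q" if "A \<in> {c<..<A0} \<union> {A0<..<b}" for A
        using that pr(2) c(2) by blast
      then show ?thesis using pr(1) c(1) in_lock by (metis UnE)
    qed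
  qed
  then obtain b c where bc: "b < A0" "A0 < c"
    "\<And>A. A \<in> {b<..<A0} \<union> {A0<..<c} \<Longrightarrow> \<exists>B. (B, A) \<in> lock_region n" by blast
  have eps: "\<exists>\<epsilon>>0. \<forall>A. A \<noteq> A0 \<and> \<bar>A - A0\<bar> < \<epsilon> \<longrightarrow> (\<exists>B. (B, A) \<in> lock_region n)"
  proof (rule exI[of _ "min (A0 - b) (c - A0)"], intro conjI allI impI)
    fix A assume "A \<noteq> A0 \<and> \<bar>A - A0\<bar> < min (A0 - b) (c - A0)"
    then have "A \<in> {b<..<A0} \<union> {A0<..<c}" by auto
    then show "\<exists>B. (B, A) \<in> lock_region n" by (rule bc(3))
  qed (use bc in auto)
  obtain x0 where x0: "pmap B0 A0 x0 = x0 + 2 * pi * of_int n"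
  proof -
    have "has_rotation_number w B0 A0 (of_int n)" using BA n by (simp add: level_set_def)
    from not_elliptic_rotation_number[OF phase_lock_not_elliptic[OF r BA] this] that
    show ?thesis by (metis of_int_eq_iff)
  qed
  \<comment> \<open>If the displacement is nonzero at \<open>y\<close>, a small change of
    \<open>B\<close> keeps its sign at \<open>y\<close> and gives it the opposite sign at the fixed
    point \<open>x0\<close>. This produces a point of the lock region on the line where there is
    none. The size of the change is half of what the Lipschitz constant allows.\<close>
  have ident: "pmap B0 A0 y = y + 2 * pi * of_int n" for y
  proof (rule ccontr)
    define D where "D = pmap B0 A0 y - y - 2 * pi * of_int n"
    assume "pmap B0 A0 y \<noteq> y + 2 * pi * of_int n"
    then consider "D > 0" | "D < 0" unfolding D_def by linarith
    then show False
    proof cases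
      case 1
      define d where "d = D / (2 * lipF)"
      have d: "d > 0" "lipF * d < D" using 1 lipF_pos by (auto simp: d_def)
      have "\<bar>pmap B0 A0 y - pmap (B0 - d) A0 y\<bar> \<le> lipF * d"
        using pmap_lipschitz[of B0 A0 y "B0 - d" A0 y] d by simp
      then have "pmap (B0 - d) A0 y > y + 2 * pi * of_int n" using d by (simp add: D_def)
      moreover have "pmap (B0 - d) A0 x0 < x0 + 2 * pi * of_int n"
        using pmap_strict_mono_B[of "B0 - d" B0 A0 x0] x0 d by simp
      ultimately show False using empty[of "B0 - d"] by (auto simp: lock_region_def)
    next
      case 2
      define d where "d = - D / (2 * lipF)"
      have d: "d > 0" "lipF * d < - D" using 2 lipF_pos by (auto simp: d_def divide_neg_pos)
      have "\<bar>pmap B0 A0 y - pmap (B0 + d) A0 y\<bar> \<le> lipF * d"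
        using pmap_lipschitz[of B0 A0 y "B0 + d" A0 y] d by simp
      then have "pmap (B0 + d) A0 y < y + 2 * pi * of_int n" using d by (simp add: D_def)
      moreover have "pmap (B0 + d) A0 x0 > x0 + 2 * pi * of_int n"
        using pmap_strict_mono_B[of B0 "B0 + d" A0 x0] x0 d by simp
      ultimately show False using empty[of "B0 + d"] by (auto simp: lock_region_def)
    qed
  qed
  show ?thesis using A0 r n eps ident by blast
qed

section \<open>Reading the displacement off the monodromy matrix near a constriction\<close>

lemma sin_pos_iff:
  assumes "\<bar>d\<bar> < pi"
  shows "0 < sin d \<longleftrightarrow> 0 < d" "sin d < 0 \<longleftrightarrow> d < 0"
proof -
  consider "d = 0" | "d > 0" | "d < 0" by linarith
  then have "(0 < sin d \<longleftrightarrow> 0 < d) \<and> (sin d < 0 \<longleftrightarrow> d < 0)"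
  proof cases
    case 2 then show ?thesis using sin_gt_zero[of d] assms by simp
  next
    case 3 then show ?thesis using sin_gt_zero[of "- d"] assms by simp
  qed simp
  then show "0 < sin d \<longleftrightarrow> 0 < d" "sin d < 0 \<longleftrightarrow> d < 0" by auto
qed

text \<open>At \<open>x = pi / 2\<close> and \<open>x = - pi / 2\<close> the values of
  \<open>mden\<close> have the same nonzero real part and imaginary parts of opposite sign, so the
  sines of the two displacements have opposite signs. The closeness hypothesis turns signs of sines
  into signs of displacements.\<close>

lemma hyperbolic_lock_region:
  assumes close: "\<And>x. \<bar>pmap B A x - x - 2 * pi * of_int n\<bar> < pi"
    and hyp: "\<bar>Im (al B A)\<bar> < \<bar>be B A\<bar>"
  shows "(B, A) \<in> lock_region n"
proof -
  define d where "d x = pmap B A x - x - 2 * pi * of_int n" for x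
  have s: "sin (d x) * (norm (mden B A x))\<^sup>2 = - 2 * Re (mden B A x) * Im (mden B A x)" for x
  proof -
    have "cis (d x) = cis (pmap B A x - x)"
      by (simp add: d_def complex_eq_iff sin_diff cos_diff sin_integer_2pi cos_integer_2pi)
    then have "cis (d x) * (mden B A x * cnj (mden B A x)) = cnj (mden B A x) * cnj (mden B A x)"
      using pmap_moebius[of B A x] by (metis mult.assoc)
    then have "Im (cis (d x) * of_real ((norm (mden B A x))\<^sup>2)) = Im (cnj (mden B A x) * cnj (mden B A x))"
      by (simp only: complex_norm_square)
    then show ?thesis by simp
  qed
  have dpi: "\<bar>d x\<bar> < pi" for x unfolding d_def by (rule close)
  have N: "(norm (mden B A x))\<^sup>2 > 0" for x using mden_nonzero by simp
  define u v R where "u = sin (d (pi / 2))" and "v = sin (d (- pi / 2))" and "R = Re (al B A)"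
  have hyp2: "(Im (al B A))\<^sup>2 < (be B A)\<^sup>2"
    using hyp by (metis abs_ge_zero power2_abs power_strict_mono zero_less_numeral)
  have R: "R\<^sup>2 > 0"
    using al_be[of B A, unfolded cmod_power2] hyp2 zero_le_power2[of "Im (al B A)"]
    unfolding R_def by linarith
  have "u * (norm (mden B A (pi / 2)))\<^sup>2 * (v * (norm (mden B A (- pi / 2)))\<^sup>2)
      = (- 2 * R * (be B A - Im (al B A))) * (- 2 * R * (- be B A - Im (al B A)))"
    unfolding u_def v_def s by (simp add: mden_def R_def)
  also have "\<dots> = 4 * R\<^sup>2 * ((Im (al B A))\<^sup>2 - (be B A)\<^sup>2)"
    by (simp add: power2_eq_square algebra_simps)
  also have "\<dots> < 0" using R hyp2 by (intro mult_pos_neg) auto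
  finally have "(u * v) * ((norm (mden B A (pi / 2)))\<^sup>2 * (norm (mden B A (- pi / 2)))\<^sup>2) < 0"
    by (simp only: mult_ac)
  then have "u * v < 0" using N[of "pi / 2"] N[of "- pi / 2"]
    by (metis mult_pos_pos not_less_iff_gr_or_eq zero_less_mult_pos2 mult_neg_neg mult_less_0_iff less_asym)
  then have "(u < 0 \<and> 0 < v) \<or> (0 < u \<and> v < 0)" by (auto simp: mult_less_0_iff)
  then have "(d (pi / 2) < 0 \<and> 0 < d (- pi / 2)) \<or> (0 < d (pi / 2) \<and> d (- pi / 2) < 0)"
    unfolding u_def v_def by (simp only: sin_pos_iff[OF dpi])
  then have "(\<exists>x. d x < 0) \<and> (\<exists>y. d y > 0)" by blast
  then obtain x y where "d x < 0" "d y > 0" by blast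
  then have "pmap B A x < x + 2 * pi * of_int n" "pmap B A y > y + 2 * pi * of_int n"
    by (simp_all add: d_def)
  then show ?thesis unfolding lock_region_def by blast
qed

text \<open>If the monodromy were trivial at a nearby point \<open>(B0, A)\<close>, the displacement
  would vanish identically there and, by monotonicity in \<open>B\<close>, have only one sign at any
  other point of the same horizontal line. That line would then miss the lock region.\<close>

lemma monodromy_near_constriction:
  assumes "constriction w B0 A0"
  shows "A0 \<noteq> 0 \<and> be B0 A0 = 0 \<and> Im (al B0 A0) = 0 \<and>
    (\<exists>n \<epsilon>. \<epsilon> > 0 \<and> is_phase_lock_area w (of_int n) \<and>
       (\<forall>A. A \<noteq> A0 \<and> \<bar>A - A0\<bar> < \<epsilon> \<longrightarrow> \<not> (be B0 A = 0 \<and> Im (al B0 A) = 0) \<and>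
          (\<bar>Im (al B0 A)\<bar> < \<bar>be B0 A\<bar> \<longrightarrow> (B0, A) \<in> interior (level_set w (of_int n)))))"
proof -
  obtain n \<epsilon>0 where A0: "A0 \<noteq> 0" and n: "is_phase_lock_area w (of_int n)"
    and ident: "\<And>x. pmap B0 A0 x = x + 2 * pi * of_int n"
    and \<epsilon>0: "\<epsilon>0 > 0" "\<And>A. A \<noteq> A0 \<Longrightarrow> \<bar>A - A0\<bar> < \<epsilon>0 \<Longrightarrow> \<exists>B. (B, A) \<in> lock_region n"
    using constriction_geometry[OF assms] by blast
  have "be B0 A0 * sin x = Im (al B0 A0)" for x
    using ident fixed_point_iff by blast
  from this[of 0] this[of "pi / 2"] have 0: "be B0 A0 = 0" "Im (al B0 A0) = 0" by simp_all
  define \<epsilon> where "\<epsilon> = min \<epsilon>0 (pi / lipF)"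
  have \<epsilon>: "\<epsilon> > 0" using \<epsilon>0 lipF_pos by (simp add: \<epsilon>_def)
  have close: "\<bar>pmap B0 A x - x - 2 * pi * of_int n\<bar> < pi" if "\<bar>A - A0\<bar> < \<epsilon>" for A x
  proof -
    have "\<bar>pmap B0 A x - pmap B0 A0 x\<bar> \<le> lipF * \<bar>A - A0\<bar>"
      using pmap_lipschitz[of B0 A x B0 A0 x] by simp
    also have "\<dots> < lipF * (pi / lipF)"
      using that lipF_pos by (intro mult_strict_left_mono) (auto simp: \<epsilon>_def)
    finally show ?thesis using lipF_pos by (simp add: ident)
  qed
  have "\<not> (be B0 A = 0 \<and> Im (al B0 A) = 0)" if A: "A \<noteq> A0" "\<bar>A - A0\<bar> < \<epsilon>" for A
  proof
    assume z: "be B0 A = 0 \<and> Im (al B0 A) = 0"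
    have id: "pmap B0 A x = x + 2 * pi * of_int n" for x
    proof -
      obtain m where m: "pmap B0 A x = x + 2 * pi * of_int m"
        using fixed_point_iff[of B0 A x] z by auto
      have "2 * pi * \<bar>of_int m - of_int n\<bar> < 2 * pi * 1"
        using close[OF A(2), of x] pi_gt_zero unfolding m
        by (simp add: abs_mult right_diff_distrib[symmetric])
      then have "\<bar>real_of_int (m - n)\<bar> < 1" using pi_gt_zero by simp
      then have "m = n" by linarith
      then show ?thesis using m by simp
    qed
    obtain B where "(B, A) \<in> lock_region n" using \<epsilon>0(2)[OF A(1)] A(2) by (auto simp: \<epsilon>_def)
    then obtain x y where "pmap B A x < x + 2 * pi * of_int n" "pmap B A y > y + 2 * pi * of_int n"
      by (auto simp: lock_region_def)
    then show False
      using pmap_strict_mono_B[of B B0 A y] pmap_strict_mono_B[of B0 B A x] id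
      by (cases B B0 rule: linorder_cases) (simp_all add: id)
  qed
  moreover have "(B0, A) \<in> interior (level_set w (of_int n))"
    if "\<bar>A - A0\<bar> < \<epsilon>" "\<bar>Im (al B0 A)\<bar> < \<bar>be B0 A\<bar>" for A
    using hyperbolic_lock_region[OF close[OF that(1)] that(2)] lock_region_subset_interior by blast
  ultimately show ?thesis using A0 0 n \<epsilon> by blast
qed

end

subsection \<open>Fourier coefficients\<close>

text \<open>The index is real because quasi-periodic solutions are expanded over shifted frequencies
  \<open>k0 + j\<close>.\<close>

definition fc :: "real \<Rightarrow> (real \<Rightarrow> complex) \<Rightarrow> complex" where
  "fc k f = integral {0..2*pi} (\<lambda>t. f t * cis (- (k * t))) / (2 * pi)"

lemma integrable_cis_mult:
  assumes "continuous_on {0..2*pi} f"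
  shows "(\<lambda>t. f t * cis (- (k * t))) integrable_on {0..2*pi}"
  by (intro integrable_continuous_real continuous_intros assms)

lemma fc_cong: "(\<And>t. t \<in> {0..2*pi} \<Longrightarrow> f t = g t) \<Longrightarrow> fc k f = fc k g"
  unfolding fc_def by (intro arg_cong2[where f = "(/)"] integral_cong) auto

lemma fc_add:
  assumes "continuous_on {0..2*pi} f" "continuous_on {0..2*pi} g"
  shows "fc k (\<lambda>t. f t + g t) = fc k f + fc k g"
  unfolding fc_def distrib_right
  by (simp add: integral_add integrable_cis_mult assms add_divide_distrib)

lemma fc_cmult: "fc k (\<lambda>t. c * f t) = c * fc k f"
  unfolding fc_def mult.assoc by simp

lemma fc_diff:
  assumes "continuous_on {0..2*pi} f" "continuous_on {0..2*pi} g"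
  shows "fc k (\<lambda>t. f t - g t) = fc k f - fc k g"
  using fc_add[OF assms(1), of "\<lambda>t. (-1) * g t" k] fc_cmult[of k "-1" g] assms
  by (simp add: continuous_on_minus)

lemma fc_cis_mult: "fc k (\<lambda>t. cis (s * t) * f t) = fc (k - s) f"
proof -
  have "cis (s * t) * f t * cis (- (k * t)) = f t * cis (- ((k - s) * t))" for t
  proof -
    have "cis (s * t) * f t * cis (- (k * t)) = f t * (cis (s * t) * cis (- (k * t)))"
      by (simp only: mult_ac)
    also have "\<dots> = f t * cis (- ((k - s) * t))"
      by (simp add: cis_mult algebra_simps)
    finally show ?thesis .
  qed
  then show ?thesis unfolding fc_def by presburger
qed

lemma fc_cnj: "fc k (\<lambda>t. cnj (f t)) = cnj (fc (- k) f)"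
  unfolding fc_def by (simp add: integral_cnj cis_cnj)

lemma fc_bound:
  assumes "continuous_on {0..2*pi} f" "\<And>t. t \<in> {0..2*pi} \<Longrightarrow> norm (f t) \<le> B"
  shows "norm (fc k f) \<le> B"
proof -
  have "norm (integral {0..2*pi} (\<lambda>t. f t * cis (- (k * t)))) \<le> B * (2 * pi - 0)"
    by (rule integral_bound) (auto intro!: continuous_intros assms simp: norm_mult)
  then show ?thesis
    by (simp add: fc_def norm_divide field_simps)
qed

lemma continuous_on_Icc_bounded:
  fixes f :: "real \<Rightarrow> complex"
  assumes "continuous_on {a..b} f"
  shows "\<exists>B. \<forall>t\<in>{a..b}. norm (f t) \<le> B"
  using compact_continuous_image[OF assms compact_Icc, THEN compact_imp_bounded]
  unfolding bounded_iff by auto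

lemma continuous_on_if_vector_derivative:
  assumes "\<And>t. (f has_vector_derivative f' t) (at t)"
  shows "continuous_on S f"
proof (intro continuous_at_imp_continuous_on ballI)
  fix t show "isCont f t" by (rule has_vector_derivative_continuous[OF assms])
qed

text \<open>Integration by parts without assuming periodicity. The boundary term is the jump over
  one period; through it the monodromy enters the recurrences.\<close>

lemma fc_deriv:
  assumes "\<And>t. (f has_vector_derivative f' t) (at t)"
  shows "fc k f' = \<i> * of_real k * fc k f + (f (2 * pi) * cis (- (2 * pi * k)) - f 0) / (2 * pi)"
proof -
  have fcont: "continuous_on {0..2*pi} f"
    by (rule continuous_on_if_vector_derivative[OF assms])
  have d: "((\<lambda>t. f t * cis (- (k * t))) has_vector_derivative
      (f' t * cis (- (k * t)) - \<i> * of_real k * (f t * cis (- (k * t))))) (at t)" for t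
  proof -
    have "((\<lambda>t. - (k * t)) has_real_derivative (- k)) (at t)"
      by (auto intro!: derivative_eq_intros)
    from has_vector_derivative_mult[OF assms has_vector_derivative_cis[OF this]]
    show ?thesis by (simp add: algebra_simps)
  qed
  have "((\<lambda>t. f' t * cis (- (k * t)) - \<i> * of_real k * (f t * cis (- (k * t)))) has_integral
      (f (2 * pi) * cis (- (k * (2 * pi))) - f 0 * cis (- (k * 0)))) {0..2*pi}"
    by (rule fundamental_theorem_of_calculus[OF _ has_vector_derivative_at_within[OF d]]) simp
  moreover have "((\<lambda>t. \<i> * of_real k * (f t * cis (- (k * t)))) has_integral
      (\<i> * of_real k * integral {0..2*pi} (\<lambda>t. f t * cis (- (k * t))))) {0..2*pi}"
    by (intro has_integral_mult_right integrable_integral integrable_cis_mult fcont)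
  ultimately have "((\<lambda>t. f' t * cis (- (k * t)) - \<i> * of_real k * (f t * cis (- (k * t))) + \<i> * of_real k * (f t * cis (- (k * t)))) has_integral
    ((f (2 * pi) * cis (- (k * (2 * pi))) - f 0 * cis (- (k * 0))) + \<i> * of_real k * integral {0..2*pi} (\<lambda>t. f t * cis (- (k * t))))) {0..2*pi}"
    by (rule has_integral_add)
  then have "((\<lambda>t. f' t * cis (- (k * t))) has_integral
    ((f (2 * pi) * cis (- (k * (2 * pi))) - f 0) + \<i> * of_real k * integral {0..2*pi} (\<lambda>t. f t * cis (- (k * t))))) {0..2*pi}"
    by simp
  then have "integral {0..2*pi} (\<lambda>t. f' t * cis (- (k * t))) =
    (f (2 * pi) * cis (- (k * (2 * pi))) - f 0) + \<i> * of_real k * integral {0..2*pi} (\<lambda>t. f t * cis (- (k * t)))"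
    by (rule integral_unique)
  then have "fc k f' = ((f (2 * pi) * cis (- (k * (2 * pi))) - f 0) + \<i> * of_real k * integral {0..2*pi} (\<lambda>t. f t * cis (- (k * t)))) / (2 * pi)"
    unfolding fc_def by (rule arg_cong)
  also have "\<dots> = \<i> * of_real k * fc k f + (f (2 * pi) * cis (- (k * (2 * pi))) - f 0) / (2 * pi)"
    unfolding fc_def add_divide_distrib times_divide_eq_right by (rule add.commute)
  also have "k * (2 * pi) = 2 * pi * k" by simp
  finally show ?thesis .
qed

lemma fc_decay:
  assumes f: "\<And>t. (f has_vector_derivative f' t) (at t)" and f': "continuous_on {0..2*pi} f'"
  shows "\<exists>C\<ge>0. \<forall>k. k \<noteq> 0 \<longrightarrow> norm (fc k f) \<le> C / \<bar>k\<bar>"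
proof -
  obtain B where B: "\<And>t. t \<in> {0..2*pi} \<Longrightarrow> norm (f' t) \<le> B"
    using continuous_on_Icc_bounded[OF f'] by blast
  define C where "C = B + norm (f (2 * pi)) + norm (f 0)"
  have B0: "B \<ge> 0" using order_trans[OF norm_ge_zero B[of 0]] by simp
  have "norm (fc k f) \<le> C / \<bar>k\<bar>" if k: "k \<noteq> 0" for k
  proof -
    have "\<i> * of_real k * fc k f = fc k f' - (f (2 * pi) * cis (- (2 * pi * k)) - f 0) / (2 * pi)"
      unfolding fc_deriv[OF f, of k] by simp
    from arg_cong[OF this, of norm]
    have "\<bar>k\<bar> * norm (fc k f) = norm (fc k f' - (f (2 * pi) * cis (- (2 * pi * k)) - f 0) / (2 * pi))"
      by (simp add: norm_mult)
    also have "\<dots> \<le> norm (fc k f') + norm ((f (2 * pi) * cis (- (2 * pi * k)) - f 0) / (2 * pi))"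
      by (rule norm_triangle_ineq4)
    also have "\<dots> \<le> B + norm (f (2 * pi) * cis (- (2 * pi * k)) - f 0) / 1"
    proof (intro add_mono fc_bound f' B)
      show "norm ((f (2 * pi) * cis (- (2 * pi * k)) - f 0) / (2 * pi)) \<le> norm (f (2 * pi) * cis (- (2 * pi * k)) - f 0) / 1"
        unfolding norm_divide using pi_gt3 by (intro divide_left_mono) auto
    qed
    also have "norm (f (2 * pi) * cis (- (2 * pi * k)) - f 0) \<le> norm (f (2 * pi)) + norm (f 0)"
      by (rule order_trans[OF norm_triangle_ineq4]) (simp add: norm_mult)
    finally have "\<bar>k\<bar> * norm (fc k f) \<le> C" by (simp add: C_def)
    then show ?thesis using k by (simp add: pos_le_divide_eq mult.commute)
  qed
  moreover have "C \<ge> 0" using B0 by (simp add: C_def)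
  ultimately show ?thesis by blast
qed

lemma fc_tendsto_0:
  assumes f: "\<And>t. (f has_vector_derivative f' t) (at t)" and f': "continuous_on {0..2*pi} f'"
    and g: "filterlim g at_infinity F"
  shows "((\<lambda>n. fc (g n) f) \<longlongrightarrow> 0) F"
proof -
  obtain C where C: "C \<ge> 0" "\<And>k. k \<noteq> 0 \<Longrightarrow> norm (fc k f) \<le> C / \<bar>k\<bar>"
    using fc_decay[OF f f'] by blast
  have "((\<lambda>n. C * norm (inverse (g n))) \<longlongrightarrow> C * norm (0::real)) F"
    by (intro tendsto_intros filterlim_compose[OF tendsto_inverse_0 g])
  then have lim: "((\<lambda>n. C * norm (inverse (g n))) \<longlongrightarrow> 0) F" by simp
  have "\<forall>\<^sub>F n in F. g n \<noteq> 0"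
    using filterlim_at_infinity_imp_eventually_ne[OF g] .
  then have "\<forall>\<^sub>F n in F. norm (fc (g n) f) \<le> C * norm (inverse (g n))"
  proof eventually_elim
    case (elim n)
    then show ?case using C(2)[OF elim] by (simp add: divide_inverse)
  qed
  then show ?thesis by (rule Lim_null_comparison[OF _ lim])
qed

lemma fc_suminf:
  fixes g :: "nat \<Rightarrow> real \<Rightarrow> complex"
  assumes g: "\<And>n. continuous_on {0..2*pi} (g n)"
    and M: "\<And>n t. t \<in> {0..2*pi} \<Longrightarrow> norm (g n t) \<le> M n" "summable M"
  shows "(\<lambda>n. fc k (g n)) sums fc k (\<lambda>t. \<Sum>n. g n t)" "continuous_on {0..2*pi} (\<lambda>t. \<Sum>n. g n t)"
proof -
  have ul0: "uniform_limit {0..2*pi} (\<lambda>n t. \<Sum>i<n. g i t) (\<lambda>t. \<Sum>i. g i t) sequentially"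
    by (rule Weierstrass_m_test[OF M])
  show c: "continuous_on {0..2*pi} (\<lambda>t. \<Sum>n. g n t)"
    by (rule uniform_limit_theorem[OF _ ul0]) (auto intro!: always_eventually continuous_intros g)
  have ul: "uniform_limit {0..2*pi} (\<lambda>n t. \<Sum>i<n. g i t * cis (- (k * t))) (\<lambda>t. (\<Sum>i. g i t) * cis (- (k * t))) sequentially"
  proof -
    have "uniform_limit {0..2*pi} (\<lambda>n t. \<Sum>i<n. g i t * cis (- (k * t))) (\<lambda>t. \<Sum>i. g i t * cis (- (k * t))) sequentially"
      by (rule Weierstrass_m_test[OF _ M(2)]) (use M(1) in \<open>simp add: norm_mult\<close>)
    moreover have "(\<Sum>i. g i t * cis (- (k * t))) = (\<Sum>i. g i t) * cis (- (k * t))" if "t \<in> {0..2*pi}" for t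
      by (rule suminf_mult2[symmetric], rule summable_comparison_test'[OF M(2)]) (use M(1)[OF that] in auto)
    ultimately show ?thesis
      by (subst (asm) uniform_limit_cong'[OF refl]) assumption+
  qed
  have "continuous_on {0..2*pi} (\<lambda>t. \<Sum>i<n. g i t * cis (- (k * t)))" for n
    by (intro continuous_intros g)
  from uniform_limit_integral[OF ul this] obtain I J where
    I: "\<And>n. ((\<lambda>t. \<Sum>i<n. g i t * cis (- (k * t))) has_integral I n) {0..2*pi}"
    and J: "((\<lambda>t. (\<Sum>i. g i t) * cis (- (k * t))) has_integral J) {0..2*pi}" "I \<longlonglongrightarrow> J"
    by auto
  have "I = (\<lambda>n. \<Sum>i<n. 2 * pi * fc k (g i))"
  proof
    fix n show "I n = (\<Sum>i<n. 2 * pi * fc k (g i))"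
      using integral_unique[OF I[of n]]
      by (simp add: integral_sum integrable_cis_mult g fc_def)
  qed
  then have "(\<lambda>i. 2 * pi * fc k (g i)) sums J"
    using J(2) unfolding sums_def by simp
  from sums_divide[OF this, of "2 * pi"] show "(\<lambda>n. fc k (g n)) sums fc k (\<lambda>t. \<Sum>n. g n t)"
    using integral_unique[OF J(1)] by (simp add: fc_def)
qed

text \<open>The exponential factor has a one-sided Fourier series, so multiplication by it preserves
  one-sidedness in the direction given by \<open>s\<close>.\<close>

lemma fc_exp_mult:
  assumes f: "continuous_on {0..2*pi} f"
  shows "(\<lambda>n. c ^ n / fact n * fc (k - s * real n) f) sums fc k (\<lambda>t. exp (c * cis (s * t)) * f t)"
proof -
  obtain B where B: "\<And>t. t \<in> {0..2*pi} \<Longrightarrow> norm (f t) \<le> B"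
    using continuous_on_Icc_bounded[OF f] by blast
  define g where "g n t = c ^ n / fact n * (cis (s * real n * t) * f t)" for n t
  have e: "(\<lambda>n. g n t) sums (exp (c * cis (s * t)) * f t)" for t
  proof -
    have "(\<lambda>n. (c * cis (s * t)) ^ n /\<^sub>R fact n * f t) sums (exp (c * cis (s * t)) * f t)"
      by (intro sums_mult2 exp_converges)
    moreover have "(c * cis (s * t)) ^ n /\<^sub>R fact n * f t = g n t" for n
      by (simp add: g_def power_mult_distrib Complex.DeMoivre scaleR_conv_of_real field_simps)
    ultimately show ?thesis by simp
  qed
  have "(\<lambda>n. fc k (g n)) sums fc k (\<lambda>t. \<Sum>n. g n t)"
  proof (rule fc_suminf(1))
    show "continuous_on {0..2*pi} (g n)" for n
      unfolding g_def[abs_def] by (intro continuous_intros f)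
    show "norm (g n t) \<le> norm c ^ n / fact n * B" if "t \<in> {0..2*pi}" for n t
      using B[OF that] by (simp add: g_def norm_mult norm_divide norm_power divide_right_mono mult_left_mono)
    have "summable (\<lambda>n. norm c ^ n /\<^sub>R fact n)" by (rule summable_exp_generic)
    then have "summable (\<lambda>n. norm c ^ n /\<^sub>R fact n * B)" by (rule summable_mult2)
    then show "summable (\<lambda>n. norm c ^ n / fact n * B)" by (simp add: divide_inverse mult_ac)
  qed
  moreover have "fc k (g n) = c ^ n / fact n * fc (k - s * real n) f" for n
    unfolding g_def[abs_def] fc_cmult fc_cis_mult ..
  moreover have "(\<lambda>t. \<Sum>n. g n t) = (\<lambda>t. exp (c * cis (s * t)) * f t)"
    using e by (simp add: sums_iff)
  ultimately show ?thesis by simp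
qed

section \<open>Uniqueness and convergence of Fourier series\<close>

lemma fc_cis: "fc (of_int j) (\<lambda>t. cis (of_int k * t)) = (if j = k then 1 else 0)"
proof -
  have "fc (of_int j) (\<lambda>t. cis (of_int k * t) * 1) = fc (of_int j - of_int k) (\<lambda>t. 1)"
    by (rule fc_cis_mult)
  moreover
  have "fc (of_int n) (\<lambda>t. 1) = (if n = 0 then 1 else 0)" for n :: int
  proof (cases "n = 0")
    case True
    then show ?thesis by (simp add: fc_def scaleR_conv_of_real)
  next
    case False
    have "cis (- (2 * pi * of_int n)) = 1"
      by (simp add: complex_eq_iff cos_integer_2pi sin_integer_2pi)
    then have "\<i> * of_real (of_int n) * fc (of_int n) (\<lambda>t. 1) = fc (of_int n) (\<lambda>t. 0)"
      using fc_deriv[of "\<lambda>t. 1" "\<lambda>t. 0" "of_int n"] by simp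
    then show ?thesis using False by (simp add: fc_def)
  qed
  from this[of "j - k"] have "fc (of_int j - of_int k) (\<lambda>t. 1) = (if j = k then 1 else 0)"
    by simp
  ultimately show ?thesis by simp
qed

lemma continuous_on_real_polynomial_cis:
  assumes "real_polynomial_function p"
  shows "continuous_on S (\<lambda>t. complex_of_real (p (cis t)))"
proof -
  have "continuous_on UNIV p"
    by (intro continuous_at_imp_continuous_on ballI continuous_real_polymonial_function assms)
  from continuous_on_compose2[OF this, of S cis] have "continuous_on S (\<lambda>t. p (cis t))"
    by (simp add: continuous_on_cis)
  then show ?thesis by (rule continuous_on_of_real)
qed

text \<open>A linear function on the circle only shifts frequencies by one in either direction, so
  the vanishing of all coefficients survives multiplication by any real polynomial.\<close>

lemma real_polynomial_function_fc_zero: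
  assumes "real_polynomial_function p"
    and "continuous_on {0..2*pi} h" and "\<And>j::int. fc (of_int j) h = 0"
  shows "fc (of_int j) (\<lambda>t. h t * of_real (p (cis t))) = 0"
  using assms
proof (induction p arbitrary: h j rule: real_polynomial_function.induct)
  case (linear p)
  interpret bounded_linear p by fact
  have p: "p (cis t) = p 1 * cos t + p \<i> * sin t" for t
  proof -
    have "cis t = cos t *\<^sub>R 1 + sin t *\<^sub>R \<i>" by (simp add: complex_eq_iff)
    then have "p (cis t) = p (cos t *\<^sub>R 1 + sin t *\<^sub>R \<i>)" by simp
    then show ?thesis by (simp only: add scaleR) simp
  qed
  define u v where "u = (p 1 - \<i> * p \<i>) / 2" and "v = (p 1 + \<i> * p \<i>) / 2"
  have "h t * of_real (p (cis t)) = u * (cis (1 * t) * h t) + v * (cis ((-1) * t) * h t)" for t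
  proof -
    have "of_real (p 1 * cos t + p \<i> * sin t) = u * cis (1 * t) + v * cis ((-1) * t)"
      unfolding u_def v_def by (simp add: complex_eq_iff field_simps)
    then show ?thesis unfolding p by (simp only: distrib_left mult_ac)
  qed
  then have "fc (of_int j) (\<lambda>t. h t * of_real (p (cis t))) =
     fc (of_int j) (\<lambda>t. u * (cis (1 * t) * h t) + v * (cis ((-1) * t) * h t))"
    by (simp only:)
  also have "\<dots> = u * fc (of_int j - 1) h + v * fc (of_int j - (-1)) h"
  proof -
    have c: "continuous_on {0..2*pi} (\<lambda>t. x * (cis (s * t) * h t))" for x s
      by (intro continuous_intros linear.prems(1))
    show ?thesis by (simp only: fc_add[OF c c] fc_cmult fc_cis_mult)
  qed
  also have "\<dots> = 0"
    using linear.prems(2)[of "j - 1"] linear.prems(2)[of "j + 1"] by simp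
  finally show ?case .
next
  case (const c)
  show ?case using fc_cmult[of "of_int j" "of_real c" h] const.prems by (simp add: mult.commute)
next
  case (add p q)
  have cont: "continuous_on {0..2*pi} (\<lambda>t. h t * of_real (r (cis t)))"
    if "real_polynomial_function r" for r
    by (rule continuous_on_mult[OF add.prems(1) continuous_on_real_polynomial_cis[OF that]])
  show ?case
    unfolding of_real_add distrib_left
    by (subst fc_add[OF cont[OF add.hyps(1)] cont[OF add.hyps(2)]]) (simp add: add.IH[OF add.prems])
next
  case (mult p q)
  have "continuous_on {0..2*pi} (\<lambda>t. h t * of_real (p (cis t)))"
    by (rule continuous_on_mult[OF mult.prems(1) continuous_on_real_polynomial_cis[OF mult.hyps(1)]])
  from mult.IH(2)[OF this mult.IH(1)[OF mult.prems]] show ?case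
    by (simp only: of_real_mult mult.assoc)
qed

text \<open>Stone-Weierstrass: \<open>f\<close> integrates to 0 against all real polynomials on the
  circle, and these approximate its real and imaginary part uniformly, so the integral of |f|^2 is
  0.\<close>

lemma fc_unique:
  assumes f: "continuous_on {0..2*pi} f" and per: "f (2 * pi) = f 0"
    and z: "\<And>j::int. fc (of_int j) f = 0" and t: "t \<in> {0..2*pi}"
  shows "f t = 0"
proof -
  define F where "F z = f (Arg2pi z)" for z
  have Fcis: "F (cis t) = f t" if "t \<in> {0..2*pi}" for t
  proof (cases "t = 2 * pi")
    case True
    moreover have "cis (2 * pi) = 1" by (simp add: complex_eq_iff)
    moreover have "Arg2pi 1 = 0" by (rule Arg2pi_unique[of 1]) auto
    ultimately show ?thesis using per by (simp add: F_def)
  next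
    case False
    have "Arg2pi (cis t) = t"
      by (rule Arg2pi_unique[of 1]) (use that False in \<open>auto simp: cis_conv_exp\<close>)
    then show ?thesis by (simp add: F_def)
  qed
  have Arg_range: "Arg2pi z \<in> {0..2*pi}" for z
    using Arg2pi_ge_0[of z] Arg2pi_lt_2pi[of z] by simp
  have cisA: "cis (Arg2pi z) = z" if "z \<in> sphere 0 1" for z
  proof -
    have "cis (Arg2pi z) = of_real (norm z) * exp (\<i> * of_real (Arg2pi z))"
      using that by (simp add: cis_conv_exp)
    also have "\<dots> = z" by (rule Arg2pi_eq[symmetric])
    finally show ?thesis .
  qed
  \<comment> \<open>Periodicity of \<open>f\<close> compensates the jump of \<open>Arg2pi\<close> at
    1. The jump is never examined: preimages of closed sets are images of compact sets under
    \<open>cis\<close>.\<close>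
  have F: "continuous_on (sphere 0 1) F"
  proof (rule iffD2[OF continuous_on_closed_vimage[OF closed_sphere]], intro allI impI)
    fix B :: "complex set" assume B: "closed B"
    have "F -` B \<inter> sphere 0 1 = cis ` (f -` B \<inter> {0..2*pi})"
    proof (intro equalityI subsetI)
      fix z assume z: "z \<in> F -` B \<inter> sphere 0 1"
      show "z \<in> cis ` (f -` B \<inter> {0..2*pi})"
      proof (rule image_eqI)
        show "z = cis (Arg2pi z)" using cisA z by simp
        show "Arg2pi z \<in> f -` B \<inter> {0..2*pi}" using z Arg_range[of z] by (simp add: F_def)
      qed
    next
      fix z assume "z \<in> cis ` (f -` B \<inter> {0..2*pi})"
      then obtain t where "z = cis t" "f t \<in> B" "t \<in> {0..2*pi}" by blast
      then show "z \<in> F -` B \<inter> sphere 0 1" using Fcis[of t] by simp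
    qed
    moreover have "closed (f -` B \<inter> {0..2*pi})"
      using iffD1[OF continuous_on_closed_vimage[OF closed_atLeastAtMost] f] B by blast
    then have "compact (f -` B \<inter> {0..2*pi})"
      using closed_Int_compact[of "f -` B \<inter> {0..2*pi}" "{0..2*pi}"] compact_Icc
      by (metis Int_assoc Int_absorb)
    then have "compact (cis ` (f -` B \<inter> {0..2*pi}))"
      by (intro compact_continuous_image continuous_intros)
    ultimately show "closed (F -` B \<inter> sphere 0 1)" by (simp add: compact_imp_closed)
  qed
  obtain M where M: "\<And>t. t \<in> {0..2*pi} \<Longrightarrow> norm (f t) \<le> M"
    using continuous_on_Icc_bounded[OF f] by blast
  have M0: "M \<ge> 0" using order_trans[OF norm_ge_zero M[of 0]] by simp
  define I where "I = integral {0..2*pi} (\<lambda>t. (norm (f t))\<^sup>2)"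
  have small: "I \<le> M * (2 * e) * (2 * pi)" if e: "e > 0" for e
  proof -
    obtain p where p: "real_polynomial_function p" "\<And>z. z \<in> sphere 0 1 \<Longrightarrow> \<bar>Re (F z) - p z\<bar> < e"
      by (rule Stone_Weierstrass_real_polynomial_function[OF compact_sphere continuous_on_Re[OF F] e]) blast
    obtain q where q: "real_polynomial_function q" "\<And>z. z \<in> sphere 0 1 \<Longrightarrow> \<bar>Im (F z) - q z\<bar> < e"
      by (rule Stone_Weierstrass_real_polynomial_function[OF compact_sphere continuous_on_Im[OF F] e]) blast
    have int0: "((\<lambda>t. f t * of_real (r (cis t))) has_integral 0) {0..2*pi}" if "real_polynomial_function r" for r
    proof -
      have "integral {0..2*pi} (\<lambda>t. f t * of_real (r (cis t))) = 0"
        using real_polynomial_function_fc_zero[OF that f z, of 0] by (simp add: fc_def)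
      moreover have "(\<lambda>t. f t * of_real (r (cis t))) integrable_on {0..2*pi}"
        by (intro integrable_continuous_real continuous_on_mult[OF f continuous_on_real_polynomial_cis[OF that]])
      ultimately show ?thesis by (metis integrable_integral)
    qed
    \<comment> \<open>\<open>G\<close> has the same integral as |f|^2, since \<open>f\<close>
      integrates to 0 against both polynomials, and it is uniformly small.\<close>
    define G where "G t = f t * (cnj (f t) - (of_real (p (cis t)) - \<i> * of_real (q (cis t))))" for t
    have "((\<lambda>t. f t * cnj (f t)) has_integral integral {0..2*pi} (\<lambda>t. f t * cnj (f t))) {0..2*pi}"
      by (intro integrable_integral integrable_continuous_real continuous_intros f)
    from has_integral_diff[OF this has_integral_diff[OF int0[OF p(1)] has_integral_mult_right[OF int0[OF q(1)], of "\<i>"]]]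
    have "(G has_integral integral {0..2*pi} (\<lambda>t. f t * cnj (f t))) {0..2*pi}"
      by (simp add: G_def[abs_def] algebra_simps)
    moreover have "integral {0..2*pi} (\<lambda>t. f t * cnj (f t)) = of_real I"
    proof -
      have "((\<lambda>t. (norm (f t))\<^sup>2) has_integral I) {0..2*pi}"
        unfolding I_def by (intro integrable_integral integrable_continuous_real continuous_intros f)
      from has_integral_of_real[OF this] have "((\<lambda>t. complex_of_real ((norm (f t))\<^sup>2)) has_integral of_real I) {0..2*pi}" .
      from integral_unique[OF this[unfolded complex_norm_square]] show ?thesis .
    qed
    ultimately have GI: "integral {0..2*pi} G = of_real I" by (simp add: integral_unique)
    have "norm (integral {0..2*pi} G) \<le> M * (2 * e) * (2 * pi - 0)"
    proof (rule integral_bound)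
      show "continuous_on {0..2*pi} G"
        unfolding G_def[abs_def]
        by (intro continuous_on_mult continuous_on_diff continuous_on_const continuous_on_cnj f
            continuous_on_real_polynomial_cis p q)
      fix t :: real assume t: "t \<in> {0..2*pi}"
      have F: "f t = F (cis t)" using Fcis t by simp
      have "norm (cnj (f t) - (of_real (p (cis t)) - \<i> * of_real (q (cis t)))) \<le>
        \<bar>Re (f t) - p (cis t)\<bar> + \<bar>Im (f t) - q (cis t)\<bar>"
        by (rule order_trans[OF cmod_le]) simp
      also have "\<dots> \<le> 2 * e"
        using p(2)[of "cis t"] q(2)[of "cis t"] unfolding F by simp
      finally show "norm (G t) \<le> M * (2 * e)"
        unfolding G_def norm_mult using M[OF t] M0 by (intro mult_mono) auto
    qed simp
    then show ?thesis unfolding GI by simp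
  qed
  have "I \<le> 0"
  proof (rule ccontr)
    assume "\<not> I \<le> 0"
    then have I: "I > 0" by simp
    define N where "N = M + 1"
    have N: "N > 0" "M \<le> N" using M0 by (simp_all add: N_def)
    define e where "e = I / (8 * pi * N)"
    have e: "e > 0" using I N by (simp add: e_def)
    have "M * (2 * e) * (2 * pi) \<le> N * (2 * e) * (2 * pi)" using e N by (intro mult_right_mono) auto
    also have "\<dots> = I / 2" using N by (simp add: e_def field_simps)
    finally show False using small[OF e] I by simp
  qed
  moreover have "I \<ge> 0" unfolding I_def
    by (intro integral_nonneg integrable_continuous_real continuous_intros f) auto
  ultimately have "I = 0" by simp
  moreover have "continuous_on {0..2*pi} (\<lambda>t. (norm (f t))\<^sup>2)"
    by (intro continuous_intros f)
  ultimately have "\<forall>t\<in>{0..2*pi}. (norm (f t))\<^sup>2 = 0"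
    unfolding I_def by (subst (asm) integral_eq_0_iff) simp_all
  then have "(norm (f t))\<^sup>2 = 0"
    using t by (rule bspec)
  then show ?thesis by simp
qed

text \<open>The sum of the absolutely convergent series has the same coefficients as
  \<open>f\<close>, so \<open>fc_unique\<close> applies to the difference.\<close>

lemma fourier_series_nonneg:
  assumes f: "continuous_on {0..2*pi} f" "f (2 * pi) = f 0"
    and c: "\<And>n. fc (real n) f = c n" "summable (\<lambda>n. norm (c n))"
    and neg: "\<And>j::int. j < 0 \<Longrightarrow> fc (of_int j) f = 0" and t: "t \<in> {0..2*pi}"
  shows "(\<lambda>n. c n * cis (real n * t)) sums f t"
proof -
  define g where "g n t = c n * cis (real n * t)" for n t
  have gc: "continuous_on {0..2*pi} (g n)" for n unfolding g_def[abs_def] by (intro continuous_intros)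
  have gb: "norm (g n t) \<le> norm (c n)" for n t by (simp add: g_def norm_mult)
  note S = fc_suminf[of g, OF gc gb c(2)]
  have sg: "summable (\<lambda>n. g n t)" for t
    by (rule summable_comparison_test'[OF c(2)]) (use gb in auto)
  define h where "h t = f t - (\<Sum>n. g n t)" for t
  have "h t = 0"
  proof (rule fc_unique[OF _ _ _ t])
    show "continuous_on {0..2*pi} h" unfolding h_def[abs_def] by (intro continuous_intros f S)
    have "g n (2 * pi) = g n 0" for n
    proof -
      have "cis (real n * (2 * pi)) = 1"
        using cos_integer_2pi[of "int n"] sin_integer_2pi[of "int n"] by (simp add: complex_eq_iff mult_ac)
      then show ?thesis by (simp add: g_def)
    qed
    then show "h (2 * pi) = h 0" using f(2) by (simp add: h_def)
    fix j :: int
    have fg: "fc (of_int j) (g n) = (if j = int n then c n else 0)" for n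
      using fc_cmult[of "of_int j" "c n" "\<lambda>t. cis (real n * t)"] fc_cis[of j "int n"]
      by (simp add: g_def[abs_def])
    have "(\<lambda>n. fc (of_int j) (g n)) sums fc (of_int j) f"
    proof (cases "j < 0")
      case True
      then have "(\<lambda>n. fc (of_int j) (g n)) = (\<lambda>n. 0)" using fg by auto
      then show ?thesis using neg[OF True] by simp
    next
      case False
      then obtain m where m: "j = int m" by (metis linorder_not_less zero_le_imp_eq_int)
      then have "(\<lambda>n. fc (of_int j) (g n)) = (\<lambda>n. if n = m then c n else 0)" using fg by auto
      then show ?thesis using sums_single[of m c] c(1)[of m] m by simp
    qed
    then have "fc (of_int j) f = fc (of_int j) (\<lambda>t. \<Sum>n. g n t)" using S(1) sums_unique2 by blast
    then show "fc (of_int j) h = 0"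
      unfolding h_def[abs_def] using fc_diff[OF f(1) S(2)] by simp
  qed
  then show ?thesis using sg[of t] by (simp add: h_def g_def sums_iff)
qed

subsection \<open>Periodic solutions for integer \<open>l\<close>\<close>

text \<open>One exponential factor is holomorphic inside the unit circle, the other outside. This
  splitting of the phase is what makes the changes of unknowns \<open>gaugeX\<close> and
  \<open>gaugeY\<close> work.\<close>

lemma hh_exp: "hh l m t = cis (l * t) * exp (of_real m * (cis t - cis (- t)))"
proof -
  have "cis t - cis (- t) = \<i> * of_real (2 * sin t)" by (simp add: complex_eq_iff)
  then have "exp (of_real m * (cis t - cis (- t))) = cis (2 * m * sin t)"
    by (simp add: cis_conv_exp mult_ac)
  then show ?thesis by (simp add: hh_def cis_mult)
qed

lemma exp_cis_deriv:
  "((\<lambda>t. exp (c * cis (s * t))) has_vector_derivative (\<i> * of_real s * c * cis (s * t) * exp (c * cis (s * t)))) (at t)"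
proof -
  have "((\<lambda>t. s * t) has_real_derivative s) (at t)" by (auto intro!: derivative_eq_intros)
  from has_vector_derivative_mult_right[OF has_vector_derivative_cis[OF this], of c]
  have "((\<lambda>t. c * cis (s * t)) has_vector_derivative (c * (\<i> * of_real s * cis (s * t)))) (at t)" .
  from field_vector_diff_chain_at[OF this DERIV_exp] show ?thesis
    by (simp add: o_def mult_ac)
qed

lemma lin_sol_init:
  assumes "a \<ge> 0"
  shows "\<exists>X Y. lin_sol a l m X Y \<and> X 0 = x \<and> Y 0 = y"
proof (intro exI conjI)
  show "lin_sol a l m (\<lambda>t. x * fundP a l m t + y * cnj (fundQ a l m t))
      (\<lambda>t. x * fundQ a l m t + y * cnj (fundP a l m t))"
    by (rule lin_sol_comb[OF fund(1)[OF assms] lin_sol_cnj[OF fund(1)[OF assms]]])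
qed (use fund(2,3)[OF assms, of l m] in simp_all)

definition periodic_sol :: "real \<Rightarrow> int \<Rightarrow> real \<Rightarrow> (real \<Rightarrow> complex) \<Rightarrow> (real \<Rightarrow> complex) \<Rightarrow> bool" where
  "periodic_sol a L m P Q \<longleftrightarrow> lin_sol a (of_int L) m P Q \<and> P (2 * pi) = P 0 \<and> Q (2 * pi) = Q 0"

text \<open>Together with \<open>gaugeY\<close> this turns the system into one where each unknown is
  coupled to a single neighbouring frequency of its own and to the same frequency of the other. The
  sign \<open>s\<close> selects the neighbour; \<open>gauge_casoratian\<close> pairs the two
  signs.\<close>

definition gaugeX :: "real \<Rightarrow> int \<Rightarrow> (real \<Rightarrow> complex) \<Rightarrow> real \<Rightarrow> complex" where
  "gaugeX m s P t = exp (of_real (of_int s * m) * cis (of_int s * t)) * P t"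

definition gaugeY :: "int \<Rightarrow> real \<Rightarrow> int \<Rightarrow> (real \<Rightarrow> complex) \<Rightarrow> real \<Rightarrow> complex" where
  "gaugeY L m s Q t = cis (- of_int L * t) * (exp (of_real (of_int s * m) * cis (of_int (- s) * t)) * Q t)"

lemma cis_int_2pi [simp]: "cis (2 * pi * of_int n) = 1" "cis (of_int n * (2 * pi)) = 1"
  "cis (- (2 * pi * of_int n)) = 1" "cis (- (of_int n * (2 * pi))) = 1"
  using cos_integer_2pi[of n] sin_integer_2pi[of n]
  by (simp_all add: complex_eq_iff mult_ac)

lemma gauge_relation:
  assumes "s = 1 \<or> s = -1"
  shows "hh (of_int L) m t * cis (- of_int L * t) * exp (of_real (of_int s * m) * cis (of_int (- s) * t))
     = exp (of_real (of_int s * m) * cis (of_int s * t))"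
    "cnj (hh (of_int L) m t) * exp (of_real (of_int s * m) * cis (of_int s * t))
     = cis (- of_int L * t) * exp (of_real (of_int s * m) * cis (of_int (- s) * t))"
proof -
  have c: "cis (of_int L * t) * cis (- of_int L * t) = 1"
    by (simp add: cis_mult)
  have "hh (of_int L) m t * cis (- of_int L * t) * exp (of_real (of_int s * m) * cis (of_int (- s) * t))
    = (cis (of_int L * t) * cis (- of_int L * t)) * (exp (of_real m * (cis t - cis (- t))) * exp (of_real (of_int s * m) * cis (of_int (- s) * t)))"
    unfolding hh_exp by (simp only: mult_ac)
  also have "\<dots> = exp (of_real m * (cis t - cis (- t)) + of_real (of_int s * m) * cis (of_int (- s) * t))"
    unfolding c by (simp add: exp_add)
  also have "\<dots> = exp (of_real (of_int s * m) * cis (of_int s * t))"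
    using assms by (auto simp: algebra_simps)
  finally show 1: "hh (of_int L) m t * cis (- of_int L * t) * exp (of_real (of_int s * m) * cis (of_int (- s) * t))
     = exp (of_real (of_int s * m) * cis (of_int s * t))" .
  show "cnj (hh (of_int L) m t) * exp (of_real (of_int s * m) * cis (of_int s * t))
     = cis (- of_int L * t) * exp (of_real (of_int s * m) * cis (of_int (- s) * t))"
    unfolding 1[symmetric] using hh_cnj_mult(2)[of "of_int L" m t]
    by (simp add: mult.assoc[symmetric])
qed

lemma gauge_deriv:
  assumes sol: "lin_sol a (of_int L) m P Q" and s: "s = 1 \<or> s = -1"
  shows "(gaugeX m s P has_vector_derivative
      (\<i> * of_real m * (cis (of_int s * t) * gaugeX m s P t) + of_real a * gaugeY L m s Q t)) (at t)"
    "(gaugeY L m s Q has_vector_derivative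
      (- (\<i> * of_int L) * gaugeY L m s Q t + - (\<i> * of_real m) * (cis (of_int (- s) * t) * gaugeY L m s Q t)
        + of_real a * gaugeX m s P t)) (at t)"
proof -
  have P: "(P has_vector_derivative (of_real a * cnj (hh (of_int L) m t) * Q t)) (at t)"
    and Q: "(Q has_vector_derivative (of_real a * hh (of_int L) m t * P t)) (at t)"
    using sol by (auto simp: lin_sol_def)
  have ss: "complex_of_real (of_int s) * of_real (of_int s * m) = of_real m" "of_int s * of_int s = (1::complex)"
    using s by auto
  define E F where "E = exp (of_real (of_int s * m) * cis (of_int s * t))"
    and "F = exp (of_real (of_int s * m) * cis (of_int (- s) * t))"
  have Ed: "((\<lambda>t. exp (of_real (of_int s * m) * cis (of_int s * t))) has_vector_derivative (\<i> * of_real m * cis (of_int s * t) * E)) (at t)"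
    using exp_cis_deriv[of "of_real (of_int s * m)" "of_int s" t] s by (auto simp: E_def)
  have Fd: "((\<lambda>t. exp (of_real (of_int s * m) * cis (of_int (- s) * t))) has_vector_derivative (- (\<i> * of_real m) * cis (of_int (- s) * t) * F)) (at t)"
    using exp_cis_deriv[of "of_real (of_int s * m)" "of_int (- s)" t] s by (auto simp: F_def)
  have rel: "hh (of_int L) m t * cis (- of_int L * t) * F = E"
    "cnj (hh (of_int L) m t) * E = cis (- of_int L * t) * F"
    using gauge_relation[OF s, of L m t] by (simp_all only: E_def F_def)
  have "E * (of_real a * cnj (hh (of_int L) m t) * Q t) = of_real a * (cnj (hh (of_int L) m t) * E) * Q t"
    by (simp only: mult_ac)
  also have "\<dots> = of_real a * gaugeY L m s Q t"
    unfolding rel(2) by (simp add: gaugeY_def F_def)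
  finally have e1: "E * (of_real a * cnj (hh (of_int L) m t) * Q t) = of_real a * gaugeY L m s Q t" .
  show "(gaugeX m s P has_vector_derivative
      (\<i> * of_real m * (cis (of_int s * t) * gaugeX m s P t) + of_real a * gaugeY L m s Q t)) (at t)"
    unfolding gaugeX_def[abs_def]
    by (rule has_vector_derivative_eq_rhs[OF has_vector_derivative_mult[OF Ed P]])
       (simp only: E_def[symmetric] e1, simp only: add.commute mult_ac)
  have "((\<lambda>t. - of_int L * t) has_real_derivative (- of_int L)) (at t)"
    by (auto intro!: derivative_eq_intros)
  note Cd = has_vector_derivative_cis[OF this]
  have "cis (- of_int L * t) * (F * (of_real a * hh (of_int L) m t * P t)) = of_real a * (hh (of_int L) m t * cis (- of_int L * t) * F) * P t"
    by (simp only: mult_ac)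
  also have "\<dots> = of_real a * gaugeX m s P t"
    unfolding rel(1) by (simp add: gaugeX_def E_def)
  finally have e2: "cis (- of_int L * t) * (F * (of_real a * hh (of_int L) m t * P t)) = of_real a * gaugeX m s P t" .
  have gY: "gaugeY L m s Q t = cis (- of_int L * t) * (F * Q t)" by (simp add: gaugeY_def F_def)
  show "(gaugeY L m s Q has_vector_derivative
      (- (\<i> * of_int L) * gaugeY L m s Q t + - (\<i> * of_real m) * (cis (of_int (- s) * t) * gaugeY L m s Q t)
        + of_real a * gaugeX m s P t)) (at t)"
    unfolding gY e2[symmetric] unfolding gaugeY_def[abs_def]
    by (rule has_vector_derivative_eq_rhs[OF has_vector_derivative_mult[OF Cd has_vector_derivative_mult[OF Fd Q]]])
       (simp only: F_def[symmetric], simp add: algebra_simps)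
qed

lemma gauge_continuous:
  assumes "lin_sol a (of_int L) m P Q" "s = 1 \<or> s = -1"
  shows "continuous_on S (gaugeX m s P)" "continuous_on S (gaugeY L m s Q)"
  by (rule continuous_on_if_vector_derivative[OF gauge_deriv(1)[OF assms]],
      rule continuous_on_if_vector_derivative[OF gauge_deriv(2)[OF assms]])

lemma gauge_periodic:
  assumes "periodic_sol a L m P Q"
  shows "gaugeX m s P (2 * pi) = gaugeX m s P 0" "gaugeY L m s Q (2 * pi) = gaugeY L m s Q 0"
proof -
  have [simp]: "cis (of_int k * (2 * pi)) = 1" for k :: int by simp
  have "- of_int L * (2 * pi) = of_int (- L) * (2 * pi)" by simp
  then have "cis (- of_int L * (2 * pi)) = 1" by (simp only: cis_int_2pi)
  then show "gaugeX m s P (2 * pi) = gaugeX m s P 0" "gaugeY L m s Q (2 * pi) = gaugeY L m s Q 0"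
    using assms unfolding periodic_sol_def gaugeX_def gaugeY_def by (simp_all only: cis_int_2pi) simp_all
qed

lemma fc_deriv_periodic:
  assumes "\<And>t. (f has_vector_derivative f' t) (at t)" "f (2 * pi) = f 0"
  shows "fc (of_int k) f' = \<i> * of_int k * fc (of_int k) f"
  using fc_deriv[OF assms(1), of "of_int k"] assms(2) by simp

lemma gauge_recurrence:
  assumes sol: "periodic_sol a L m P Q" and s: "s = 1 \<or> s = -1"
  defines "x \<equiv> \<lambda>k::int. fc (of_int k) (gaugeX m s P)"
    and "y \<equiv> \<lambda>k::int. fc (of_int k) (gaugeY L m s Q)"
  shows "of_int k * x k = of_real m * x (k - s) - \<i> * of_real a * y k"
    "of_int k * y k = - of_int L * y k - of_real m * y (k + s) - \<i> * of_real a * x k"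
proof -
  have lin: "lin_sol a (of_int L) m P Q" using sol by (simp add: periodic_sol_def)
  note c = gauge_continuous[OF lin s]
  have "\<i> * of_int k * x k = \<i> * of_real m * fc (of_int k - of_int s) (gaugeX m s P) + of_real a * y k"
    unfolding x_def fc_deriv_periodic[OF gauge_deriv(1)[OF lin s] gauge_periodic(1)[OF sol], symmetric]
    by (subst fc_add) (auto simp only: fc_cmult fc_cis_mult y_def intro!: continuous_intros c)
  then have "(- \<i>) * (\<i> * of_int k * x k) = (- \<i>) * (\<i> * of_real m * x (k - s) + of_real a * y k)"
    by (simp add: x_def)
  then show "of_int k * x k = of_real m * x (k - s) - \<i> * of_real a * y k"
    by (simp add: algebra_simps)
  have cont: "continuous_on {0..2*pi} (\<lambda>t. - (\<i> * of_int L) * gaugeY L m s Q t + - (\<i> * of_real m) * (cis (of_int (- s) * t) * gaugeY L m s Q t))"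
    by (intro continuous_intros c)
  have "\<i> * of_int k * y k = fc (of_int k) (\<lambda>t. - (\<i> * of_int L) * gaugeY L m s Q t + - (\<i> * of_real m) * (cis (of_int (- s) * t) * gaugeY L m s Q t)) + of_real a * x k"
    unfolding y_def fc_deriv_periodic[OF gauge_deriv(2)[OF lin s] gauge_periodic(2)[OF sol], symmetric]
    by (subst fc_add[OF cont]) (auto simp only: fc_cmult x_def intro!: continuous_intros c)
  also have "\<dots> = - (\<i> * of_int L) * y k + - (\<i> * of_real m) * fc (of_int k - of_int (- s)) (gaugeY L m s Q) + of_real a * x k"
    by (subst fc_add) (auto simp only: fc_cmult fc_cis_mult y_def intro!: continuous_intros c)
  finally have "(- \<i>) * (\<i> * of_int k * y k) = (- \<i>) * (- (\<i> * of_int L) * y k + - (\<i> * of_real m) * y (k + s) + of_real a * x k)"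
    by (simp add: y_def)
  moreover have "of_int k * y k = (- \<i>) * (\<i> * of_int k * y k)" by (simp add: mult.assoc[symmetric])
  ultimately have "of_int k * y k = (- \<i>) * (- (\<i> * of_int L) * y k + - (\<i> * of_real m) * y (k + s) + of_real a * x k)"
    by simp
  also have "\<dots> = - of_int L * y k - of_real m * y (k + s) - \<i> * of_real a * x k"
    by (simp add: algebra_simps)
  finally show "of_int k * y k = - of_int L * y k - of_real m * y (k + s) - \<i> * of_real a * x k" .
qed

lemma gauge_tendsto_0:
  assumes sol: "periodic_sol a L m P Q" and s: "s = 1 \<or> s = -1"
    and g: "filterlim (\<lambda>n. real_of_int (g n)) at_infinity F"
  shows "((\<lambda>n. fc (of_int (g n)) (gaugeX m s P)) \<longlongrightarrow> 0) F"
    "((\<lambda>n. fc (of_int (g n)) (gaugeY L m s Q)) \<longlongrightarrow> 0) F"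
proof -
  have lin: "lin_sol a (of_int L) m P Q" using sol by (simp add: periodic_sol_def)
  note c = gauge_continuous[OF lin s]
  show "((\<lambda>n. fc (of_int (g n)) (gaugeX m s P)) \<longlongrightarrow> 0) F"
    by (rule fc_tendsto_0[OF gauge_deriv(1)[OF lin s] _ g]) (intro continuous_intros c)
  show "((\<lambda>n. fc (of_int (g n)) (gaugeY L m s Q)) \<longlongrightarrow> 0) F"
    by (rule fc_tendsto_0[OF gauge_deriv(2)[OF lin s] _ g]) (intro continuous_intros c)
qed

lemma lin_sol_continuous:
  assumes "lin_sol a l m P Q"
  shows "continuous_on S P" "continuous_on S Q"
proof -
  have P: "(P has_vector_derivative (of_real a * cnj (hh l m t) * Q t)) (at t)"
    and Q: "(Q has_vector_derivative (of_real a * hh l m t * P t)) (at t)" for t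
    using assms by (auto simp: lin_sol_def)
  show "continuous_on S P" "continuous_on S Q"
    by (rule continuous_on_if_vector_derivative[OF P], rule continuous_on_if_vector_derivative[OF Q])
qed

lemma gauge_zero_imp_zero:
  assumes sol: "periodic_sol a L m P Q" and s: "s = 1 \<or> s = -1"
    and z: "\<And>k::int. fc (of_int k) (gaugeX m s P) = 0" "\<And>k::int. fc (of_int k) (gaugeY L m s Q) = 0"
  shows "P 0 = 0" "Q 0 = 0"
proof -
  have lin: "lin_sol a (of_int L) m P Q" using sol by (simp add: periodic_sol_def)
  have "gaugeX m s P 0 = 0"
    by (rule fc_unique[OF gauge_continuous(1)[OF lin s] gauge_periodic(1)[OF sol] z(1)]) simp
  then show "P 0 = 0" by (simp add: gaugeX_def)
  have "gaugeY L m s Q 0 = 0"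
    by (rule fc_unique[OF gauge_continuous(2)[OF lin s] gauge_periodic(2)[OF sol] z(2)]) simp
  then show "Q 0 = 0" by (simp add: gaugeY_def)
qed

lemma fc_exp_mult_zero:
  assumes f: "continuous_on {0..2*pi} f" and z: "\<And>n::nat. fc (k - s * real n) f = 0"
  shows "fc k (\<lambda>t. exp (c * cis (s * t)) * f t) = 0"
proof -
  have "(\<lambda>n. c ^ n / fact n * fc (k - s * real n) f) = (\<lambda>n. 0)" using z by simp
  then show ?thesis using fc_exp_mult[OF f, of c k s] sums_unique2[OF sums_zero] by metis
qed

text \<open>A third choice of unknown. The coefficients of its equation are trigonometric
  polynomials with frequencies 1 and -1, and eliminating \<open>Q\<close> yields a symmetric
  three-term recurrence.\<close>

definition wave :: "real \<Rightarrow> real \<Rightarrow> (real \<Rightarrow> complex) \<Rightarrow> real \<Rightarrow> complex" where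
  "wave l m P t = hh l m t * P t"

lemma wave_deriv:
  assumes "lin_sol a l m P Q"
  shows "(wave l m P has_vector_derivative (\<i> * of_real l * wave l m P t
     + (\<i> * of_real m * (cis (1 * t) * wave l m P t) + \<i> * of_real m * (cis ((-1) * t) * wave l m P t)) + of_real a * Q t)) (at t)"
    "(Q has_vector_derivative (of_real a * wave l m P t)) (at t)"
proof -
  have P: "(P has_vector_derivative (of_real a * cnj (hh l m t) * Q t)) (at t)"
    and Q: "(Q has_vector_derivative (of_real a * hh l m t * P t)) (at t)"
    using assms by (auto simp: lin_sol_def)
  have c: "complex_of_real (2 * cos t) = cis (1 * t) + cis ((-1) * t)" by (simp add: complex_eq_iff)
  have "hh l m t * (of_real a * cnj (hh l m t) * Q t) = of_real a * (hh l m t * cnj (hh l m t)) * Q t"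
    by (simp only: mult_ac)
  then have e: "hh l m t * (of_real a * cnj (hh l m t) * Q t) = of_real a * Q t"
    by (simp only: hh_cnj_mult mult_1_right)
  have e2: "\<i> * of_real (l + 2 * m * cos t) * hh l m t * P t
    = \<i> * of_real l * wave l m P t + (\<i> * of_real m * (cis (1 * t) * wave l m P t) + \<i> * of_real m * (cis ((-1) * t) * wave l m P t))"
  proof -
    have "\<i> * of_real (l + 2 * m * cos t) * hh l m t * P t
      = \<i> * of_real l * wave l m P t + \<i> * of_real m * of_real (2 * cos t) * wave l m P t"
      by (simp add: wave_def algebra_simps)
    also have "\<dots> = \<i> * of_real l * wave l m P t + (\<i> * of_real m * (cis (1 * t) * wave l m P t) + \<i> * of_real m * (cis ((-1) * t) * wave l m P t))"
      unfolding c by (simp only: distrib_left distrib_right mult.assoc)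
    finally show ?thesis .
  qed
  show "(wave l m P has_vector_derivative (\<i> * of_real l * wave l m P t
     + (\<i> * of_real m * (cis (1 * t) * wave l m P t) + \<i> * of_real m * (cis ((-1) * t) * wave l m P t)) + of_real a * Q t)) (at t)"
    unfolding e2[symmetric] e[symmetric] unfolding wave_def[abs_def]
    by (rule has_vector_derivative_eq_rhs[OF has_vector_derivative_mult[OF hh_deriv P]]) (simp only: add.commute)
  show "(Q has_vector_derivative (of_real a * wave l m P t)) (at t)"
    using Q by (simp add: wave_def mult.assoc)
qed

lemma wave_continuous:
  assumes "lin_sol a l m P Q"
  shows "continuous_on S (wave l m P)"
  by (rule continuous_on_if_vector_derivative[OF wave_deriv(1)[OF assms]])

lemma hh_int_2pi [simp]: "hh (of_int L) m (2 * pi) = 1"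
  using hh_shift[of "of_int L" m 0] by simp

lemma wave_jump [simp]: "wave (of_int L) m P (2 * pi) = P (2 * pi)" "wave l m P 0 = P 0"
  by (simp_all add: wave_def)

text \<open>Two integrations by parts give coefficients of order 1 / n^2: since \<open>f\<close> is
  periodic, only the second one can leave a boundary term.\<close>

lemma fc_summable:
  assumes f: "\<And>t. (f has_vector_derivative f' t) (at t)" "f (2 * pi) = f 0"
    and f': "\<And>t. (f' has_vector_derivative f'' t) (at t)" and c: "continuous_on {0..2*pi} f''"
  shows "summable (\<lambda>n. norm (fc (real n) f))"
proof -
  obtain C where C: "C \<ge> 0" "\<And>k. k \<noteq> 0 \<Longrightarrow> norm (fc k f') \<le> C / \<bar>k\<bar>"
    using fc_decay[OF f' c] by blast
  have b: "norm (fc (real n) f) \<le> C * (1 / real n ^ 2)" if "n \<ge> 1" for n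
  proof -
    have n0: "real n \<noteq> 0" using that by simp
    have "\<i> * of_real (real n) * fc (real n) f = fc (real n) f'"
      using fc_deriv_periodic[OF f, of "int n"] by simp
    from arg_cong[OF this, of norm] have "real n * norm (fc (real n) f) = norm (fc (real n) f')"
      by (simp add: norm_mult)
    also have "\<dots> \<le> C / real n" using C(2)[OF n0] by simp
    finally show ?thesis using that by (simp add: field_simps power2_eq_square)
  qed
  have "summable (\<lambda>n. C * (1 / real n ^ 2))"
    using summable_mult[OF inverse_power_summable[of 2], of C] by (simp add: field_simps)
  then show ?thesis
    by (rule summable_comparison_test'[of _ 1]) (use b in auto)
qed

lemma wave_summable:
  assumes sol: "periodic_sol a L m P Q"
  shows "summable (\<lambda>n. norm (fc (real n) (wave (of_int L) m P)))" "summable (\<lambda>n. norm (fc (real n) Q))"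
proof -
  have lin: "lin_sol a (of_int L) m P Q" and per: "P (2 * pi) = P 0" "Q (2 * pi) = Q 0"
    using sol by (simp_all add: periodic_sol_def)
  note d = wave_deriv[OF lin]
  have cs: "((\<lambda>t. cis (s * t)) has_vector_derivative (\<i> * of_real s * cis (s * t))) (at t)" for s t
    by (rule has_vector_derivative_cis) (auto intro!: derivative_eq_intros)
  let ?R = "wave (of_int L) m P"
  let ?R' = "\<lambda>t. \<i> * of_real (of_int L) * ?R t + (\<i> * of_real m * (cis (1 * t) * ?R t) + \<i> * of_real m * (cis ((-1) * t) * ?R t)) + of_real a * Q t"
  note c = wave_continuous[OF lin] lin_sol_continuous[OF lin]
  show "summable (\<lambda>n. norm (fc (real n) ?R))"
  proof (rule fc_summable[OF d(1)])
    show "(?R' has_vector_derivative (\<i> * of_real (of_int L) * ?R' t +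
       (\<i> * of_real m * (cis (1 * t) * ?R' t + (\<i> * of_real 1 * cis (1 * t)) * ?R t) +
        \<i> * of_real m * (cis ((-1) * t) * ?R' t + (\<i> * of_real (-1) * cis ((-1) * t)) * ?R t)) +
       of_real a * (of_real a * ?R t))) (at t)" for t
      by (intro has_vector_derivative_add has_vector_derivative_mult_right
          has_vector_derivative_mult d cs)
    show "continuous_on {0..2*pi} (\<lambda>t. \<i> * of_real (of_int L) * ?R' t +
       (\<i> * of_real m * (cis (1 * t) * ?R' t + (\<i> * of_real 1 * cis (1 * t)) * ?R t) +
        \<i> * of_real m * (cis ((-1) * t) * ?R' t + (\<i> * of_real (-1) * cis ((-1) * t)) * ?R t)) +
       of_real a * (of_real a * ?R t))"
      by (intro continuous_intros c)
  qed (simp add: per)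
  show "summable (\<lambda>n. norm (fc (real n) Q))"
  proof (rule fc_summable[OF d(2) per(2)])
    show "((\<lambda>t. of_real a * ?R t) has_vector_derivative of_real a * ?R' t) (at t)" for t
      by (intro has_vector_derivative_mult_right d)
    show "continuous_on {0..2*pi} (\<lambda>t. of_real a * ?R' t)"
      by (intro continuous_intros c)
  qed
qed

text \<open>Periodicity of the uncorrected components. In terms of \<open>mona\<close> this is the
  value \<open>cis (pi * L)\<close>, which may be -1.\<close>

definition trivial_mon :: "real \<Rightarrow> int \<Rightarrow> real \<Rightarrow> bool" where
  "trivial_mon a L m \<longleftrightarrow> (\<forall>X Y. lin_sol a (of_int L) m X Y \<longrightarrow> X (2 * pi) = X 0 \<and> Y (2 * pi) = Y 0)"

lemma trivial_mon_sol:
  assumes "trivial_mon a L m" "lin_sol a (of_int L) m X Y"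
  shows "periodic_sol a L m X Y"
  using assms by (auto simp: trivial_mon_def periodic_sol_def)

lemma filterlim_int_at_infinity:
  "filterlim (\<lambda>n. real_of_int (int n + c)) at_infinity sequentially"
  "filterlim (\<lambda>n. real_of_int (c - int n)) at_infinity sequentially"
proof -
  have 1: "filterlim (\<lambda>n. real n) at_top sequentially" by (rule filterlim_real_sequentially)
  have "filterlim (\<lambda>n. real_of_int c + real n) at_top sequentially"
    by (rule filterlim_tendsto_add_at_top[OF tendsto_const 1])
  then show "filterlim (\<lambda>n. real_of_int (int n + c)) at_infinity sequentially"
    by (intro filterlim_at_top_imp_at_infinity) (simp add: add.commute)
  have "filterlim (\<lambda>n. real_of_int (- c) + real n) at_top sequentially"
    by (rule filterlim_tendsto_add_at_top[OF tendsto_const 1])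
  then have "filterlim (\<lambda>n. - (real_of_int (- c) + real n)) at_bot sequentially"
    by (simp only: filterlim_uminus_at_bot minus_minus)
  then show "filterlim (\<lambda>n. real_of_int (c - int n)) at_infinity sequentially"
    by (intro filterlim_at_bot_imp_at_infinity) simp
qed

section \<open>Polynomial solutions are incompatible with trivial monodromy\<close>

lemma fc_sum:
  assumes "finite F" "\<And>k. continuous_on {0..2*pi} (g k)"
  shows "fc j (\<lambda>t. \<Sum>k\<in>F. g k t) = (\<Sum>k\<in>F. fc j (g k))"
  using assms(1)
proof (induction F rule: finite_induct)
  case empty
  show ?case by (simp add: fc_def)
next
  case (insert x F)
  have "fc j (\<lambda>t. \<Sum>k\<in>insert x F. g k t) = fc j (\<lambda>t. g x t + (\<Sum>k\<in>F. g k t))"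
    using insert.hyps by simp
  also have "\<dots> = fc j (g x) + fc j (\<lambda>t. \<Sum>k\<in>F. g k t)"
    by (rule fc_add[OF assms(2) continuous_on_sum[OF assms(2)]])
  finally show ?case using insert by simp
qed

text \<open>The Wronskian of two solutions, written in terms of Fourier coefficients, is a Casoratian that
  does not depend on the index; hence it vanishes by the decay of the coefficients.\<close>

lemma gauge_casoratian:
  fixes p q u v :: "int \<Rightarrow> complex"
  assumes m: "m \<noteq> 0"
    and p: "\<And>k. of_int k * p k = m * p (k - 1) - c * q k"
    and q: "\<And>k. of_int k * q k = of_int n * q k - m * q (k + 1) - c * p k"
    and u: "\<And>k. of_int k * u k = m * u (k + 1) - c * v k"
    and v: "\<And>k. of_int k * v k = of_int n * v k - m * v (k - 1) - c * u k"
    and lim: "(\<lambda>j. p (int j)) \<longlonglongrightarrow> 0" "(\<lambda>j. q (int j + 1)) \<longlonglongrightarrow> 0"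
      "(\<lambda>j. u (n - int j)) \<longlonglongrightarrow> 0" "(\<lambda>j. v (n - 1 - int j)) \<longlonglongrightarrow> 0"
  shows "of_int n * q 0 * u n = 0"
proof -
  define C where "C K = p K * v (n - K - 1) - q (K + 1) * u (n - K)" for K
  have step: "C K = C (K - 1)" for K
  proof -
    have 1: "m * p (K - 1) = of_int K * p K + c * q K" using p[of K] by (simp add: algebra_simps)
    have 2: "m * q (K + 1) = of_int n * q K - of_int K * q K - c * p K" using q[of K] by (simp add: algebra_simps)
    have 3: "m * u (n - K + 1) = of_int (n - K) * u (n - K) + c * v (n - K)" using u[of "n - K"] by (simp add: algebra_simps)
    have 4: "m * v (n - K - 1) = of_int n * v (n - K) - of_int (n - K) * v (n - K) - c * u (n - K)"
      using v[of "n - K"] by (simp add: algebra_simps)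
    have "m * (C K - C (K - 1)) = p K * (m * v (n - K - 1)) - (m * q (K + 1)) * u (n - K)
       - (m * p (K - 1)) * v (n - K) + q K * (m * u (n - K + 1))"
      by (simp add: C_def algebra_simps)
    also have "\<dots> = 0"
      unfolding 1 2 3 4 by (simp add: algebra_simps)
    finally show ?thesis using m by simp
  qed
  have "C (int j) = C (-1)" for j
  proof (induction j)
    case 0
    show ?case using step[of 0] by simp
  next
    case (Suc j)
    show ?case using step[of "int (Suc j)"] Suc by simp
  qed
  moreover have "(\<lambda>j. C (int j)) \<longlonglongrightarrow> 0 * 0 - 0 * 0"
  proof -
    have e: "C (int j) = p (int j) * v (n - 1 - int j) - q (int j + 1) * u (n - int j)" for j
    proof -
      have "n - int j - 1 = n - 1 - int j" by simp
      then show ?thesis unfolding C_def by (simp only:)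
    qed
    show ?thesis unfolding e by (intro tendsto_diff tendsto_mult lim)
  qed
  ultimately have "C (-1) = 0" using LIMSEQ_unique[OF tendsto_const] by simp
  \<comment> \<open>At index -1 the recurrence for \<open>p\<close> at frequency 0 loses its left
    side and gives \<open>p (-1)\<close> in terms of \<open>q 0\<close> alone. Hence this value of
    the constant collapses to a single product.\<close>
  then have 0: "p (-1) * v n - q 0 * u (n + 1) = 0" by (simp add: C_def)
  have 1: "m * p (-1) = c * q 0" using p[of 0] by simp
  have 2: "m * u (n + 1) = of_int n * u n + c * v n" using u[of n] by (simp add: algebra_simps)
  have "0 = m * (p (-1) * v n - q 0 * u (n + 1))" unfolding 0 by simp
  also have "\<dots> = (m * p (-1)) * v n - q 0 * (m * u (n + 1))" by (simp add: algebra_simps)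
  also have "\<dots> = - (of_int n * q 0 * u n)" unfolding 1 2 by (simp add: algebra_simps)
  finally show ?thesis by simp
qed

text \<open>The descent begins at frequency 0, where the factor \<open>k\<close> vanishes and gives
  \<open>p (-1) = 0\<close>. Below it the coefficient \<open>k - n\<close> of \<open>q k\<close> has
  no zero.\<close>

lemma lower_block_zero:
  fixes p q :: "int \<Rightarrow> complex"
  assumes m: "m \<noteq> 0" and n: "n \<ge> 1"
    and p: "\<And>k. of_int k * p k = m * p (k - 1) - c * q k"
    and q: "\<And>k. of_int k * q k = of_int n * q k - m * q (k + 1) - c * p k"
    and q0: "q 0 = 0"
  shows "q (- int j) = 0 \<and> p (- 1 - int j) = 0"
proof (induction j)
  case 0
  show ?case using p[of 0] m q0 by simp
next
  case (Suc j)
  have "of_int (- 1 - int j) * q (- 1 - int j) = of_int n * q (- 1 - int j)"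
    using q[of "- 1 - int j"] Suc by simp
  then have "of_int (- 1 - int j - n) * q (- 1 - int j) = 0" by (simp add: algebra_simps)
  moreover have "(of_int (- 1 - int j - n) :: complex) \<noteq> 0" unfolding of_int_eq_0_iff using n by simp
  ultimately have q': "q (- 1 - int j) = 0" by (metis mult_eq_0_iff)
  have "m * p (- 2 - int j) = 0"
    using p[of "- 1 - int j"] Suc q' by simp
  then have p': "p (- 2 - int j) = 0" using m by simp
  have "- int (Suc j) = - 1 - int j" "- 1 - int (Suc j) = - 2 - int j" by simp_all
  then show ?case using p' q' by (simp only: simp_thms)
qed

lemma upper_block_zero:
  fixes p q :: "int \<Rightarrow> complex"
  assumes m: "m \<noteq> 0"
    and p: "\<And>k. of_int k * p k = m * p (k - 1) - c * q k"
    and q: "\<And>k. of_int k * q k = of_int n * q k - m * q (k + 1) - c * p k"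
    and p0: "p 0 = 0" "q 0 = 0"
  shows "p (int j) = 0 \<and> q (int j) = 0"
proof (induction j)
  case 0
  show ?case using p0 by simp
next
  case (Suc j)
  have q': "q (1 + int j) = 0" using q[of "int j"] Suc m by (simp add: add.commute)
  have "of_int (1 + int j) * p (1 + int j) = 0"
    using p[of "1 + int j"] Suc q' by simp
  moreover have "(of_int (1 + int j) :: complex) \<noteq> 0" unfolding of_int_eq_0_iff by simp
  ultimately have "p (1 + int j) = 0" by (metis mult_eq_0_iff)
  then show ?case using q' by simp
qed

text \<open>The descent divides by the frequency and therefore stops at 0; it clears the frequencies
  1 to \<open>n\<close> of \<open>u\<close>.\<close>

lemma window_zero:
  fixes u v :: "int \<Rightarrow> complex"
  assumes m: "m \<noteq> 0"
    and u: "\<And>k. of_int k * u k = m * u (k + 1) - c * v k"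
    and v: "\<And>k. of_int k * v k = of_int n * v k - m * v (k - 1) - c * u k"
    and un: "u n = 0" and j: "int j < n"
  shows "u (n - int j) = 0 \<and> v (n - int j - 1) = 0"
  using j
proof (induction j)
  case 0
  show ?case using v[of n] m un by simp
next
  case (Suc j)
  define k where "k = n - int j - 1"
  have IH: "u (k + 1) = 0" "v k = 0" using Suc by (simp_all add: k_def)
  have "of_int k * u k = 0" using u[of k] IH by simp
  moreover have "k \<noteq> 0" using Suc.prems by (simp add: k_def)
  ultimately have uk: "u k = 0" by simp
  have "m * v (k - 1) = 0" using v[of k] IH uk by simp
  then have "v (k - 1) = 0" using m by simp
  then show ?case using uk by (simp add: k_def algebra_simps)
qed

lemma int_zero_from_halves:
  assumes "\<And>j. f (int j) = (0::complex)" "\<And>j. f (- 1 - int j) = 0"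
  shows "f k = 0"
proof (cases "k \<ge> 0")
  case True
  then show ?thesis using assms(1)[of "nat k"] by simp
next
  case False
  then show ?thesis using assms(2)[of "nat (- 1 - k)"] by simp
qed

text \<open>A solution with \<open>Q\<close> supported on nonpositive and \<open>P\<close> on nonnegative frequencies comes from
  a polynomial solution of the double confluent Heun equation.  Triviality of the monodromy forces
  \<open>\<integral> P * cnj P' = 0\<close>, that is \<open>\<Sum> s * |p\<^sub>s|\<^sup>2 = 0\<close> for the Fourier coefficients \<open>p\<^sub>s\<close> of \<open>P\<close>.\<close>

lemma no_polynomial_solution:
  assumes a: "a > 0" and m: "m \<noteq> 0" and triv: "trivial_mon a L m"
    and sol: "lin_sol a (of_int L) m P Q" and nz: "P 0 \<noteq> 0 \<or> Q 0 \<noteq> 0"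
    and Q0: "\<And>j::int. j \<ge> 1 \<Longrightarrow> fc (of_int j) Q = 0"
    and P0: "\<And>j::int. j < 0 \<Longrightarrow> fc (of_int j) P = 0"
  shows False
proof -
  \<comment> \<open>The frequency shift in \<open>gaugeY\<close>. It will turn out that
    \<open>gq Q\<close> is supported on the frequencies 1 to \<open>n\<close>.\<close>
  define n where "n = - L"
  define c where "c = \<i> * complex_of_real a"
  define gp gq where "gp X k = fc (of_int k) (gaugeX m 1 X)" and "gq Y k = fc (of_int k) (gaugeY L m 1 Y)"
    for X Y :: "real \<Rightarrow> complex" and k :: int
  define gu gv where "gu X k = fc (of_int k) (gaugeX m (-1) X)" and "gv Y k = fc (of_int k) (gaugeY L m (-1) Y)"
    for X Y :: "real \<Rightarrow> complex" and k :: int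
  have mC: "complex_of_real m \<noteq> 0" using m by simp
  note per = trivial_mon_sol[OF triv]
  have rec_p: "of_int k * gp X k = of_real m * gp X (k - 1) - c * gq Y k"
    and rec_q: "of_int k * gq Y k = of_int n * gq Y k - of_real m * gq Y (k + 1) - c * gp X k"
    and rec_u: "of_int k * gu X k = of_real m * gu X (k + 1) - c * gv Y k"
    and rec_v: "of_int k * gv Y k = of_int n * gv Y k - of_real m * gv Y (k - 1) - c * gu X k"
    if "lin_sol a (of_int L) m X Y" for X Y k
    using gauge_recurrence[OF per[OF that], of 1 k] gauge_recurrence[OF per[OF that], of "-1" k]
    by (simp_all add: gp_def gq_def gu_def gv_def c_def n_def)
  have Pc: "continuous_on S P" and Qc: "continuous_on S Q" for S
    using lin_sol_continuous[OF sol] by auto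
  have p_neg: "gp P k = 0" if "k < 0" for k
    unfolding gp_def gaugeX_def[abs_def]
  proof (rule fc_exp_mult_zero[OF Pc])
    fix j :: nat
    show "fc (of_int k - of_int 1 * real j) P = 0"
      using P0[of "k - int j"] that by simp
  qed
  have q_hi: "gq Q k = 0" if "k \<ge> n + 1" for k
  proof -
    have "gq Q k = fc (of_int k - (- of_int L)) (\<lambda>t. exp (of_real (of_int 1 * m) * cis (of_int (- 1) * t)) * Q t)"
      unfolding gq_def gaugeY_def[abs_def] by (rule fc_cis_mult)
    also have "\<dots> = 0"
    proof (rule fc_exp_mult_zero[OF Qc])
      fix j :: nat
      show "fc (of_int k - - of_int L - of_int (- 1) * real j) Q = 0"
        using Q0[of "k + L + int j"] that by (simp add: n_def)
    qed
    finally show ?thesis .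
  qed
  have cnz: "c \<noteq> 0" using a by (simp add: c_def)
  \<comment> \<open>Both terms of the recurrence that contain \<open>gp P\<close> vanish for
    \<open>k \<le> 0\<close>; at \<open>k = 0\<close> the left one does so through the factor
    \<open>k\<close>.\<close>
  have q_lo: "gq Q k = 0" if "k \<le> 0" for k
  proof -
    have e1: "of_int k * gp P k = 0" using p_neg[of k] that by (cases "k = 0") auto
    have e2: "gp P (k - 1) = 0" using p_neg[of "k - 1"] that by simp
    have "0 = of_real m * 0 - c * gq Q k"
      using rec_p[OF sol, of k] unfolding e1 e2 .
    then show ?thesis using cnz by simp
  qed
  have all_zero: False if "\<And>k. gq Q k = 0" "\<And>k. gp P k = 0"
    using gauge_zero_imp_zero[OF per[OF sol], of 1] that nz by (simp add: gp_def gq_def)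
  have pos_zero: False if "gp P 0 = 0"
  proof (rule all_zero)
    have z: "gp P (int j) = 0 \<and> gq Q (int j) = 0" for j
      by (rule upper_block_zero[OF mC rec_p[OF sol] rec_q[OF sol] that q_lo[of 0]]) simp
    show "gq Q k = 0" for k
      by (rule int_zero_from_halves[of "gq Q"]) (simp_all add: z q_lo)
    show "gp P k = 0" for k
      by (rule int_zero_from_halves[of "gp P"]) (simp_all add: z p_neg)
  qed
  have n1: "n \<ge> 1"
  proof (rule ccontr)
    assume "\<not> n \<ge> 1"
    then have q: "gq Q k = 0" for k using q_hi[of k] q_lo[of k] by linarith
    have "gp P k = 0" for k
      using rec_q[OF sol, of k] q cnz by simp
    then show False using all_zero q by blast
  qed
  \<comment> \<open>The determinant of the two initial vectors is |P 0|^2 + |Q 0|^2, so this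
    solution is independent of the given one.\<close>
  obtain X Y where XY: "lin_sol a (of_int L) m X Y" "X 0 = - cnj (Q 0)" "Y 0 = cnj (P 0)"
    using lin_sol_init[of a "of_int L" m "- cnj (Q 0)" "cnj (P 0)"] a by auto
  \<comment> \<open>Otherwise the combination of the two solutions that vanishes at frequency 0 in
    both unknowns would also vanish below, by \<open>lower_block_zero\<close>, and above, by
    \<open>upper_block_zero\<close>, against independence.\<close>
  have q0: "gq Y 0 \<noteq> 0"
  proof
    assume "gq Y 0 = 0"
    note low = lower_block_zero[OF mC n1 rec_p[OF XY(1)] rec_q[OF XY(1)] this]
    define U V where "U t = gp P 0 * X t + (- gp X 0) * P t" and "V t = gp P 0 * Y t + (- gp X 0) * Q t" for t
    have UV: "lin_sol a (of_int L) m U V"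
      unfolding U_def[abs_def] V_def[abs_def] by (rule lin_sol_comb[OF XY(1) sol])
    have gU: "gp U k = gp P 0 * gp X k + (- gp X 0) * gp P k" for k
    proof -
      have "gp U k = fc (of_int k) (\<lambda>t. gp P 0 * gaugeX m 1 X t + (- gp X 0) * gaugeX m 1 P t)"
        unfolding gp_def[of U] by (rule fc_cong) (simp add: gaugeX_def U_def algebra_simps)
      also have "\<dots> = gp P 0 * gp X k + (- gp X 0) * gp P k"
        unfolding gp_def[of X k] gp_def[of P k]
        by (subst fc_add) (auto simp only: fc_cmult intro!: continuous_intros gauge_continuous(1)[OF XY(1)] gauge_continuous(1)[OF sol])
      finally show ?thesis .
    qed
    have gV: "gq V k = gp P 0 * gq Y k + (- gp X 0) * gq Q k" for k
    proof -
      have "gq V k = fc (of_int k) (\<lambda>t. gp P 0 * gaugeY L m 1 Y t + (- gp X 0) * gaugeY L m 1 Q t)"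
        unfolding gq_def[of V] by (rule fc_cong) (simp add: gaugeY_def V_def algebra_simps)
      also have "\<dots> = gp P 0 * gq Y k + (- gp X 0) * gq Q k"
        unfolding gq_def[of Y k] gq_def[of Q k]
        by (subst fc_add) (auto simp only: fc_cmult intro!: continuous_intros gauge_continuous(2)[OF XY(1)] gauge_continuous(2)[OF sol])
      finally show ?thesis .
    qed
    have z0: "gp U 0 = 0" "gq V 0 = 0"
      unfolding gU gV using q_lo[of 0] \<open>gq Y 0 = 0\<close> by simp_all
    note up = upper_block_zero[OF mC rec_p[OF UV] rec_q[OF UV] z0]
    have "gq Y (- 1 - int j) = 0" "gp X (- 1 - int j) = 0" for j
      using low[of "Suc j"] low[of j] by (simp_all add: algebra_simps)
    then have neg: "gq V (- 1 - int j) = 0" "gp U (- 1 - int j) = 0" for j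
      unfolding gU gV by (simp_all add: q_lo p_neg)
    have V0: "gq V k = 0" for k
      by (rule int_zero_from_halves[of "gq V"]) (simp_all add: up neg)
    have U0: "gp U k = 0" for k
      by (rule int_zero_from_halves[of "gp U"]) (simp_all add: up neg)
    have "U 0 = 0" "V 0 = 0"
      using gauge_zero_imp_zero[OF per[OF UV], of 1, folded gp_def gq_def, OF _ U0 V0] by simp_all
    then have "gp P 0 * X 0 = gp X 0 * P 0" "gp P 0 * Y 0 = gp X 0 * Q 0"
      by (simp_all add: U_def V_def)
    then have e: "gp P 0 * - cnj (Q 0) = gp X 0 * P 0" "gp P 0 * cnj (P 0) = gp X 0 * Q 0"
      by (simp_all only: XY(2,3))
    have "gp P 0 * (P 0 * cnj (P 0) + Q 0 * cnj (Q 0)) = P 0 * (gp P 0 * cnj (P 0)) - Q 0 * (gp P 0 * - cnj (Q 0))"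
      by (simp add: algebra_simps)
    also have "\<dots> = 0" unfolding e by simp
    finally have "gp P 0 = 0 \<or> P 0 * cnj (P 0) + Q 0 * cnj (Q 0) = 0" by simp
    moreover have "P 0 * cnj (P 0) + Q 0 * cnj (Q 0) = of_real ((norm (P 0))\<^sup>2 + (norm (Q 0))\<^sup>2)"
      by (simp only: of_real_add complex_norm_square)
    moreover have "(norm (P 0))\<^sup>2 + (norm (Q 0))\<^sup>2 \<noteq> 0"
      using nz by (simp add: sum_power2_eq_zero_iff)
    ultimately have "gp P 0 = 0" by (metis of_real_eq_0_iff)
    then show False by (rule pos_zero)
  qed
  have "of_int n * gq Y 0 * gu P n = 0"
  proof (rule gauge_casoratian[OF mC rec_p[OF XY(1)] rec_q[OF XY(1)] rec_u[OF sol] rec_v[OF sol]])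
    have f0: "filterlim (\<lambda>j. real_of_int (int j)) at_infinity sequentially"
      using filterlim_int_at_infinity(1)[of 0] by simp
    show "(\<lambda>j. gp X (int j)) \<longlonglongrightarrow> 0"
      unfolding gp_def by (rule gauge_tendsto_0(1)[OF per[OF XY(1)] _ f0]) simp
    show "(\<lambda>j. gq Y (int j + 1)) \<longlonglongrightarrow> 0"
      unfolding gq_def by (rule gauge_tendsto_0(2)[OF per[OF XY(1)] _ filterlim_int_at_infinity(1)]) simp
    show "(\<lambda>j. gu P (n - int j)) \<longlonglongrightarrow> 0"
      unfolding gu_def by (rule gauge_tendsto_0(1)[OF per[OF sol] _ filterlim_int_at_infinity(2)]) simp
    show "(\<lambda>j. gv Q (n - 1 - int j)) \<longlonglongrightarrow> 0"
      unfolding gv_def by (rule gauge_tendsto_0(2)[OF per[OF sol] _ filterlim_int_at_infinity(2)]) simp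
  qed
  then have un: "gu P n = 0" using n1 q0 by simp
  have u_win: "gu P k = 0" if "1 \<le> k" "k \<le> n" for k
    using window_zero[OF mC rec_u[OF sol] rec_v[OF sol] un, of "nat (n - k)"] that by simp
  \<comment> \<open>\<open>S\<close> is the derivative of \<open>P\<close> divided by
    \<open>a\<close>. Its pairing with \<open>P\<close> is computed twice: as -i times a sum of
    nonnegative terms, and as a finite sum over the window on which \<open>gu P\<close>
    vanishes.\<close>
  define S where "S t = cnj (hh (of_int L) m t) * Q t" for t
  have S_wave: "S = wave (- L) (- m) Q"
    by (rule ext) (simp add: S_def wave_def hh_neg)
  have swap: "periodic_sol a (- L) (- m) Q P"
    using per[OF sol] lin_sol_swap[of a "of_int L" m P Q] by (simp add: periodic_sol_def)
  then have swap_lin: "lin_sol a (of_int (- L)) (- m) Q P" by (simp add: periodic_sol_def)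
  have Pd: "(P has_vector_derivative (of_real a * S t)) (at t)" for t
    using wave_deriv(2)[OF swap_lin] by (simp add: S_wave)
  define \<sigma> where "\<sigma> j = fc (real j) S" for j :: nat
  have S_sum: "summable (\<lambda>j. norm (\<sigma> j))"
    unfolding \<sigma>_def S_wave by (rule wave_summable(1)[OF swap])
  have S_cont: "continuous_on T S" for T
    unfolding S_wave by (rule wave_continuous[OF swap_lin])
  have S_per: "S (2 * pi) = S 0"
    using per[OF sol] by (simp add: S_def periodic_sol_def)
  have fcP: "of_real a * fc (of_int k) S = \<i> * of_int k * fc (of_int k) P" for k
    using fc_deriv_periodic[OF Pd, of k] per[OF sol] by (simp add: periodic_sol_def fc_cmult)
  have S_neg: "fc (of_int k) S = 0" if "k < 0" for k
    using fcP[of k] P0[OF that] a by simp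
  have S_series: "(\<lambda>j. \<sigma> j * cis (real j * t)) sums S t" if "t \<in> {0..2*pi}" for t
    by (rule fourier_series_nonneg[OF S_cont S_per _ S_sum S_neg that]) (simp add: \<sigma>_def)
  have sig_p: "fc (real j) P = - \<i> * of_real (a / real j) * \<sigma> j" if "j \<noteq> 0" for j
  proof -
    have "of_real a * \<sigma> j = \<i> * of_real (real j) * fc (real j) P"
      using fcP[of "int j"] by (simp add: \<sigma>_def)
    then have "(- \<i> / of_real (real j)) * (of_real a * \<sigma> j) = (- \<i> / of_real (real j)) * (\<i> * of_real (real j) * fc (real j) P)"
      by (rule arg_cong)
    then show ?thesis using that by (simp add: field_simps)
  qed
  have sig0: "\<sigma> 0 = 0" using fcP[of 0] a by (simp add: \<sigma>_def)
  have B: "(\<lambda>j. fc 0 (\<lambda>t. cnj (\<sigma> j * cis (real j * t)) * P t)) sums fc 0 (\<lambda>t. cnj (S t) * P t)"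
  proof -
    obtain B where B: "\<And>t. t \<in> {0..2*pi} \<Longrightarrow> norm (P t) \<le> B"
      using continuous_on_Icc_bounded[OF Pc] by blast
    have "(\<lambda>j. fc 0 (\<lambda>t. cnj (\<sigma> j * cis (real j * t)) * P t)) sums fc 0 (\<lambda>t. \<Sum>j. cnj (\<sigma> j * cis (real j * t)) * P t)"
    proof (rule fc_suminf(1))
      show "continuous_on {0..2*pi} (\<lambda>t. cnj (\<sigma> j * cis (real j * t)) * P t)" for j
        by (intro continuous_intros Pc)
      show "norm (cnj (\<sigma> j * cis (real j * t)) * P t) \<le> norm (\<sigma> j) * B" if "t \<in> {0..2*pi}" for j t
        using B[OF that] by (simp add: norm_mult mult_left_mono)
      show "summable (\<lambda>j. norm (\<sigma> j) * B)" by (rule summable_mult2[OF S_sum])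
    qed
    also have "fc 0 (\<lambda>t. \<Sum>j. cnj (\<sigma> j * cis (real j * t)) * P t) = fc 0 (\<lambda>t. cnj (S t) * P t)"
    proof (rule fc_cong)
      fix t assume "t \<in> {0..2*pi}"
      then have "(\<lambda>j. cnj (\<sigma> j * cis (real j * t)) * P t) sums (cnj (S t) * P t)"
        using S_series by (intro sums_mult2) (simp only: sums_cnj)
      then show "(\<Sum>j. cnj (\<sigma> j * cis (real j * t)) * P t) = cnj (S t) * P t" by (simp add: sums_iff)
    qed
    finally show ?thesis .
  qed
  have fc_term: "fc 0 (\<lambda>t. cnj (\<sigma> j * cis (real j * t)) * P t) = - \<i> * of_real (a * (norm (\<sigma> j))\<^sup>2 / real j)" for j
  proof -
    have "(\<lambda>t. cnj (\<sigma> j * cis (real j * t)) * P t) = (\<lambda>t. cnj (\<sigma> j) * (cis ((- real j) * t) * P t))"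
      by (simp add: cis_cnj mult.assoc)
    then have "fc 0 (\<lambda>t. cnj (\<sigma> j * cis (real j * t)) * P t) = cnj (\<sigma> j) * fc (real j) P"
      by (simp only: fc_cmult fc_cis_mult) simp
    also have "\<dots> = - \<i> * of_real (a * (norm (\<sigma> j))\<^sup>2 / real j)"
    proof (cases "j = 0")
      case False
      have "cnj (\<sigma> j) * fc (real j) P = - \<i> * of_real (a / real j) * (\<sigma> j * cnj (\<sigma> j))"
        unfolding sig_p[OF False] by (simp only: mult_ac)
      also have "\<sigma> j * cnj (\<sigma> j) = of_real ((norm (\<sigma> j))\<^sup>2)" by (rule complex_norm_square[symmetric])
      finally show ?thesis by simp
    qed (simp add: sig0)
    finally show ?thesis .
  qed
  define N where "N = nat n"
  have Y_series: "gaugeY L m 1 Q t = (\<Sum>k\<in>{1..N}. gq Q (int k) * cis (real k * t))" if t: "t \<in> {0..2*pi}" for t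
  proof -
    have z: "gq Q (int k) = 0" if "k \<notin> {1..N}" for k
      using q_hi[of "int k"] q_lo[of "int k"] that n1 by (auto simp: N_def nat_le_iff not_le)
    have "summable (\<lambda>k. norm (gq Q (int k)))"
      by (rule summable_finite[of "{1..N}"]) (use z in auto)
    then have "(\<lambda>k. gq Q (int k) * cis (real k * t)) sums gaugeY L m 1 Q t"
      by (intro fourier_series_nonneg[OF gauge_continuous(2)[OF sol] gauge_periodic(2)[OF per[OF sol]] _ _ _ t])
         (use q_lo in \<open>auto simp: gq_def\<close>)
    moreover have "(\<lambda>k. gq Q (int k) * cis (real k * t)) sums (\<Sum>k\<in>{1..N}. gq Q (int k) * cis (real k * t))"
      by (rule sums_finite) (use z in auto)
    ultimately show ?thesis by (rule sums_unique2)
  qed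
  \<comment> \<open>Here the two gauges meet. The factor exp(m z) that turns \<open>S\<close> into
    \<open>gaugeY\<close> of \<open>Q\<close> becomes under conjugation a factor exp(-m / z) on
    \<open>P\<close>, which is \<open>gaugeX\<close> for the sign -1.\<close>
  have "fc 0 (\<lambda>t. cnj (S t) * P t) = fc 0 (\<lambda>t. \<Sum>k\<in>{1..N}. cnj (gq Q (int k)) * (cis ((- real k) * t) * gaugeX m (-1) P t))"
  proof (rule fc_cong)
    fix t assume t: "t \<in> {0..2*pi}"
    define E where "E = exp (of_real m * cis t)"
    have E: "cnj E = exp (of_real m * cis (- t))" by (simp add: E_def exp_cnj cis_cnj)
    have E0: "E \<noteq> 0" by (simp add: E_def)
    have "E * S t = (cnj (hh (of_int L) m t) * E) * Q t"
      by (simp add: S_def mult_ac)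
    also have "\<dots> = gaugeY L m 1 Q t"
      using gauge_relation(2)[of 1 L m t] by (simp add: E_def gaugeY_def mult.assoc)
    finally have "E * S t = gaugeY L m 1 Q t" .
    then have "cnj E * cnj (S t) = cnj (gaugeY L m 1 Q t)" by (metis complex_cnj_mult)
    then have "exp (- (of_real m * cis (- t))) * (cnj E * cnj (S t)) = exp (- (of_real m * cis (- t))) * cnj (gaugeY L m 1 Q t)" by simp
    then have "cnj (S t) = exp (- (of_real m * cis (- t))) * cnj (gaugeY L m 1 Q t)"
      unfolding E by (simp add: mult.assoc[symmetric] exp_add[symmetric])
    then have "cnj (S t) * P t = cnj (gaugeY L m 1 Q t) * gaugeX m (-1) P t"
      by (simp add: gaugeX_def)
    also have "\<dots> = (\<Sum>k\<in>{1..N}. cnj (gq Q (int k)) * (cis ((- real k) * t) * gaugeX m (-1) P t))"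
      unfolding Y_series[OF t] by (simp add: cis_cnj sum_distrib_right mult.assoc)
    finally show "cnj (S t) * P t = (\<Sum>k\<in>{1..N}. cnj (gq Q (int k)) * (cis ((- real k) * t) * gaugeX m (-1) P t))" .
  qed
  also have "\<dots> = (\<Sum>k\<in>{1..N}. fc 0 (\<lambda>t. cnj (gq Q (int k)) * (cis ((- real k) * t) * gaugeX m (-1) P t)))"
  proof -
    have c: "continuous_on {0..2*pi} (\<lambda>t. cnj (gq Q (int k)) * (cis ((- real k) * t) * gaugeX m (-1) P t))" for k
      by (intro continuous_intros gauge_continuous(1)[OF sol]) simp
    show ?thesis by (rule fc_sum[OF finite_atLeastAtMost c])
  qed
  also have "\<dots> = (\<Sum>k\<in>{1..N}. cnj (gq Q (int k)) * gu P (int k))"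
  proof (rule sum.cong[OF refl])
    fix k
    show "fc 0 (\<lambda>t. cnj (gq Q (int k)) * (cis ((- real k) * t) * gaugeX m (-1) P t)) = cnj (gq Q (int k)) * gu P (int k)"
      by (simp only: fc_cmult fc_cis_mult gu_def) simp
  qed
  also have "\<dots> = 0"
    by (rule sum.neutral) (use u_win in \<open>auto simp: N_def\<close>)
  finally have zero: "fc 0 (\<lambda>t. cnj (S t) * P t) = 0" .
  have "(\<lambda>j. \<i> * (- \<i> * of_real (a * (norm (\<sigma> j))\<^sup>2 / real j))) sums (\<i> * 0)"
    using B unfolding fc_term zero by (rule sums_mult)
  then have "(\<lambda>j. complex_of_real (a * (norm (\<sigma> j))\<^sup>2 / real j)) sums complex_of_real 0"
    by (simp add: mult.assoc[symmetric])
  then have sum0: "(\<lambda>j. a * (norm (\<sigma> j))\<^sup>2 / real j) sums 0"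
    by (simp only: sums_of_real_iff)
  have "a * (norm (\<sigma> j))\<^sup>2 / real j = 0" for j
  proof -
    have nn: "\<And>j. 0 \<le> a * (norm (\<sigma> j))\<^sup>2 / real j" using a by simp
    show ?thesis
      using suminf_eq_zero_iff[OF sums_summable[OF sum0] nn] sums_unique[OF sum0, symmetric] by blast
  qed
  then have sig: "\<sigma> j = 0" for j using a sig0 by (cases "j = 0") auto
  have "fc (of_int k) S = 0" for k
  proof (cases "k \<ge> 0")
    case True
    then show ?thesis using sig[of "nat k"] by (simp add: \<sigma>_def)
  qed (use S_neg in simp)
  then have "S t = 0" if "t \<in> {0..2*pi}" for t
    by (intro fc_unique[OF S_cont S_per _ that]) auto
  then have Qz: "Q t = 0" if "t \<in> {0..2*pi}" for t
    using that by (simp add: S_def)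
  have fQ: "gq Q k = 0" for k
    unfolding gq_def using fc_cong[of "gaugeY L m 1 Q" "\<lambda>t. 0"] Qz by (simp add: gaugeY_def fc_def)
  moreover have "gp P k = 0" for k
    using rec_q[OF sol, of k] fQ cnz by simp
  ultimately show False using all_zero by blast
qed

subsection \<open>Trivial monodromy forces \<open>l\<close> to be an integer\<close>

text \<open>The Casoratian is constant by the recurrence and 0 by decay, so a three-term recurrence
  has, up to factors, at most one solution that decays at plus infinity.\<close>

lemma casoratian_const_zero:
  fixes r r' :: "int \<Rightarrow> complex"
  assumes m: "m \<noteq> 0"
    and r: "\<And>j. c j * r j = m * (r (j - 1) + r (j + 1))"
    and r': "\<And>j. c j * r' j = m * (r' (j - 1) + r' (j + 1))"
    and lim: "\<And>d. (\<lambda>n. r (int n + d)) \<longlonglongrightarrow> 0" "\<And>d. (\<lambda>n. r' (int n + d)) \<longlonglongrightarrow> 0"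
  shows "r 0 * r' 1 = r 1 * r' 0"
proof -
  define C where "C j = r j * r' (j + 1) - r (j + 1) * r' j" for j
  have step: "C j = C (j - 1)" for j
  proof -
    have "m * (C j - C (j - 1)) = r j * (m * (r' (j - 1) + r' (j + 1))) - r' j * (m * (r (j - 1) + r (j + 1)))"
      by (simp add: C_def algebra_simps)
    also have "\<dots> = 0" unfolding r[symmetric] r'[symmetric] by simp
    finally show ?thesis using m by simp
  qed
  have "C (int n) = C 0" for n
  proof (induction n)
    case (Suc n)
    show ?case using step[of "int (Suc n)"] Suc by simp
  qed simp
  moreover have "(\<lambda>n. C (int n)) \<longlonglongrightarrow> 0 * 0 - 0 * 0"
    unfolding C_def by (intro tendsto_diff tendsto_mult lim lim[of 0, simplified])
  ultimately have "C 0 = 0" using LIMSEQ_unique[OF tendsto_const] by simp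
  then show ?thesis by (simp add: C_def)
qed

lemma three_term_zero:
  fixes r :: "int \<Rightarrow> complex"
  assumes m: "m \<noteq> 0" and r: "\<And>j. c j * r j = m * (r (j - 1) + r (j + 1))"
    and r0: "r 0 = 0" "r 1 = 0"
  shows "r k = 0"
proof -
  have up: "r (int n) = 0 \<and> r (int n + 1) = 0" for n
  proof (induction n)
    case (Suc n)
    then show ?case using r[of "int n + 1"] m by (simp add: add.commute)
  qed (use r0 in simp)
  have down: "r (- int n) = 0 \<and> r (- 1 - int n) = 0" for n
  proof (induction n)
    case 0
    show ?case using r[of 0] r0 m by simp
  next
    case (Suc n)
    have e: "- int (Suc n) = - 1 - int n" "- 1 - int (Suc n) = (- 1 - int n) - 1" by simp_all
    have "- int n = (- 1 - int n) + 1" by simp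
    then have "r ((- 1 - int n) + 1) = 0" using Suc by metis
    then have "r ((- 1 - int n) - 1) = 0" using r[of "- 1 - int n"] m Suc by simp
    then show ?case unfolding e using Suc by blast
  qed
  show ?thesis
    by (rule int_zero_from_halves[of r]) (use up down in blast)+
qed

lemma exists_kernel_pair:
  fixes a b c d :: complex
  assumes "a * d = b * c"
  shows "\<exists>x y. (x \<noteq> 0 \<or> y \<noteq> 0) \<and> x * a + y * c = 0 \<and> x * b + y * d = 0"
proof (cases "a = 0 \<and> c = 0")
  case True
  show ?thesis
  proof (cases "b = 0 \<and> d = 0")
    case True
    then show ?thesis using \<open>a = 0 \<and> c = 0\<close> by (intro exI[of _ 1] exI[of _ 0]) simp
  next
    case False
    then show ?thesis using \<open>a = 0 \<and> c = 0\<close> by (intro exI[of _ d] exI[of _ "- b"]) auto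
  qed
next
  case False
  then show ?thesis using assms by (intro exI[of _ c] exI[of _ "- a"]) (auto simp: algebra_simps)
qed

text \<open>All solutions share one Floquet exponent \<open>k0\<close>. If it were not an integer,
  two independent solutions would give coefficient sequences of one regular three-term recurrence,
  both decaying; then a nontrivial combination has no coefficients at all. An integer exponent makes
  \<open>l\<close> an integer.\<close>

lemma integer_of_trivial_monodromy:
  assumes a: "a > 0" and m: "m \<noteq> 0" and b: "monb a l m = 0" and al: "Im (mona a l m) = 0"
  shows "\<exists>L. l = of_int L \<and> trivial_mon a L m"
proof -
  have a0: "a \<ge> 0" using a by simp
  define e where "e = Re (mona a l m)"
  have mona: "mona a l m = of_real e" using al by (simp add: e_def complex_eq_iff)
  have "e\<^sup>2 = 1" using monodromy_det[OF a0, of l m] b by (simp add: mona)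
  then have e1: "e = 1 \<or> e = -1" by (simp add: power2_eq_1_iff)
  \<comment> \<open>\<open>cis (2 * pi * k0)\<close> is the common multiplier of \<open>Q\<close>
    and \<open>hh * P\<close>; the sign \<open>e\<close> is absorbed by the shift 1 / 2.\<close>
  define k0 where "k0 = (if e = 1 then l / 2 else l / 2 + 1 / 2)"
  have k0: "cis (2 * pi * k0) = of_real e * cis (pi * l)"
  proof (cases "e = 1")
    case False
    then have "e = -1" using e1 by simp
    moreover have "2 * pi * (l / 2 + 1 / 2) = pi * l + pi" by (simp add: algebra_simps)
    ultimately show ?thesis using False by (simp add: k0_def cis_mult[symmetric])
  qed (simp add: k0_def)
  have per: "X (2 * pi) = of_real e * cis (- (pi * l)) * X 0" "Y (2 * pi) = cis (2 * pi * k0) * Y 0"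
    if XY: "lin_sol a l m X Y" for X Y
  proof -
    note M = lin_sol_monodromy[OF a0 XY, unfolded mona b]
    have c: "cis (- (pi * l)) * cis (pi * l) = 1" by (simp add: cis_mult)
    have "X (2 * pi) = (cis (- (pi * l)) * cis (pi * l)) * X (2 * pi)" unfolding c by simp
    also have "\<dots> = cis (- (pi * l)) * (cis (pi * l) * X (2 * pi))" by (rule mult.assoc)
    also have "\<dots> = cis (- (pi * l)) * (of_real e * X 0)" using M(1) by simp
    finally show "X (2 * pi) = of_real e * cis (- (pi * l)) * X 0" by (simp add: mult_ac)
    have "Y (2 * pi) = cis (pi * l) * (cis (- (pi * l)) * Y (2 * pi))"
      unfolding mult.assoc[symmetric] mult.commute[of "cis (pi * l)"] c by simp
    also have "\<dots> = cis (pi * l) * (of_real e * Y 0)" using M(2) by simp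
    finally show "Y (2 * pi) = cis (2 * pi * k0) * Y 0"
      unfolding k0 by (simp add: mult_ac)
  qed
  have R_per: "wave l m X (2 * pi) = cis (2 * pi * k0) * wave l m X 0" if XY: "lin_sol a l m X Y" for X Y
  proof -
    have h: "hh l m (2 * pi) = cis (2 * pi * l)" using hh_shift[of l m 0] by simp
    have "wave l m X (2 * pi) = (cis (2 * pi * l) * cis (- (pi * l))) * of_real e * X 0"
      unfolding wave_def h per(1)[OF XY] by (simp only: mult_ac)
    also have "cis (2 * pi * l) * cis (- (pi * l)) = cis (pi * l)" by (simp add: cis_mult)
    finally have f: "wave l m X (2 * pi) = cis (pi * l) * of_real e * X 0" .
    show ?thesis unfolding f k0 by (simp add: wave_def mult_ac)
  qed
  have jump: "(f (2 * pi) * cis (- (2 * pi * (k0 + of_int j))) - f 0) / (2 * pi) = 0"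
    if "f (2 * pi) = cis (2 * pi * k0) * f 0" for f :: "real \<Rightarrow> complex" and j :: int
  proof -
    have "cis (- (2 * pi * (k0 + of_int j))) = cis (- (2 * pi * k0)) * cis (- (2 * pi * of_int j))"
      unfolding cis_mult by (simp add: algebra_simps)
    then have "f (2 * pi) * cis (- (2 * pi * (k0 + of_int j))) = f 0 * (cis (2 * pi * k0) * cis (- (2 * pi * k0)))"
      unfolding that by simp
    also have "\<dots> = f 0" by (simp add: cis_mult)
    finally show ?thesis by simp
  qed
  define rr qq where "rr X j = fc (k0 + of_int j) (wave l m X)" and "qq Y j = fc (k0 + of_int j) Y"
    for X Y :: "real \<Rightarrow> complex" and j :: int
  have rec_q: "of_real a * rr X j = \<i> * of_real (k0 + of_int j) * qq Y j" if XY: "lin_sol a l m X Y" for X Y j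
    using fc_deriv[OF wave_deriv(2)[OF XY], of "k0 + of_int j"] jump[OF per(2)[OF XY], of j]
    by (simp add: rr_def qq_def fc_cmult)
  have rec_r: "\<i> * of_real (k0 + of_int j) * rr X j
      = \<i> * of_real l * rr X j + \<i> * of_real m * (rr X (j - 1) + rr X (j + 1)) + of_real a * qq Y j"
    if XY: "lin_sol a l m X Y" for X Y j
  proof -
    note c = wave_continuous[OF XY] lin_sol_continuous[OF XY]
    have c1: "continuous_on {0..2*pi} (\<lambda>t. \<i> * of_real l * wave l m X t)"
      and c2: "continuous_on {0..2*pi} (\<lambda>t. \<i> * of_real m * (cis (s * t) * wave l m X t))"
      and c3: "continuous_on {0..2*pi} (\<lambda>t. of_real a * Y t)" for s
      by (intro continuous_intros c)+
    have "\<i> * of_real (k0 + of_int j) * rr X j = fc (k0 + of_int j) (\<lambda>t. \<i> * of_real l * wave l m X t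
     + (\<i> * of_real m * (cis (1 * t) * wave l m X t) + \<i> * of_real m * (cis ((-1) * t) * wave l m X t)) + of_real a * Y t)"
      unfolding fc_deriv[OF wave_deriv(1)[OF XY]] jump[where f = "wave l m X", OF R_per[OF XY]] by (simp add: rr_def)
    also have "\<dots> = \<i> * of_real l * rr X j + (\<i> * of_real m * fc (k0 + of_int j - 1) (wave l m X) + \<i> * of_real m * fc (k0 + of_int j - (-1)) (wave l m X)) + of_real a * qq Y j"
      unfolding rr_def qq_def
      by (simp only: fc_add[OF continuous_on_add[OF c1 continuous_on_add[OF c2 c2]] c3] fc_add[OF c1 continuous_on_add[OF c2 c2]] fc_add[OF c2 c2] fc_cmult fc_cis_mult)
    finally show ?thesis by (simp add: rr_def algebra_simps)
  qed
  have "k0 \<in> \<int>"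
  proof (rule ccontr)
    assume k0Z: "k0 \<notin> \<int>"
    have nz: "k0 + of_int j \<noteq> 0" for j
    proof
      assume "k0 + of_int j = 0"
      then have "k0 = of_int (- j)" by simp
      then show False using k0Z by (metis Ints_of_int)
    qed
    \<comment> \<open>The quotient by \<open>k0 + j\<close> comes from eliminating \<open>Q\<close>.
      For an integer exponent the elimination fails at one frequency, where the recurrence splits
      into two half-lines; this is how trivial monodromy becomes possible.\<close>
    define c where "c j = complex_of_real (k0 + of_int j - l + a\<^sup>2 / (k0 + of_int j))" for j :: int
    have rec: "c j * rr X j = of_real m * (rr X (j - 1) + rr X (j + 1))" if XY: "lin_sol a l m X Y" for X Y j
    proof -
      define \<kappa> where "\<kappa> = complex_of_real (k0 + of_int j)"
      have kz: "\<kappa> \<noteq> 0" unfolding \<kappa>_def of_real_eq_0_iff by (rule nz)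
      have q: "qq Y j = - \<i> * of_real a * rr X j / \<kappa>"
      proof -
        have "\<i> * \<kappa> * qq Y j = of_real a * rr X j" using rec_q[OF XY, of j] by (simp add: \<kappa>_def)
        then have "(- \<i>) * (\<i> * \<kappa> * qq Y j) = (- \<i>) * (of_real a * rr X j)" by (rule arg_cong)
        then have "\<kappa> * qq Y j = - \<i> * of_real a * rr X j" by (simp add: mult.assoc[symmetric])
        then show ?thesis using kz by (simp add: field_simps)
      qed
      have "\<kappa> * rr X j = - \<i> * (\<i> * \<kappa> * rr X j)" by (simp add: mult.assoc[symmetric])
      also have "\<dots> = - \<i> * (\<i> * of_real l * rr X j + \<i> * of_real m * (rr X (j - 1) + rr X (j + 1)) + of_real a * qq Y j)"
        using rec_r[OF XY, of j] by (simp only: \<kappa>_def)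
      also have "\<dots> = of_real l * rr X j + of_real m * (rr X (j - 1) + rr X (j + 1)) - of_real (a\<^sup>2) * rr X j / \<kappa>"
        unfolding q by (simp add: algebra_simps power2_eq_square)
      finally have "(\<kappa> - of_real l + of_real (a\<^sup>2) / \<kappa>) * rr X j = of_real m * (rr X (j - 1) + rr X (j + 1))"
        by (simp add: algebra_simps)
      moreover have "c j = \<kappa> - of_real l + of_real (a\<^sup>2) / \<kappa>"
        by (simp add: c_def \<kappa>_def)
      ultimately show ?thesis by (simp only:)
    qed
    have lim: "(\<lambda>n. rr X (int n + d)) \<longlonglongrightarrow> 0" if XY: "lin_sol a l m X Y" for X Y d
      unfolding rr_def
    proof (rule fc_tendsto_0[OF wave_deriv(1)[OF XY]])
      show "continuous_on {0..2 * pi} (\<lambda>t. \<i> * of_real l * wave l m X t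
         + (\<i> * of_real m * (cis (1 * t) * wave l m X t) + \<i> * of_real m * (cis ((-1) * t) * wave l m X t)) + of_real a * Y t)"
        by (intro continuous_intros wave_continuous[OF XY] lin_sol_continuous[OF XY])
      have "filterlim (\<lambda>n. (k0 + of_int d) + real n) at_top sequentially"
        by (rule filterlim_tendsto_add_at_top[OF tendsto_const filterlim_real_sequentially])
      then have "filterlim (\<lambda>n. k0 + real_of_int (int n + d)) at_top sequentially"
        by (simp add: add_ac)
      then show "filterlim (\<lambda>n. k0 + real_of_int (int n + d)) at_infinity sequentially"
        by (rule filterlim_at_top_imp_at_infinity)
    qed
    have mC: "complex_of_real m \<noteq> 0" using m by simp
    note F = fund[OF a0, of l m]
    let ?P = "fundP a l m" and ?P' = "\<lambda>t. cnj (fundQ a l m t)"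
    let ?Q = "fundQ a l m" and ?Q' = "\<lambda>t. cnj (fundP a l m t)"
    note F' = lin_sol_cnj[OF F(1)]
    \<comment> \<open>Vanishing of the Casoratian allows a nontrivial combination whose coefficients
      are 0 at two adjacent frequencies, hence everywhere.\<close>
    have "rr ?P 0 * rr ?P' 1 = rr ?P 1 * rr ?P' 0"
      by (rule casoratian_const_zero[OF mC rec[OF F(1)] rec[OF F'] lim[OF F(1)] lim[OF F']])
    then obtain x y where xy: "x \<noteq> 0 \<or> y \<noteq> 0"
      "x * rr ?P 0 + y * rr ?P' 0 = 0" "x * rr ?P 1 + y * rr ?P' 1 = 0"
      using exists_kernel_pair by blast
    define X Y where "X t = x * ?P t + y * ?P' t" and "Y t = x * ?Q t + y * ?Q' t" for t
    have XY: "lin_sol a l m X Y"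
      unfolding X_def[abs_def] Y_def[abs_def] by (rule lin_sol_comb[OF F(1) F'])
    have rX: "rr X j = x * rr ?P j + y * rr ?P' j" for j
    proof -
      have "rr X j = fc (k0 + of_int j) (\<lambda>t. x * wave l m ?P t + y * wave l m ?P' t)"
        unfolding rr_def by (rule fc_cong) (simp add: X_def wave_def algebra_simps)
      also have "\<dots> = x * rr ?P j + y * rr ?P' j"
        unfolding rr_def
        by (subst fc_add) (auto simp only: fc_cmult intro!: continuous_intros wave_continuous[OF F(1)] wave_continuous[OF F'])
      finally show ?thesis .
    qed
    have z: "rr X j = 0" for j
      by (rule three_term_zero[OF mC rec[OF XY]]) (simp_all add: rX xy)
    have zq: "qq Y j = 0" for j
    proof -
      have "\<i> * of_real (k0 + of_int j) * qq Y j = 0" using rec_q[OF XY, of j] z by simp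
      moreover have "\<i> * complex_of_real (k0 + of_int j) \<noteq> 0"
        unfolding mult_eq_0_iff of_real_eq_0_iff using nz[of j] by simp
      ultimately show ?thesis by (metis mult_eq_0_iff)
    qed
    have vanish: "f 0 = 0"
      if f: "continuous_on {0..2*pi} f" "f (2 * pi) = cis (2 * pi * k0) * f 0" "\<And>j::int. fc (k0 + of_int j) f = 0"
      for f :: "real \<Rightarrow> complex"
    proof -
      have "cis (- k0 * 0) * f 0 = 0"
      proof (rule fc_unique[where f = "\<lambda>t. cis (- k0 * t) * f t"])
        show "continuous_on {0..2*pi} (\<lambda>t. cis (- k0 * t) * f t)" by (intro continuous_intros f(1))
        have "cis (- k0 * (2 * pi)) * f (2 * pi) = (cis (- k0 * (2 * pi)) * cis (2 * pi * k0)) * f 0"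
          unfolding f(2) by (simp only: mult.assoc)
        also have "cis (- k0 * (2 * pi)) * cis (2 * pi * k0) = 1" unfolding cis_mult by simp
        finally show "cis (- k0 * (2 * pi)) * f (2 * pi) = cis (- k0 * 0) * f 0" by simp
        show "fc (of_int j) (\<lambda>t. cis (- k0 * t) * f t) = 0" for j
          unfolding fc_cis_mult using f(3)[of j] by (simp add: add.commute)
      qed simp
      then show ?thesis by simp
    qed
    have "wave l m X 0 = 0"
      by (rule vanish[OF wave_continuous[OF XY] R_per[OF XY]]) (use z in \<open>simp add: rr_def\<close>)
    then have "X 0 = 0" by simp
    moreover have "Y 0 = 0"
      by (rule vanish[OF lin_sol_continuous(2)[OF XY] per(2)[OF XY]]) (use zq in \<open>simp add: qq_def\<close>)
    ultimately show False using xy(1) F(2,3) by (simp add: X_def Y_def)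
  qed
  then obtain j :: int where j: "k0 = of_int j" by (rule Ints_cases)
  have "\<exists>L. l = of_int L"
  proof (cases "e = 1")
    case True
    then have "l = of_int (2 * j)" using j by (simp add: k0_def)
    then show ?thesis by blast
  next
    case False
    then have "l = of_int (2 * j - 1)" using j by (simp add: k0_def)
    then show ?thesis by blast
  qed
  then obtain L where L: "l = of_int L" by blast
  have "X (2 * pi) = X 0 \<and> Y (2 * pi) = Y 0" if XY: "lin_sol a l m X Y" for X Y
  proof
    show "Y (2 * pi) = Y 0" using per(2)[OF XY] by (simp add: j)
    show "X (2 * pi) = X 0" using R_per[OF XY] by (simp add: j L)
  qed
  then show ?thesis using L by (auto simp: trivial_mon_def)
qed

subsection \<open>Fourier coefficients near a point of trivial monodromy\<close>

text \<open>Periodicity holds only up to the jumps, which enter as a right-hand side that is the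
  same at all frequencies. At \<open>k = 0\<close> the first equation ties \<open>r 0\<close> to the
  jump of \<open>Y\<close> alone.\<close>

lemma jump_recurrence:
  assumes XY: "lin_sol a (of_int L) m X Y"
  defines "r \<equiv> \<lambda>k::int. fc (of_int k) (wave (of_int L) m X)" and "q \<equiv> \<lambda>k::int. fc (of_int k) Y"
    and "JX \<equiv> (X (2 * pi) - X 0) / (2 * pi)" and "JY \<equiv> (Y (2 * pi) - Y 0) / (2 * pi)"
  shows "of_real a * r k = \<i> * of_int k * q k + JY"
    "\<i> * of_int k * r k + JX = \<i> * of_int L * r k + \<i> * of_real m * (r (k - 1) + r (k + 1)) + of_real a * q k"
proof -
  show "of_real a * r k = \<i> * of_int k * q k + JY"
    using fc_deriv[OF wave_deriv(2)[OF XY], of "of_int k"]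
    by (simp add: r_def q_def JY_def fc_cmult)
  let ?l = "real_of_int L"
  note c = wave_continuous[OF XY] lin_sol_continuous[OF XY]
  have c1: "continuous_on {0..2*pi} (\<lambda>t. \<i> * of_real ?l * wave ?l m X t)"
    and c2: "continuous_on {0..2*pi} (\<lambda>t. \<i> * of_real m * (cis (s * t) * wave ?l m X t))"
    and c3: "continuous_on {0..2*pi} (\<lambda>t. of_real a * Y t)" for s
    by (intro continuous_intros c)+
  have "\<i> * of_int k * r k + JX = fc (of_int k) (\<lambda>t. \<i> * of_real ?l * wave ?l m X t
     + (\<i> * of_real m * (cis (1 * t) * wave ?l m X t) + \<i> * of_real m * (cis ((-1) * t) * wave ?l m X t)) + of_real a * Y t)"
    unfolding fc_deriv[OF wave_deriv(1)[OF XY]] by (simp add: r_def JX_def)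
  also have "\<dots> = \<i> * of_real ?l * r k + (\<i> * of_real m * fc (of_int k - 1) (wave ?l m X) + \<i> * of_real m * fc (of_int k - (-1)) (wave ?l m X)) + of_real a * q k"
    unfolding r_def q_def
    by (simp only: fc_add[OF continuous_on_add[OF c1 continuous_on_add[OF c2 c2]] c3] fc_add[OF c1 continuous_on_add[OF c2 c2]] fc_add[OF c2 c2] fc_cmult fc_cis_mult)
  finally show "\<i> * of_int k * r k + JX = \<i> * of_int L * r k + \<i> * of_real m * (r (k - 1) + r (k + 1)) + of_real a * q k"
    by (simp add: r_def algebra_simps)
qed

lemma three_term_with_jump:
  assumes XY: "lin_sol a (of_int L) m X Y" and k: "k \<noteq> 0"
  defines "r \<equiv> \<lambda>k::int. fc (of_int k) (wave (of_int L) m X)"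
    and "JX \<equiv> (X (2 * pi) - X 0) / (2 * pi)" and "JY \<equiv> (Y (2 * pi) - Y 0) / (2 * pi)"
  shows "of_real (of_int k - of_int L + a\<^sup>2 / of_int k) * r k - of_real m * (r (k - 1) + r (k + 1))
     = \<i> * JX + of_real (a / of_int k) * JY"
proof -
  define \<kappa> where "\<kappa> = complex_of_int k"
  define q where "q = fc (of_int k) Y"
  have kz: "\<kappa> \<noteq> 0" using k by (simp add: \<kappa>_def)
  have 1: "of_real a * r k = \<i> * \<kappa> * q + JY"
    and 2: "\<i> * \<kappa> * r k + JX = \<i> * of_int L * r k + \<i> * of_real m * (r (k - 1) + r (k + 1)) + of_real a * q"
    using jump_recurrence[OF XY, of k] by (simp_all add: r_def JX_def JY_def \<kappa>_def q_def)
  have "\<i> * \<kappa> * q = of_real a * r k - JY" using 1 by simp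
  then have "(- \<i>) * (\<i> * \<kappa> * q) = (- \<i>) * (of_real a * r k - JY)" by (rule arg_cong)
  then have "\<kappa> * q = - \<i> * (of_real a * r k - JY)" by (simp add: mult.assoc[symmetric])
  then have q: "q = - \<i> * (of_real a * r k - JY) / \<kappa>" using kz by (simp add: field_simps)
  have "(- \<i>) * (\<i> * \<kappa> * r k + JX) = (- \<i>) * (\<i> * of_int L * r k + \<i> * of_real m * (r (k - 1) + r (k + 1)) + of_real a * q)"
    using 2 by (rule arg_cong)
  then have "\<kappa> * r k - \<i> * JX = of_int L * r k + of_real m * (r (k - 1) + r (k + 1)) - \<i> * of_real a * q"
    by (simp add: algebra_simps)
  also have "\<i> * of_real a * q = of_real a * (of_real a * r k - JY) / \<kappa>"
    unfolding q by (simp add: mult_ac)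
  finally have "(\<kappa> - of_int L + of_real (a\<^sup>2) / \<kappa>) * r k - of_real m * (r (k - 1) + r (k + 1)) = \<i> * JX + (of_real a / \<kappa>) * JY"
    by (simp add: algebra_simps power2_eq_square diff_divide_distrib)
  moreover have "complex_of_real (of_int k - of_int L + a\<^sup>2 / of_int k) = \<kappa> - of_int L + of_real (a\<^sup>2) / \<kappa>"
    "complex_of_real (a / of_int k) = of_real a / \<kappa>"
    by (simp_all add: \<kappa>_def)
  ultimately show ?thesis by (simp only:)
qed

text \<open>Summation by parts on the half-line of positive frequencies. The boundary term at 0
  retains only \<open>r 0\<close> because \<open>\<rho> 0 = 0\<close>, the one at infinity
  disappears by decay, and the mismatch between \<open>m\<close> and \<open>m0\<close> is the
  error.\<close>

lemma green_estimate:
  fixes \<rho> r g :: "nat \<Rightarrow> complex" and d :: "nat \<Rightarrow> real"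
  assumes \<rho>: "\<rho> 0 = 0" "\<And>k. of_real (d (Suc k)) * \<rho> (Suc k) = of_real m0 * (\<rho> k + \<rho> (k + 2))"
    and r: "\<And>k. of_real (d (Suc k)) * r (Suc k) - of_real m * (r k + r (k + 2)) = g (Suc k)"
    and B: "\<And>k. norm (r k) \<le> B" and sum: "summable (\<lambda>k. norm (\<rho> k))"
    and G: "(\<lambda>k. \<rho> (Suc k) * g (Suc k)) sums G"
  shows "norm (G + of_real m0 * \<rho> 1 * r 0) \<le> \<bar>m - m0\<bar> * (2 * B * (\<Sum>k. norm (\<rho> k)))"
proof -
  define D where "D k = \<rho> k * r (Suc k) - \<rho> (Suc k) * r k" for k
  define E where "E K = (\<Sum>k<K. \<rho> (Suc k) * (r k + r (k + 2)))" for K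
  have B0: "B \<ge> 0" using order_trans[OF norm_ge_zero B[of 0]] .
  have part: "(\<Sum>k<K. \<rho> (Suc k) * g (Suc k)) = of_real m0 * (D 0 - D K) - of_real (m - m0) * E K" for K
  proof (induction K)
    case (Suc K)
    have "\<rho> (Suc K) * g (Suc K) = (of_real (d (Suc K)) * \<rho> (Suc K)) * r (Suc K) - of_real m * \<rho> (Suc K) * (r K + r (K + 2))"
      unfolding r[symmetric] by (simp add: algebra_simps)
    also have "\<dots> = of_real m0 * (\<rho> K + \<rho> (K + 2)) * r (Suc K) - of_real m * \<rho> (Suc K) * (r K + r (K + 2))"
      unfolding \<rho>(2) ..
    also have "\<dots> = of_real m0 * (D K - D (Suc K)) - of_real (m - m0) * (\<rho> (Suc K) * (r K + r (K + 2)))"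
      by (simp add: D_def algebra_simps)
    finally have step: "\<rho> (Suc K) * g (Suc K) = of_real m0 * (D K - D (Suc K)) - of_real (m - m0) * (\<rho> (Suc K) * (r K + r (K + 2)))" .
    have E: "E (Suc K) = E K + \<rho> (Suc K) * (r K + r (K + 2))" by (simp add: E_def)
    show ?case unfolding sum.lessThan_Suc Suc E step by (simp add: algebra_simps)
  qed (simp add: E_def)
  have D0: "D 0 = - \<rho> 1 * r 0" by (simp add: D_def \<rho>(1))
  have Eb: "norm (E K) \<le> 2 * B * (\<Sum>k. norm (\<rho> k))" for K
  proof -
    have "norm (E K) \<le> (\<Sum>k<K. norm (\<rho> (Suc k)) * (2 * B))"
      unfolding E_def
    proof (rule order_trans[OF norm_sum sum_mono])
      fix k
      have "norm (r k + r (k + 2)) \<le> 2 * B"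
        using B[of k] B[of "k + 2"] norm_triangle_ineq[of "r k" "r (k + 2)"] by linarith
      then show "norm (\<rho> (Suc k) * (r k + r (k + 2))) \<le> norm (\<rho> (Suc k)) * (2 * B)"
        by (simp add: norm_mult mult_left_mono)
    qed
    also have "\<dots> = (\<Sum>k<K. norm (\<rho> (Suc k))) * (2 * B)" by (simp add: sum_distrib_right)
    also have "(\<Sum>k<K. norm (\<rho> (Suc k))) = (\<Sum>k<Suc K. norm (\<rho> k))"
      by (simp only: sum.lessThan_Suc_shift) (simp add: \<rho>(1))
    also have "(\<Sum>k<Suc K. norm (\<rho> k)) * (2 * B) \<le> (\<Sum>k. norm (\<rho> k)) * (2 * B)"
      using B0 by (intro mult_right_mono sum_le_suminf[OF sum]) auto
    finally show ?thesis by (simp add: mult_ac)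
  qed
  have \<rho>0: "\<rho> \<longlonglongrightarrow> 0"
    using summable_LIMSEQ_zero[OF sum] by (rule tendsto_norm_zero_cancel)
  have Dlim: "D \<longlonglongrightarrow> 0"
  proof (rule Lim_null_comparison)
    show "\<forall>\<^sub>F k in sequentially. norm (D k) \<le> norm (\<rho> k) * B + norm (\<rho> (Suc k)) * B"
    proof (intro always_eventually allI)
      fix k
      have "norm (D k) \<le> norm (\<rho> k * r (Suc k)) + norm (\<rho> (Suc k) * r k)"
        unfolding D_def by (rule norm_triangle_ineq4)
      also have "\<dots> \<le> norm (\<rho> k) * B + norm (\<rho> (Suc k)) * B"
        unfolding norm_mult using B by (intro add_mono mult_left_mono) auto
      finally show "norm (D k) \<le> norm (\<rho> k) * B + norm (\<rho> (Suc k)) * B" .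
    qed
    have "(\<lambda>k. norm (\<rho> k) * B + norm (\<rho> (Suc k)) * B) \<longlonglongrightarrow> norm (0::complex) * B + norm (0::complex) * B"
      by (intro tendsto_intros \<rho>0 LIMSEQ_Suc[OF \<rho>0])
    then show "(\<lambda>k. norm (\<rho> k) * B + norm (\<rho> (Suc k)) * B) \<longlonglongrightarrow> 0" by simp
  qed
  have "(\<lambda>K. norm ((\<Sum>k<K. \<rho> (Suc k) * g (Suc k)) + of_real m0 * \<rho> 1 * r 0 + of_real m0 * D K))
     \<longlonglongrightarrow> norm (G + of_real m0 * \<rho> 1 * r 0 + of_real m0 * 0)"
    using G unfolding sums_def by (intro tendsto_intros Dlim)
  moreover have "norm ((\<Sum>k<K. \<rho> (Suc k) * g (Suc k)) + of_real m0 * \<rho> 1 * r 0 + of_real m0 * D K)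
      \<le> \<bar>m - m0\<bar> * (2 * B * (\<Sum>k. norm (\<rho> k)))" for K
  proof -
    have "(\<Sum>k<K. \<rho> (Suc k) * g (Suc k)) + of_real m0 * \<rho> 1 * r 0 + of_real m0 * D K = - of_real (m - m0) * E K"
      unfolding part D0 by (simp add: algebra_simps)
    then have "norm ((\<Sum>k<K. \<rho> (Suc k) * g (Suc k)) + of_real m0 * \<rho> 1 * r 0 + of_real m0 * D K) = \<bar>m - m0\<bar> * norm (E K)"
      by (simp only: norm_mult norm_minus_cancel norm_of_real)
    then show ?thesis using mult_left_mono[OF Eb[of K], of "\<bar>m - m0\<bar>"] by simp
  qed
  ultimately show ?thesis
    by (intro LIMSEQ_le_const2) (auto simp del: of_real_diff)
qed

text \<open>The nonnegative frequencies of a solution normalized to have no coefficient at frequency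
  1. Both starting values are then controlled by the jumps, and with them every bounded sequence of
  this kind.\<close>

definition jump_seq :: "real \<Rightarrow> int \<Rightarrow> real \<Rightarrow> (nat \<Rightarrow> complex) \<Rightarrow> complex \<Rightarrow> complex \<Rightarrow> bool" where
  "jump_seq a L m r JX JY \<longleftrightarrow> of_real a * r 0 = JY \<and> r 1 = 0 \<and>
     (\<forall>k. of_real (real (Suc k) - of_int L + a\<^sup>2 / real (Suc k)) * r (Suc k) - of_real m * (r k + r (k + 2))
        = \<i> * JX + of_real (a / real (Suc k)) * JY)"

lemma jump_seq_rhs_bound:
  assumes "a > 0"
  shows "norm (\<i> * JX + of_real (a / real (Suc k)) * JY) \<le> (1 + a) * (norm JX + norm JY)"
proof -
  have "norm (\<i> * JX + of_real (a / real (Suc k)) * JY) \<le> norm JX + \<bar>a / real (Suc k)\<bar> * norm JY"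
    by (rule order_trans[OF norm_triangle_ineq]) (simp only: norm_mult norm_of_real norm_ii mult_1_left order_refl)
  also have "\<bar>a / real (Suc k)\<bar> \<le> a"
    using assms divide_left_mono[of 1 "real (Suc k)" a] by simp
  finally have "norm (\<i> * JX + of_real (a / real (Suc k)) * JY) \<le> norm JX + a * norm JY"
    by (simp add: mult_right_mono)
  also have "\<dots> \<le> (1 + a) * (norm JX + norm JY)"
    using assms by (simp add: algebra_simps)
  finally show ?thesis .
qed

text \<open>Each step of the forward recurrence divides by \<open>m\<close>, so the constant may
  grow with \<open>K\<close>; the lower bound \<open>m1\<close> makes it independent of
  \<open>m\<close>.\<close>

lemma jump_seq_initial_bound:
  assumes a: "a > 0" and m1: "m1 > 0"
  shows "\<exists>C\<ge>0. \<forall>m r JX JY. m1 \<le> \<bar>m\<bar> \<and> jump_seq a L m r JX JY \<longrightarrow>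
     (\<forall>k\<le>K. norm (r k) \<le> C * (norm JX + norm JY))"
proof (induction K)
  case 0
  have "norm (r 0) \<le> (1 / a) * (norm JX + norm JY)" if "jump_seq a L m r JX JY" for m r JX JY
  proof -
    have "a * norm (r 0) = norm JY"
      using that a unfolding jump_seq_def by (metis abs_of_pos norm_mult norm_of_real)
    then have "norm (r 0) = (1 / a) * norm JY" using a by (simp add: field_simps)
    also have "\<dots> \<le> (1 / a) * (norm JX + norm JY)" using a by (intro mult_left_mono) auto
    finally show ?thesis .
  qed
  then show ?case using a by (intro exI[of _ "1 / a"]) auto
next
  case (Suc K)
  then obtain C where C: "C \<ge> 0" "\<And>m r JX JY k. m1 \<le> \<bar>m\<bar> \<Longrightarrow> jump_seq a L m r JX JY \<Longrightarrow> k \<le> K \<Longrightarrow>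
     norm (r k) \<le> C * (norm JX + norm JY)" by blast
  define d where "d = \<bar>real K - of_int L + a\<^sup>2 / real K\<bar>"
  define C' where "C' = C + (d * C + (1 + a)) / m1"
  have CC: "C \<le> C'" using C(1) a m1 by (simp add: C'_def d_def)
  have "norm (r k) \<le> C' * (norm JX + norm JY)"
    if m: "m1 \<le> \<bar>m\<bar>" and js: "jump_seq a L m r JX JY" and k: "k \<le> Suc K" for m r JX JY k
  proof (cases "k \<le> K")
    case True
    show ?thesis
      by (rule order_trans[OF C(2)[OF m js True]]) (intro mult_right_mono CC, simp)
  next
    case False
    then have kK: "k = Suc K" using k by simp
    define J where "J = norm JX + norm JY"
    have J0: "J \<ge> 0" by (simp add: J_def)
    show ?thesis
    proof (cases K)
      case 0
      then have "r k = 0" using js kK by (simp add: jump_seq_def)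
      then show ?thesis using C(1) CC by (simp add: add_nonneg_nonneg)
    next
      case (Suc n)
      define rhs where "rhs = \<i> * JX + of_real (a / real (Suc n)) * JY"
      have e: "of_real (real (Suc n) - of_int L + a\<^sup>2 / real (Suc n)) * r (Suc n) - of_real m * (r n + r (n + 2)) = rhs"
        using js unfolding jump_seq_def rhs_def by blast
      have r1: "norm (r (Suc n)) \<le> C * J" "norm (r n) \<le> C * J"
        using C(2)[OF m js, of "Suc n"] C(2)[OF m js, of n] Suc by (simp_all add: J_def)
      have rb: "norm rhs \<le> (1 + a) * J" unfolding rhs_def J_def by (rule jump_seq_rhs_bound[OF a])
      have "of_real m * r (n + 2) = of_real (real (Suc n) - of_int L + a\<^sup>2 / real (Suc n)) * r (Suc n) - rhs - of_real m * r n"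
        using e by (simp add: algebra_simps)
      then have "norm (of_real m * r (n + 2)) \<le> norm (of_real (real (Suc n) - of_int L + a\<^sup>2 / real (Suc n)) * r (Suc n)) + norm rhs + norm (of_real m * r n)"
        by (simp only: order_trans[OF norm_triangle_ineq4 add_right_mono[OF norm_triangle_ineq4]])
      also have "\<dots> \<le> d * (C * J) + (1 + a) * J + \<bar>m\<bar> * (C * J)"
        unfolding norm_mult norm_of_real using r1 rb Suc
        by (intro add_mono mult_left_mono) (auto simp: d_def intro!: mult_left_mono)
      finally have "\<bar>m\<bar> * norm (r (n + 2)) \<le> (d * C + (1 + a)) * J + \<bar>m\<bar> * (C * J)"
        by (simp add: norm_mult algebra_simps)
      also have "(d * C + (1 + a)) * J \<le> \<bar>m\<bar> * ((d * C + (1 + a)) / m1 * J)"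
      proof -
        have "m1 * ((d * C + (1 + a)) / m1 * J) \<le> \<bar>m\<bar> * ((d * C + (1 + a)) / m1 * J)"
          using m m1 C(1) a J0 by (intro mult_right_mono) (auto simp: d_def)
        then show ?thesis using m1 by simp
      qed
      finally have "\<bar>m\<bar> * norm (r (n + 2)) \<le> \<bar>m\<bar> * (C' * J)"
        by (simp add: C'_def algebra_simps)
      then have "norm (r (n + 2)) \<le> C' * J"
        by (rule mult_left_le_imp_le) (use m m1 in simp)
      then show ?thesis using kK Suc by (simp add: J_def)
    qed
  qed
  then show ?case using C(1) CC by (intro exI[of _ C']) auto
qed

text \<open>Only finitely many steps of the recurrence may amplify; beyond them the diagonal dominates and a
  bounded sequence obeys the maximum principle.\<close>

lemma jump_seq_bound:
  assumes a: "a > 0" and m1: "m1 > 0" and m2: "m2 > 0"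
  shows "\<exists>C\<ge>0. \<forall>m r JX JY. m1 \<le> \<bar>m\<bar> \<and> \<bar>m\<bar> \<le> m2 \<and> jump_seq a L m r JX JY \<and> (\<exists>B. \<forall>k. norm (r k) \<le> B) \<longrightarrow>
     (\<forall>k. norm (r k) \<le> C * (norm JX + norm JY))"
proof -
  \<comment> \<open>Beyond \<open>K\<close> the diagonal coefficient is at least
    \<open>3 * m2\<close>, against at most \<open>2 * m2\<close> for the two neighbours
    together.\<close>
  define K where "K = nat \<lceil>\<bar>of_int L\<bar> + 3 * m2\<rceil>"
  have K: "real K \<ge> \<bar>of_int L\<bar> + 3 * m2" unfolding K_def by linarith
  obtain C where C: "C \<ge> 0" "\<And>m r JX JY k. m1 \<le> \<bar>m\<bar> \<Longrightarrow> jump_seq a L m r JX JY \<Longrightarrow> k \<le> K \<Longrightarrow>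
     norm (r k) \<le> C * (norm JX + norm JY)"
    using jump_seq_initial_bound[OF a m1, of L K] by blast
  define C' where "C' = 3 * C + (1 + a) / m2"
  have CC: "C \<le> C'" "C' \<ge> 0" using C(1) a m2 by (simp_all add: C'_def)
  have "norm (r k) \<le> C' * (norm JX + norm JY)"
    if m: "m1 \<le> \<bar>m\<bar>" "\<bar>m\<bar> \<le> m2" and js: "jump_seq a L m r JX JY" and B: "\<And>k. norm (r k) \<le> B" for m r JX JY B k
  proof -
    define J where "J = norm JX + norm JY"
    have J0: "J \<ge> 0" by (simp add: J_def)
    have bdd: "bdd_above (range (\<lambda>k. norm (r k)))" using B by (auto simp: bdd_above_def)
    define s where "s = (SUP k. norm (r k))"
    have s: "norm (r k) \<le> s" for k unfolding s_def by (rule cSUP_upper[OF _ bdd]) simp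
    have s0: "s \<ge> 0" using order_trans[OF norm_ge_zero s] .
    have each: "norm (r k) \<le> max (C * J) ((2 * m2 * s + (1 + a) * J) / (3 * m2))" for k
    proof (cases "k \<le> K")
      case True
      then show ?thesis using C(2)[OF m(1) js True] by (simp add: J_def)
    next
      case False
      then obtain n where n: "k = Suc n" by (cases k) auto
      define rhs where "rhs = \<i> * JX + of_real (a / real (Suc n)) * JY"
      define D where "D = real (Suc n) - of_int L + a\<^sup>2 / real (Suc n)"
      have e: "of_real D * r (Suc n) - of_real m * (r n + r (n + 2)) = rhs"
        using js unfolding jump_seq_def rhs_def D_def by blast
      have rb: "norm rhs \<le> (1 + a) * J" unfolding rhs_def J_def by (rule jump_seq_rhs_bound[OF a])
      have "real (Suc n) \<ge> real K" using False n by simp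
      moreover have "a\<^sup>2 / real (Suc n) \<ge> 0" by simp
      moreover have "real_of_int L \<le> \<bar>real_of_int L\<bar>" by simp
      ultimately have D: "D \<ge> 3 * m2" unfolding D_def using K by linarith
      have "of_real D * r (Suc n) = rhs + of_real m * (r n + r (n + 2))"
        using e by (simp add: algebra_simps)
      then have "norm (of_real D * r (Suc n)) \<le> norm rhs + norm (of_real m * (r n + r (n + 2)))"
        using norm_triangle_ineq by metis
      also have "norm (of_real m * (r n + r (n + 2))) \<le> m2 * (s + s)"
        unfolding norm_mult norm_of_real
        using m s s0 m2 by (intro mult_mono order_trans[OF norm_triangle_ineq add_mono]) auto
      finally have "D * norm (r (Suc n)) \<le> (1 + a) * J + 2 * m2 * s"
        using rb D m2 by (simp add: norm_mult)
      moreover have "3 * m2 * norm (r (Suc n)) \<le> D * norm (r (Suc n))"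
        using D by (intro mult_right_mono) auto
      ultimately have "norm (r k) \<le> (2 * m2 * s + (1 + a) * J) / (3 * m2)"
        using m2 n by (simp add: field_simps)
      then show ?thesis by simp
    qed
    have "s \<le> max (C * J) ((2 * m2 * s + (1 + a) * J) / (3 * m2))"
      unfolding s_def[of] by (rule cSUP_least) (use each s_def in auto)
    then consider "s \<le> C * J" | "s \<le> (2 * m2 * s + (1 + a) * J) / (3 * m2)" by linarith
    then have "s \<le> C' * J"
    proof cases
      case 1
      also have "C * J \<le> C' * J" using CC J0 by (intro mult_right_mono) auto
      finally show ?thesis .
    next
      case 2
      then have "m2 * s \<le> (1 + a) * J" using m2 by (simp add: field_simps)
      then have "s \<le> (1 + a) / m2 * J" using m2 by (simp add: field_simps)
      also have "\<dots> \<le> C' * J" using C(1) J0 by (intro mult_right_mono) (auto simp: C'_def)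
      finally show ?thesis .
    qed
    then show ?thesis using s[of k] by (simp add: J_def)
  qed
  then show ?thesis using CC(2) by (intro exI[of _ C']) blast
qed

text \<open>With \<open>k = c2 / c1\<close>, smallness of \<open>p + q * k\<close> makes
  \<open>p\<close> nearly equal to \<open>- q * k\<close>, so \<open>p * q\<close> has the sign
  opposite to \<open>Re k\<close>. In the boundary case \<open>Re k = 0\<close> no such pair exists,
  so it may be put on either side.\<close>

lemma sign_dichotomy:
  fixes c1 c2 :: complex
  assumes c: "c1 \<noteq> 0" "c2 \<noteq> 0"
  shows "\<exists>e>0. (\<forall>p q::real. (p \<noteq> 0 \<or> q \<noteq> 0) \<and> norm (p * c1 + q * c2) \<le> e * (\<bar>p\<bar> + \<bar>q\<bar>) \<longrightarrow> p * q < 0) \<or>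
             (\<forall>p q::real. (p \<noteq> 0 \<or> q \<noteq> 0) \<and> norm (p * c1 + q * c2) \<le> e * (\<bar>p\<bar> + \<bar>q\<bar>) \<longrightarrow> p * q > 0)"
proof -
  define k where "k = c2 / c1"
  have k0: "k \<noteq> 0" using c by (simp add: k_def)
  \<comment> \<open>A lower bound for both 1 and |k|. When the mixed term is nonnegative, |p + q
    k|^2 is at least u^2 (p^2 + q^2), hence at least u^2 (|p| + |q|)^2 / 2, twice the square of what
    \<open>e\<close> admits.\<close>
  define u where "u = min 1 (norm k)"
  have u: "u > 0" "u \<le> 1" "u \<le> norm k" using k0 by (auto simp: u_def)
  define e where "e = norm c1 * u / 2"
  have e: "e > 0" using c u by (simp add: e_def)
  have main: False
    if pq: "p \<noteq> 0 \<or> q \<noteq> 0" and le: "norm (p * c1 + q * c2) \<le> e * (\<bar>p\<bar> + \<bar>q\<bar>)" and s: "0 \<le> p * q * Re k" for p q :: real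
  proof -
    have "p * c1 + q * c2 = c1 * (of_real p + of_real q * k)" using c by (simp add: k_def field_simps)
    then have "norm c1 * norm (of_real p + of_real q * k) \<le> norm c1 * (u / 2 * (\<bar>p\<bar> + \<bar>q\<bar>))"
      using le by (simp add: norm_mult e_def mult_ac)
    then have "norm (of_real p + of_real q * k) \<le> u / 2 * (\<bar>p\<bar> + \<bar>q\<bar>)" using c by simp
    then have "(norm (of_real p + of_real q * k))\<^sup>2 \<le> (u / 2 * (\<bar>p\<bar> + \<bar>q\<bar>))\<^sup>2"
      by (rule power_mono) simp
    moreover have "(norm (of_real p + of_real q * k))\<^sup>2 = p\<^sup>2 + 2 * (p * q * Re k) + q\<^sup>2 * (norm k)\<^sup>2"
      unfolding cmod_power2 by (simp add: power2_eq_square algebra_simps)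
    moreover have "q\<^sup>2 * u\<^sup>2 \<le> q\<^sup>2 * (norm k)\<^sup>2" using u by (intro mult_left_mono power_mono) auto
    moreover have "p\<^sup>2 * u\<^sup>2 \<le> p\<^sup>2 * 1" using u by (intro mult_left_mono power_le_one) auto
    ultimately have "(p\<^sup>2 + q\<^sup>2) * u\<^sup>2 \<le> (u / 2 * (\<bar>p\<bar> + \<bar>q\<bar>))\<^sup>2" using s by (simp add: distrib_right)
    also have "\<dots> = u\<^sup>2 * ((\<bar>p\<bar> + \<bar>q\<bar>)\<^sup>2 / 4)" by (simp add: power_mult_distrib power_divide)
    also have "(\<bar>p\<bar> + \<bar>q\<bar>)\<^sup>2 \<le> 2 * (p\<^sup>2 + q\<^sup>2)"
      using sum_squares_bound[of "\<bar>p\<bar>" "\<bar>q\<bar>"] by (simp add: power2_sum)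
    finally have "(p\<^sup>2 + q\<^sup>2) * u\<^sup>2 \<le> u\<^sup>2 * (2 * (p\<^sup>2 + q\<^sup>2) / 4)"
      by (simp add: mult_left_mono divide_right_mono)
    then have "u\<^sup>2 * (p\<^sup>2 + q\<^sup>2) \<le> 0" by (simp add: field_simps)
    moreover have "u\<^sup>2 * (p\<^sup>2 + q\<^sup>2) > 0" using u pq by (intro mult_pos_pos) (auto simp: sum_power2_gt_zero_iff)
    ultimately show False by simp
  qed
  show ?thesis
  proof (cases "Re k \<ge> 0")
    case True
    have "p * q < 0" if "p \<noteq> 0 \<or> q \<noteq> 0" "norm (p * c1 + q * c2) \<le> e * (\<bar>p\<bar> + \<bar>q\<bar>)" for p q :: real
      using main[OF that] True by (metis mult_nonneg_nonneg not_less)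
    then show ?thesis using e by blast
  next
    case False
    have "p * q > 0" if "p \<noteq> 0 \<or> q \<noteq> 0" "norm (p * c1 + q * c2) \<le> e * (\<bar>p\<bar> + \<bar>q\<bar>)" for p q :: real
      using main[OF that] False by (metis mult_nonpos_nonpos nle_le not_less)
    then show ?thesis using e by blast
  qed
qed

section \<open>One-sided solutions at trivial monodromy\<close>

lemma zero_coefficients_zero:
  assumes a: "a > 0" and sol: "periodic_sol a L m X Y"
    and z: "\<And>k::int. fc (of_int k) (wave (of_int L) m X) = 0"
  shows "X 0 = 0" "Y 0 = 0"
proof -
  have lin: "lin_sol a (of_int L) m X Y" and per: "X (2 * pi) = X 0" "Y (2 * pi) = Y 0"
    using sol by (simp_all add: periodic_sol_def)
  have "wave (of_int L) m X 0 = 0"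
    by (rule fc_unique[OF wave_continuous[OF lin] _ z]) (simp_all add: per)
  then show "X 0 = 0" by simp
  have q: "fc (of_int k) Y = 0" for k
  proof (cases "k = 0")
    case True
    then show ?thesis
      using jump_recurrence(2)[OF lin, of 0] z[of 0] z[of "-1"] z[of 1] per a by simp
  next
    case False
    then show ?thesis using jump_recurrence(1)[OF lin, of k] z[of k] per by simp
  qed
  show "Y 0 = 0"
    by (rule fc_unique[OF lin_sol_continuous(2)[OF lin] per(2) q]) simp
qed

text \<open>For a periodic solution the coefficient at frequency 0 vanishes, so the two half-lines
  decouple, and one more zero at \<open>s\<close> empties the half-line on that side.\<close>

lemma one_sided_coefficients:
  assumes a: "a > 0" and m: "m \<noteq> 0" and sol: "periodic_sol a L m X Y"
    and s: "s = 1 \<or> s = -1" and z: "fc (of_int s) (wave (of_int L) m X) = 0"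
  shows "fc (of_int (s * int n)) (wave (of_int L) m X) = 0"
proof -
  define r where "r k = fc (of_int k) (wave (of_int L) m X)" for k :: int
  have lin: "lin_sol a (of_int L) m X Y" and per: "X (2 * pi) = X 0" "Y (2 * pi) = Y 0"
    using sol by (simp_all add: periodic_sol_def)
  have r0: "r 0 = 0"
    using jump_recurrence(1)[OF lin, of 0] per a by (simp add: r_def)
  have rec: "of_real (of_int k - of_int L + a\<^sup>2 / of_int k) * r k - of_real m * (r (k - 1) + r (k + 1)) = 0" if "k \<noteq> 0" for k
    using three_term_with_jump[OF lin that] per by (simp add: r_def)
  have "r (s * int n) = 0 \<and> r (s * int n + s) = 0"
  proof (induction n)
    case 0
    show ?case using r0 z by (simp add: r_def)
  next
    case (Suc n)
    define k where "k = s * int n + s"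
    have kz: "k \<noteq> 0" using s by (auto simp: k_def)
    have rk: "r k = 0" "r (k - s) = 0" using Suc by (simp_all add: k_def)
    have "r (k - 1) + r (k + 1) = 0" using rec[OF kz] m rk by simp
    then have "r (k + s) = 0" using s rk by auto
    moreover have "s * int (Suc n) = k" by (simp add: k_def algebra_simps)
    ultimately show ?case using rk by simp
  qed
  then show ?thesis by (simp only: r_def)
qed

text \<open>An isotropic initial vector makes the solution proportional to its conjugate
  \<open>(cnj Y, cnj X)\<close>. If the coefficients of \<open>Y\<close> are missing on one side,
  those of \<open>X\<close> are then missing on the other, which is excluded by
  \<open>no_polynomial_solution\<close>. Exchanging the components reduces \<open>s = -1\<close> to
  \<open>s = 1\<close>.\<close>

lemma not_isotropic:
  assumes a: "a > 0" and m: "m \<noteq> 0" and triv: "trivial_mon a L m"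
    and lin: "lin_sol a (of_int L) m X Y" and nz: "X 0 \<noteq> 0 \<or> Y 0 \<noteq> 0"
    and s: "s = 1 \<or> s = -1" and z: "fc (of_int s) (wave (of_int L) m X) = 0"
    and \<sigma>: "\<sigma> = 1 \<or> \<sigma> = (-1::complex)"
  shows "X 0 \<noteq> \<sigma> * \<i> * Y 0"
proof
  assume iso: "X 0 = \<sigma> * \<i> * Y 0"
  have sol: "periodic_sol a L m X Y" by (rule trivial_mon_sol[OF triv lin])
  have per: "X (2 * pi) = X 0" "Y (2 * pi) = Y 0" using sol by (simp_all add: periodic_sol_def)
  have a0: "a \<ge> 0" using a by simp
  have Y0: "Y 0 \<noteq> 0" using nz iso by auto
  define \<kappa> where "\<kappa> = - \<sigma> * \<i> * cnj (Y 0) / Y 0"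
  have ss: "\<sigma> * \<sigma> = 1" "cnj \<sigma> = \<sigma>" "\<sigma> \<noteq> 0" using \<sigma> by auto
  have \<kappa>0: "\<kappa> \<noteq> 0" using Y0 ss by (simp add: \<kappa>_def)
  have "\<kappa> * X 0 = (\<sigma> * \<sigma>) * cnj (Y 0)"
    using \<sigma> Y0 by (auto simp: \<kappa>_def iso mult_ac) (simp_all add: mult.assoc[of \<i> \<i>, symmetric])?
  then have k1: "cnj (Y 0) = \<kappa> * X 0" by (simp add: ss)
  have k2: "cnj (X 0) = \<kappa> * Y 0"
    using Y0 by (simp add: \<kappa>_def iso ss)
  have XY: "cnj (Y t) = \<kappa> * X t" for t
  proof -
    have "cnj (Y t) = cnj (Y 0) * fundP a (of_int L) m t + cnj (X 0) * cnj (fundQ a (of_int L) m t)"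
      using lin_sol_repr(1)[OF a0 lin_sol_cnj[OF lin], of t] by simp
    also have "\<dots> = \<kappa> * (X 0 * fundP a (of_int L) m t + Y 0 * cnj (fundQ a (of_int L) m t))"
      unfolding k1 k2 by (simp add: algebra_simps)
    also have "\<dots> = \<kappa> * X t" by (simp only: lin_sol_repr(1)[OF a0 lin, of t, symmetric])
    finally show ?thesis .
  qed
  have fXY: "\<kappa> * fc (of_int k) X = cnj (fc (of_int (- k)) Y)" for k
  proof -
    have "\<kappa> * fc (of_int k) X = fc (of_int k) (\<lambda>t. cnj (Y t))"
      unfolding XY fc_cmult ..
    then show ?thesis by (simp add: fc_cnj)
  qed
  have Yz: "fc (of_int (s * k)) Y = 0" if "k \<ge> 1" for k
  proof -
    have "fc (of_int (s * int (nat k))) (wave (of_int L) m X) = 0"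
      by (rule one_sided_coefficients[OF a m sol s z])
    then have "\<i> * of_int (s * k) * fc (of_int (s * k)) Y = 0"
      using jump_recurrence(1)[OF lin, of "s * k"] that by (simp add: per)
    moreover have "\<i> * (of_int (s * k) :: complex) \<noteq> 0"
      unfolding mult_eq_0_iff of_int_eq_0_iff using that s by auto
    ultimately show ?thesis by (metis mult_eq_0_iff)
  qed
  have Xz: "fc (of_int (- (s * k))) X = 0" if "k \<ge> 1" for k
    using fXY[of "- (s * k)"] Yz[OF that] \<kappa>0 by simp
  show False
    using s
  proof
    assume s1: "s = 1"
    show False
    proof (rule no_polynomial_solution[OF a m triv lin nz])
      show "fc (of_int j) Y = 0" if "1 \<le> j" for j using Yz[OF that] s1 by simp
      show "fc (of_int j) X = 0" if "j < 0" for j using Xz[of "- j"] that s1 by simp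
    qed
  next
    assume s1: "s = -1"
    have swap: "lin_sol a (of_int (- L)) (- m) Y X"
      using lin_sol_swap[OF lin] by simp
    have triv': "trivial_mon a (- L) (- m)"
      unfolding trivial_mon_def
    proof (intro allI impI)
      fix U V assume "lin_sol a (of_int (- L)) (- m) U V"
      from lin_sol_swap[OF this] have "lin_sol a (of_int L) m V U" by simp
      then show "U (2 * pi) = U 0 \<and> V (2 * pi) = V 0" using triv by (auto simp: trivial_mon_def)
    qed
    show False
    proof (rule no_polynomial_solution[OF a _ triv' swap])
      show "- m \<noteq> 0" using m by simp
      show "Y 0 \<noteq> 0 \<or> X 0 \<noteq> 0" using Y0 by simp
      show "fc (of_int j) X = 0" if "1 \<le> j" for j using Xz[OF that] s1 by simp
      show "fc (of_int j) Y = 0" if "j < 0" for j using Yz[of "- j"] that s1 by simp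
    qed
  qed
qed

lemma fc_wave_comb:
  assumes "lin_sol a l m P Q" "lin_sol a l m P' Q'"
  shows "fc k (wave l m (\<lambda>t. x * P t + y * P' t)) = x * fc k (wave l m P) + y * fc k (wave l m P')"
proof -
  have "fc k (wave l m (\<lambda>t. x * P t + y * P' t)) = fc k (\<lambda>t. x * wave l m P t + y * wave l m P' t)"
    by (rule fc_cong) (simp add: wave_def algebra_simps)
  also have "\<dots> = x * fc k (wave l m P) + y * fc k (wave l m P')"
    by (subst fc_add) (auto simp only: fc_cmult intro!: continuous_intros wave_continuous[OF assms(1)] wave_continuous[OF assms(2)])
  finally show ?thesis .
qed

lemma fc_wave_lipschitz:
  assumes c: "continuous_on {0..2*pi} (wave l m F)" "continuous_on {0..2*pi} (wave l m0 F0)"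
    and d: "\<And>t. t \<in> {0..2*pi} \<Longrightarrow> norm (F t - F0 t) \<le> K * \<bar>m - m0\<bar>"
    and M: "\<And>t. t \<in> {0..2*pi} \<Longrightarrow> norm (F0 t) \<le> M"
  shows "norm (fc k (wave l m F) - fc k (wave l m0 F0)) \<le> (K + 2 * M) * \<bar>m - m0\<bar>"
proof -
  have "norm (fc k (\<lambda>t. wave l m F t - wave l m0 F0 t)) \<le> (K + 2 * M) * \<bar>m - m0\<bar>"
  proof (rule fc_bound)
    show "continuous_on {0..2*pi} (\<lambda>t. wave l m F t - wave l m0 F0 t)" by (intro continuous_intros c)
    fix t :: real assume t: "t \<in> {0..2*pi}"
    have "wave l m F t - wave l m0 F0 t = hh l m t * (F t - F0 t) + (hh l m t - hh l m0 t) * F0 t"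
      by (simp add: wave_def algebra_simps)
    also have "norm \<dots> \<le> norm (F t - F0 t) + norm (hh l m t - hh l m0 t) * norm (F0 t)"
      by (rule order_trans[OF norm_triangle_ineq]) (simp add: norm_mult)
    also have "\<dots> \<le> K * \<bar>m - m0\<bar> + (2 * \<bar>m - m0\<bar>) * M"
      by (intro add_mono mult_mono d t M norm_hh_diff_le) auto
    finally show "norm (wave l m F t - wave l m0 F0 t) \<le> (K + 2 * M) * \<bar>m - m0\<bar>"
      by (simp add: algebra_simps)
  qed
  then show ?thesis by (simp only: fc_diff[OF c])
qed

text \<open>Near trivial monodromy the monodromy matrix minus identity is, to first order in its own size, a
  multiple of one fixed matrix, determined by the one-sided solutions at \<open>m0\<close>.\<close>

lemma resonance_relation:
  assumes a: "a > 0" and m0: "m0 \<noteq> 0" and triv: "trivial_mon a L m0"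
  shows "\<exists>v1 v2 w1 w2 C d. d > 0 \<and> C \<ge> 0 \<and> v1 \<noteq> \<i> * v2 \<and> v1 \<noteq> - \<i> * v2 \<and> w1 \<noteq> \<i> * w2 \<and> w1 \<noteq> - \<i> * w2 \<and>
    (\<forall>m. \<bar>m - m0\<bar> < d \<longrightarrow>
      norm (\<i> * of_real (Im (mona a (of_int L) m)) * (w1 * v1 - w2 * v2) + of_real (monb a (of_int L) m) * (w1 * v2 + w2 * v1))
      \<le> C * \<bar>m - m0\<bar> * (\<bar>Im (mona a (of_int L) m)\<bar> + \<bar>monb a (of_int L) m\<bar>))"
proof -
  have a0: "a \<ge> 0" using a by simp
  define l where "l = real_of_int L"
  define P P' Q Q' where "P m = fundP a l m" and "P' m t = cnj (fundQ a l m t)"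
    and "Q m = fundQ a l m" and "Q' m t = cnj (fundP a l m t)" for m t
  have lin: "lin_sol a l m (P m) (Q m)" "lin_sol a l m (P' m) (Q' m)" for m
    using fund(1)[OF a0] lin_sol_cnj[OF fund(1)[OF a0]] by (simp_all add: P_def Q_def P'_def[abs_def] Q'_def[abs_def])
  have init: "P m 0 = 1" "Q m 0 = 0" "P' m 0 = 0" "Q' m 0 = 1" for m
    using fund(2,3)[OF a0, of l m] by (simp_all add: P_def Q_def P'_def Q'_def)
  define M where "M = exp (2 * pi * a)"
  have M: "norm (P m t) \<le> M" "norm (P' m t) \<le> M" if "t \<in> {0..2*pi}" for m t
  proof -
    have "exp (a * \<bar>t\<bar>) \<le> M" using that a0 by (auto simp: M_def mult.commute[of _ a] intro!: mult_left_mono)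
    then show "norm (P m t) \<le> M" "norm (P' m t) \<le> M"
      using fund(4,5)[OF a0, of l m t] by (simp_all add: P_def P'_def)
  qed
  have M0: "M \<ge> 0" by (simp add: M_def)
  define Lp where "Lp = lipC a"
  have Lp0: "Lp \<ge> 0" using a0 by (simp add: Lp_def lipC_def)
  have lip: "norm (P m t - P m' t) \<le> Lp * \<bar>m - m'\<bar>" "norm (Q m t - Q m' t) \<le> Lp * \<bar>m - m'\<bar>"
    "norm (P' m t - P' m' t) \<le> Lp * \<bar>m - m'\<bar>" if "t \<in> {0..2*pi}" for m m' t
  proof -
    have b: "norm (fundP a l m t - fundP a l m' t) \<le> Lp * \<bar>m - m'\<bar>" "norm (fundQ a l m t - fundQ a l m' t) \<le> Lp * \<bar>m - m'\<bar>"
      using fund_lipschitz[OF a0, of t l m m'] that by (simp_all add: Lp_def)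
    then show "norm (P m t - P m' t) \<le> Lp * \<bar>m - m'\<bar>" "norm (Q m t - Q m' t) \<le> Lp * \<bar>m - m'\<bar>"
      by (simp_all add: P_def Q_def)
    have "norm (P' m t - P' m' t) = norm (cnj (fundQ a l m t - fundQ a l m' t))" by (simp add: P'_def)
    then show "norm (P' m t - P' m' t) \<le> Lp * \<bar>m - m'\<bar>" using b(2) by (simp only: complex_mod_cnj)
  qed
  define Lx where "Lx = Lp + 2 * M"
  \<comment> \<open>Crossing the two coefficients at frequency 1 yields a combination without such a
    coefficient, whose initial vector is Lipschitz in \<open>m\<close>.\<close>
  define x1 x2 where "x1 m = fc 1 (wave l m (P' m))" and "x2 m = - fc 1 (wave l m (P m))" for m
  have xlip: "norm (x1 m - x1 m0) \<le> Lx * \<bar>m - m0\<bar>" "norm (x2 m - x2 m0) \<le> Lx * \<bar>m - m0\<bar>" for m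
  proof -
    show "norm (x1 m - x1 m0) \<le> Lx * \<bar>m - m0\<bar>"
      unfolding x1_def Lx_def
      by (rule fc_wave_lipschitz[OF wave_continuous[OF lin(2)] wave_continuous[OF lin(2)] lip(3) M(2)])
    have "norm (fc 1 (wave l m (P m)) - fc 1 (wave l m0 (P m0))) \<le> Lx * \<bar>m - m0\<bar>"
      unfolding Lx_def
      by (rule fc_wave_lipschitz[OF wave_continuous[OF lin(1)] wave_continuous[OF lin(1)] lip(1) M(1)])
    then show "norm (x2 m - x2 m0) \<le> Lx * \<bar>m - m0\<bar>"
      unfolding x2_def by (metis minus_diff_minus norm_minus_cancel)
  qed
  have xb: "norm (x1 m) \<le> M" "norm (x2 m) \<le> M" for m
  proof -
    have "norm (fc 1 (wave l m (P' m))) \<le> M" "norm (fc 1 (wave l m (P m))) \<le> M"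
      using M by (auto intro!: fc_bound wave_continuous[OF lin(1)] wave_continuous[OF lin(2)] simp: wave_def norm_mult)
    then show "norm (x1 m) \<le> M" "norm (x2 m) \<le> M" by (simp_all add: x1_def x2_def)
  qed
  define X Y where "X m t = x1 m * P m t + x2 m * P' m t" and "Y m t = x1 m * Q m t + x2 m * Q' m t" for m t
  have XY: "lin_sol a l m (X m) (Y m)" for m
    unfolding X_def[abs_def] Y_def[abs_def] by (rule lin_sol_comb[OF lin])
  have XY0: "X m 0 = x1 m" "Y m 0 = x2 m" for m by (simp_all add: X_def Y_def init)
  have r1: "fc 1 (wave l m (X m)) = 0" for m
    unfolding X_def[abs_def] fc_wave_comb[OF lin] by (simp add: x1_def x2_def)
  \<comment> \<open>The one-sided solution at \<open>m0\<close>: a zero at frequency -1 leaves only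
    positive frequencies in its \<open>wave\<close>.\<close>
  obtain w1 w2 where w: "w1 \<noteq> 0 \<or> w2 \<noteq> 0"
    and wz: "w1 * fc (-1) (wave l m0 (P m0)) + w2 * fc (-1) (wave l m0 (P' m0)) = 0"
    using exists_kernel_pair[of "fc (-1) (wave l m0 (P m0))" 0 0 "fc (-1) (wave l m0 (P' m0))"] by auto
  define W V where "W t = w1 * P m0 t + w2 * P' m0 t" and "V t = w1 * Q m0 t + w2 * Q' m0 t" for t
  have WV: "lin_sol a l m0 W V"
    unfolding W_def[abs_def] V_def[abs_def] by (rule lin_sol_comb[OF lin])
  have WV0: "W 0 = w1" "V 0 = w2" by (simp_all add: W_def V_def init)
  have rm1: "fc (-1) (wave l m0 W) = 0"
    unfolding W_def[abs_def] fc_wave_comb[OF lin] by (rule wz)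
  have perW: "periodic_sol a L m0 W V" using trivial_mon_sol[OF triv] WV by (simp add: l_def)
  have perWV: "W (2 * pi) = W 0" "V (2 * pi) = V 0" using perW by (simp_all add: periodic_sol_def)
  have W_neg: "fc (of_int k) (wave l m0 W) = 0" if "k \<le> 0" for k
    using one_sided_coefficients[OF a m0 perW, of "-1" "nat (- k)"] rm1 that by (simp add: l_def)
  \<comment> \<open>If every solution at \<open>m0\<close> lacked the coefficient at frequency 1,
    then \<open>W\<close> would have no coefficients on either side.\<close>
  have x_nz: "x1 m0 \<noteq> 0 \<or> x2 m0 \<noteq> 0"
  proof (rule ccontr)
    assume "\<not> (x1 m0 \<noteq> 0 \<or> x2 m0 \<noteq> 0)"
    then have "fc 1 (wave l m0 W) = 0"
      unfolding W_def[abs_def] fc_wave_comb[OF lin] by (simp add: x1_def x2_def)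
    then have pos: "fc (of_int k) (wave l m0 W) = 0" if "k \<ge> 0" for k
      using one_sided_coefficients[OF a m0 perW, of 1 "nat k"] that by (simp add: l_def)
    have "fc (of_int k) (wave (of_int L) m0 W) = 0" for k
      using pos[of k] W_neg[of k] by (cases "k \<ge> 0") (simp_all add: l_def)
    from zero_coefficients_zero[OF a perW this] show False using w by (simp add: WV0)
  qed
  have niso_v: "x1 m0 \<noteq> \<sigma> * \<i> * x2 m0" if "\<sigma> = 1 \<or> \<sigma> = (-1::complex)" for \<sigma>
    using not_isotropic[OF a m0 triv XY[of m0, unfolded l_def] _ _ _ that, of 1] x_nz r1[of m0] by (simp add: XY0 l_def)
  have niso_w: "w1 \<noteq> \<sigma> * \<i> * w2" if "\<sigma> = 1 \<or> \<sigma> = (-1::complex)" for \<sigma>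
    using not_isotropic[OF a m0 triv WV[unfolded l_def] _ _ _ that, of "-1"] w rm1 by (simp add: WV0 l_def)
  define \<rho> where "\<rho> k = fc (real k) (wave l m0 W)" for k :: nat
  define q where "q k = fc (real k) V" for k :: nat
  have \<rho>0: "\<rho> 0 = 0" using W_neg[of 0] by (simp add: \<rho>_def)
  have \<rho>sum: "summable (\<lambda>k. norm (\<rho> k))" and qsum: "summable (\<lambda>k. norm (q k))"
    using wave_summable[OF perW] by (simp_all add: \<rho>_def q_def l_def)
  have JW: "(W (2 * pi) - W 0) / (2 * pi) = 0" "(V (2 * pi) - V 0) / (2 * pi) = 0" by (simp_all add: perWV)
  have \<rho>rec: "of_real (real (Suc k) - of_int L + a\<^sup>2 / real (Suc k)) * \<rho> (Suc k) = of_real m0 * (\<rho> k + \<rho> (k + 2))" for k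
    using three_term_with_jump[OF WV[unfolded l_def], of "int (Suc k)"]
    by (simp add: perWV \<rho>_def l_def add.commute)
  have \<rho>q: "of_real a * \<rho> k = \<i> * of_real (real k) * q k" for k
    using jump_recurrence(1)[OF WV[unfolded l_def], of "int k"] by (simp add: perWV \<rho>_def q_def l_def)
  \<comment> \<open>The equation at frequency 0, where the coefficients of \<open>wave\<close> at 0
    and -1 vanish. It rewrites the boundary term of Green's formula.\<close>
  have q0: "of_real m0 * \<rho> 1 = \<i> * of_real a * q 0"
  proof -
    have "0 = \<i> * of_real m0 * \<rho> 1 + of_real a * q 0"
      using jump_recurrence(2)[OF WV[unfolded l_def], of 0] W_neg[of 0] W_neg[of "-1"]
      by (simp add: perWV \<rho>_def q_def l_def)
    then have "(- \<i>) * 0 = (- \<i>) * (\<i> * of_real m0 * \<rho> 1 + of_real a * q 0)" by (rule arg_cong)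
    then show ?thesis by (simp add: algebra_simps)
  qed
  have V_neg: "fc (of_int j) V = 0" if "j < 0" for j
  proof -
    have "\<i> * of_int j * fc (of_int j) V = 0"
      using jump_recurrence(1)[OF WV[unfolded l_def], of j] W_neg[of j] that by (simp add: perWV l_def)
    then show ?thesis using that by simp
  qed
  have "(\<lambda>k. \<rho> k * cis (real k * 0)) sums wave l m0 W 0"
    by (rule fourier_series_nonneg[OF wave_continuous[OF WV] _ _ \<rho>sum])
       (use W_neg perWV in \<open>simp_all add: \<rho>_def l_def\<close>)
  then have "\<rho> sums w1" by (simp add: WV0)
  then have \<rho>S: "(\<lambda>k. \<rho> (Suc k)) sums w1" using sums_Suc_iff[of \<rho> "w1"] \<rho>0 by simp
  have "(\<lambda>k. q k * cis (real k * 0)) sums V 0"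
    by (rule fourier_series_nonneg[OF lin_sol_continuous(2)[OF WV] perWV(2) _ qsum V_neg])
       (simp_all add: q_def)
  then have "q sums w2" by (simp add: WV0)
  then have qS: "(\<lambda>k. q (Suc k)) sums (w2 - q 0)" using sums_Suc_iff[of q "w2 - q 0"] by simp
  obtain C1 where C1: "C1 \<ge> 0" "\<And>m r JX JY. \<bar>m0\<bar> / 2 \<le> \<bar>m\<bar> \<Longrightarrow> \<bar>m\<bar> \<le> 2 * \<bar>m0\<bar> \<Longrightarrow> jump_seq a L m r JX JY \<Longrightarrow>
      \<exists>B. \<forall>k. norm (r k) \<le> B \<Longrightarrow> \<forall>k. norm (r k) \<le> C1 * (norm JX + norm JY)"
    using jump_seq_bound[OF a, of "\<bar>m0\<bar> / 2" "2 * \<bar>m0\<bar>" L] m0 by (auto simp del: norm_ii)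
  define S where "S = (\<Sum>k. norm (\<rho> k))"
  have S0: "S \<ge> 0" unfolding S_def by (rule suminf_nonneg[OF \<rho>sum]) simp
  define Wn where "Wn = norm w1 + norm w2"
  have Wn0: "Wn \<ge> 0" by (simp add: Wn_def)
  \<comment> \<open>Three errors, in this order: Green's formula, the second order deviation
    \<open>\<xi>\<close> of the diagonal, and the change of \<open>(x1, x2)\<close> between
    \<open>m\<close> and \<open>m0\<close>.\<close>
  define C where "C = 2 * pi * (2 * (C1 * (4 * M)) * S) + 2 * Lp * (M * Wn) + Wn * Lx"
  have Lx0: "Lx \<ge> 0" using Lp0 M0 by (simp add: Lx_def)
  have C0: "C \<ge> 0" unfolding C_def using C1(1) M0 S0 Lp0 Wn0 Lx0 by (intro add_nonneg_nonneg mult_nonneg_nonneg) auto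
  \<comment> \<open>The first bound gives \<open>Lp * \<bar>m - m0\<bar> \<le> 1 / 2\<close>, which
    keeps \<open>2 + \<xi>\<close> above 1. The second keeps |m| between half and twice |m0|, the
    range chosen for \<open>jump_seq_bound\<close>.\<close>
  define d where "d = min (1 / (2 * Lp + 1)) (\<bar>m0\<bar> / 2)"
  have d0: "d > 0" using Lp0 m0 by (simp add: d_def)
  define e0 where "e0 = cos (pi * l)"
  have sin0: "sin (pi * l) = 0" unfolding sin_zero_iff_int2 l_def by (metis mult.commute)
  have e0: "e0 * e0 = 1" using sin_cos_squared_add[of "pi * l"] by (simp add: e0_def sin0 power2_eq_square)
  have cis0: "cis (pi * l) = of_real e0" "cis (- (pi * l)) = of_real e0"
    by (simp_all add: complex_eq_iff e0_def sin0)
  have e0C: "of_real e0 * of_real e0 = (1::complex)" unfolding of_real_mult[symmetric] e0 by simp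
  have e0abs: "\<bar>e0\<bar> = 1" using e0 by (metis abs_mult abs_one abs_mult_self_eq power2_eq_square abs_square_eq_1)
  have per0: "periodic_sol a L m0 (P m0) (Q m0)" using trivial_mon_sol[OF triv] lin(1)[of m0] by (simp add: l_def)
  have mona0: "mona a l m0 = of_real e0" and monb0: "monb a l m0 = 0"
    using per0 init[of m0] by (simp_all add: mona_def monb_def cis0 periodic_sol_def P_def Q_def)
  have main: "norm (\<i> * of_real (Im (mona a l m)) * (w1 * x1 m0 - w2 * x2 m0) + of_real (monb a l m) * (w1 * x2 m0 + w2 * x1 m0))
      \<le> C * \<bar>m - m0\<bar> * (\<bar>Im (mona a l m)\<bar> + \<bar>monb a l m\<bar>)" if m: "\<bar>m - m0\<bar> < d" for m
  proof -
    define \<eta> b where "\<eta> = Im (mona a l m)" and "b = monb a l m"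
    define N where "N = \<bar>\<eta>\<bar> + \<bar>b\<bar>"
    \<comment> \<open>Real part of the deviation of the diagonal from 1 after removal of the sign
      \<open>e0\<close>. The determinant gives
      \<open>\<xi> * (2 + \<xi>) = b\<^sup>2 - \<eta>\<^sup>2\<close>, so it is of second order and
      the jumps are linear in \<open>\<eta>\<close> and \<open>b\<close> up to smaller
      terms.\<close>
    define \<xi> where "\<xi> = e0 * Re (mona a l m) - 1"
    define dm where "dm = \<bar>m - m0\<bar>"
    have dm0: "dm \<ge> 0" by (simp add: dm_def)
    have N0: "N \<ge> 0" by (simp add: N_def)
    have tpi: "2 * pi \<in> {0..2*pi}" by simp
    have dal: "norm (mona a l m - mona a l m0) \<le> Lp * dm"
      using lip(1)[OF tpi, of m m0] unfolding mona_def dm_def P_def right_diff_distrib[symmetric] by (simp add: norm_mult)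
    have db: "\<bar>b\<bar> \<le> Lp * dm"
    proof -
      have "b = Re (cis (- (pi * l)) * (Q m (2 * pi) - Q m0 (2 * pi)))"
        using monb0 by (simp add: b_def monb_def Q_def right_diff_distrib)
      then have "\<bar>b\<bar> \<le> norm (cis (- (pi * l)) * (Q m (2 * pi) - Q m0 (2 * pi)))"
        by (simp only: abs_Re_le_cmod)
      then show ?thesis using lip(2)[OF tpi, of m m0] by (simp add: norm_mult dm_def)
    qed
    have d\<eta>: "\<bar>\<eta>\<bar> \<le> Lp * dm"
      using abs_Im_le_cmod[of "mona a l m - mona a l m0"] dal by (simp add: mona0 \<eta>_def)
    have d\<xi>: "\<bar>\<xi>\<bar> \<le> Lp * dm"
    proof -
      have "\<xi> = e0 * Re (mona a l m - mona a l m0)"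
        by (simp add: \<xi>_def mona0 right_diff_distrib e0)
      then have "\<bar>\<xi>\<bar> = \<bar>Re (mona a l m - mona a l m0)\<bar>" by (simp only: abs_mult e0abs mult_1_left)
      then show ?thesis using abs_Re_le_cmod[of "mona a l m - mona a l m0"] dal by linarith
    qed
    have half: "Lp * dm \<le> 1 / 2"
    proof -
      have "dm \<le> 1 / (2 * Lp + 1)" using m by (simp add: d_def dm_def)
      then have "(2 * Lp + 1) * dm \<le> 1" using Lp0 by (simp add: field_simps)
      then show ?thesis using dm0 by (simp add: algebra_simps)
    qed
    have NL: "N \<le> 2 * Lp * dm" using db d\<eta> by (simp add: N_def)
    have N1: "N \<le> 1" using NL half by simp
    have "(1 + \<xi>)\<^sup>2 + \<eta>\<^sup>2 - b\<^sup>2 = 1"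
    proof -
      have "(1 + \<xi>)\<^sup>2 = (e0 * e0) * (Re (mona a l m))\<^sup>2" by (simp add: \<xi>_def power2_eq_square)
      then show ?thesis
        using monodromy_det[OF a0, of l m] by (simp add: e0 cmod_power2 \<eta>_def b_def)
    qed
    then have "\<xi> * (2 + \<xi>) = b\<^sup>2 - \<eta>\<^sup>2" by (simp add: power2_eq_square algebra_simps)
    then have "\<bar>\<xi>\<bar> * \<bar>2 + \<xi>\<bar> = \<bar>b\<^sup>2 - \<eta>\<^sup>2\<bar>" by (simp only: abs_mult[symmetric])
    moreover have "\<bar>\<xi>\<bar> * 1 \<le> \<bar>\<xi>\<bar> * \<bar>2 + \<xi>\<bar>"
      using d\<xi> half by (intro mult_left_mono) linarith+
    moreover have "\<bar>b\<^sup>2 - \<eta>\<^sup>2\<bar> \<le> N * N"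
    proof -
      have "\<bar>b\<^sup>2 - \<eta>\<^sup>2\<bar> \<le> \<bar>b\<bar> * \<bar>b\<bar> + \<bar>\<eta>\<bar> * \<bar>\<eta>\<bar>"
        using abs_triangle_ineq4[of "b\<^sup>2" "\<eta>\<^sup>2"] by (simp add: power2_eq_square)
      also have "\<dots> \<le> N * N" by (simp add: N_def algebra_simps)
      finally show ?thesis .
    qed
    ultimately have \<xi>N: "\<bar>\<xi>\<bar> \<le> N * N" by linarith
    have \<xi>N1: "\<bar>\<xi>\<bar> \<le> N" using \<xi>N mult_left_mono[OF N1 N0] by simp
    have \<xi>N2: "\<bar>\<xi>\<bar> \<le> N * (2 * Lp * dm)" using \<xi>N mult_left_mono[OF NL N0] by simp
    define JX JY where "JX = (X m (2 * pi) - X m 0) / (2 * pi)" and "JY = (Y m (2 * pi) - Y m 0) / (2 * pi)"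
    have al: "mona a l m = of_real (Re (mona a l m)) + \<i> * of_real \<eta>" by (simp add: complex_eq_iff \<eta>_def)
    have al1: "of_real e0 * mona a l m = 1 + of_real \<xi> + \<i> * of_real e0 * of_real \<eta>"
      by (subst al) (simp add: \<xi>_def algebra_simps)
    have al2: "of_real e0 * cnj (mona a l m) = 1 + of_real \<xi> - \<i> * of_real e0 * of_real \<eta>"
      using arg_cong[OF al1, of cnj] by simp
    have X2: "X m (2 * pi) = of_real e0 * (mona a l m * x1 m + of_real b * x2 m)"
    proof -
      have "of_real e0 * X m (2 * pi) = mona a l m * x1 m + of_real b * x2 m"
        using lin_sol_monodromy(1)[OF a0 XY[of m]] by (simp add: cis0 XY0 b_def)
      then have "of_real e0 * (of_real e0 * X m (2 * pi)) = of_real e0 * (mona a l m * x1 m + of_real b * x2 m)" by simp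
      then show ?thesis by (simp only: mult.assoc[symmetric] e0C mult_1_left)
    qed
    have Y2: "Y m (2 * pi) = of_real e0 * (of_real b * x1 m + cnj (mona a l m) * x2 m)"
    proof -
      have "of_real e0 * Y m (2 * pi) = of_real b * x1 m + cnj (mona a l m) * x2 m"
        using lin_sol_monodromy(2)[OF a0 XY[of m]] by (simp add: cis0 XY0 b_def)
      then have "of_real e0 * (of_real e0 * Y m (2 * pi)) = of_real e0 * (of_real b * x1 m + cnj (mona a l m) * x2 m)" by simp
      then show ?thesis by (simp only: mult.assoc[symmetric] e0C mult_1_left)
    qed
    have JX: "2 * pi * JX = of_real \<xi> * x1 m + of_real e0 * (\<i> * of_real \<eta> * x1 m + of_real b * x2 m)"
    proof -
      have "2 * pi * JX = (of_real e0 * mona a l m) * x1 m + of_real e0 * (of_real b * x2 m) - x1 m"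
      proof -
        have "2 * pi * JX = X m (2 * pi) - x1 m" by (simp add: JX_def XY0)
        then show ?thesis unfolding X2 by (simp add: algebra_simps)
      qed
      then show ?thesis unfolding al1 by (simp add: algebra_simps)
    qed
    have JY: "2 * pi * JY = of_real \<xi> * x2 m + of_real e0 * (of_real b * x1 m - \<i> * of_real \<eta> * x2 m)"
    proof -
      have "2 * pi * JY = (of_real e0 * cnj (mona a l m)) * x2 m + of_real e0 * (of_real b * x1 m) - x2 m"
      proof -
        have "2 * pi * JY = Y m (2 * pi) - x2 m" by (simp add: JY_def XY0)
        then show ?thesis unfolding Y2 by (simp add: algebra_simps)
      qed
      then show ?thesis unfolding al2 by (simp add: algebra_simps)
    qed
    have small: "norm J \<le> 2 * M * N"
      if "2 * pi * J = of_real \<xi> * u + of_real e0 * (z1 + z2)" "norm u \<le> M" "norm z1 \<le> \<bar>\<eta>\<bar> * M" "norm z2 \<le> \<bar>b\<bar> * M" for J u z1 z2 :: complex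
    proof -
      have "norm (2 * pi * J) \<le> norm (of_real \<xi> * u) + norm (of_real e0 * (z1 + z2))"
        unfolding that(1) by (rule norm_triangle_ineq)
      also have "\<dots> = \<bar>\<xi>\<bar> * norm u + norm (z1 + z2)" by (simp add: norm_mult e0abs)
      also have "\<dots> \<le> N * M + (\<bar>\<eta>\<bar> * M + \<bar>b\<bar> * M)"
        using \<xi>N1 that(2-4) N0 by (intro add_mono mult_mono order_trans[OF norm_triangle_ineq add_mono]) auto
      also have "\<dots> = 2 * M * N" by (simp add: N_def algebra_simps)
      finally have "2 * pi * norm J \<le> 2 * M * N" by (simp add: norm_mult)
      moreover have "1 * norm J \<le> 2 * pi * norm J" using pi_gt3 by (intro mult_right_mono) auto
      ultimately show ?thesis by simp
    qed
    have nJX: "norm JX \<le> 2 * M * N"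
      by (rule small[OF JX xb(1)]) (auto simp: norm_mult intro!: mult_left_mono xb)
    have nJY: "norm JY \<le> 2 * M * N"
    proof (rule small)
      show "2 * pi * JY = of_real \<xi> * x2 m + of_real e0 * (- (\<i> * of_real \<eta> * x2 m) + of_real b * x1 m)"
        unfolding JY by simp
    qed (auto simp: norm_mult intro!: mult_left_mono xb)
    define r where "r k = fc (real k) (wave l m (X m))" for k :: nat
    have js: "jump_seq a L m r JX JY"
      unfolding jump_seq_def
    proof (intro conjI allI)
      show "of_real a * r 0 = JY"
        using jump_recurrence(1)[OF XY[of m, unfolded l_def], of 0] by (simp add: r_def JY_def l_def)
      show "r 1 = 0" using r1[of m] by (simp add: r_def)
      show "of_real (real (Suc k) - of_int L + a\<^sup>2 / real (Suc k)) * r (Suc k) - of_real m * (r k + r (k + 2))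
        = \<i> * JX + of_real (a / real (Suc k)) * JY" for k
        using three_term_with_jump[OF XY[of m, unfolded l_def], of "int (Suc k)"]
        by (simp add: r_def JX_def JY_def l_def add.commute)
    qed
    have rB: "\<exists>B. \<forall>k. norm (r k) \<le> B"
    proof -
      obtain B where "\<And>t. t \<in> {0..2*pi} \<Longrightarrow> norm (wave l m (X m) t) \<le> B"
        using continuous_on_Icc_bounded[OF wave_continuous[OF XY[of m]]] by blast
      then have "\<forall>k. norm (r k) \<le> B"
        unfolding r_def by (intro allI fc_bound wave_continuous[OF XY[of m]])
      then show ?thesis by blast
    qed
    have mm: "\<bar>m0\<bar> / 2 \<le> \<bar>m\<bar>" "\<bar>m\<bar> \<le> 2 * \<bar>m0\<bar>"
    proof -
      have *: "\<bar>m - m0\<bar> * 2 < \<bar>m0\<bar>" using m by (simp add: d_def)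
      have t1: "\<bar>m0\<bar> \<le> \<bar>m\<bar> + \<bar>m - m0\<bar>" using abs_triangle_ineq4[of m "m - m0"] by simp
      have t2: "\<bar>m\<bar> \<le> \<bar>m0\<bar> + \<bar>m - m0\<bar>" using abs_triangle_ineq[of m0 "m - m0"] by simp
      show "\<bar>m0\<bar> / 2 \<le> \<bar>m\<bar>" "\<bar>m\<bar> \<le> 2 * \<bar>m0\<bar>" using * t1 t2 by simp_all
    qed
    have rb: "norm (r k) \<le> C1 * (4 * M * N)" for k
    proof -
      have "norm (r k) \<le> C1 * (norm JX + norm JY)" using C1(2)[OF mm js rB] by blast
      also have "\<dots> \<le> C1 * (4 * M * N)" using nJX nJY C1(1) by (intro mult_left_mono) auto
      finally show ?thesis .
    qed
    define g where "g k = \<i> * JX + of_real (a / real k) * JY" for k :: nat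
    \<comment> \<open>Because \<open>a * \<rho> k / k = \<i> * q k\<close>, the terms with the jump
      of \<open>Y\<close> sum to the value \<open>w2\<close> of \<open>V\<close> at 0 without its
      mean \<open>q 0\<close>.\<close>
    define G where "G = \<i> * JX * w1 + \<i> * JY * (w2 - q 0)"
    have gs: "(\<lambda>k. \<rho> (Suc k) * g (Suc k)) sums G"
    proof -
      have "\<rho> (Suc k) * g (Suc k) = \<i> * JX * \<rho> (Suc k) + \<i> * JY * q (Suc k)" for k
      proof -
        have "of_real (a / real (Suc k)) * \<rho> (Suc k) = (of_real a * \<rho> (Suc k)) / of_real (real (Suc k))"
          by (simp only: of_real_divide times_divide_eq_left)
        also have "\<dots> = \<i> * q (Suc k)" unfolding \<rho>q by (simp del: of_nat_Suc)
        finally have "of_real (a / real (Suc k)) * \<rho> (Suc k) = \<i> * q (Suc k)" .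
        then have "\<rho> (Suc k) * g (Suc k) = \<i> * JX * \<rho> (Suc k) + (\<i> * q (Suc k)) * JY"
          unfolding g_def by (metis distrib_left mult.assoc mult.commute)
        then show ?thesis by (simp only: mult_ac)
      qed
      then show ?thesis unfolding G_def by (simp only:) (intro sums_add sums_mult \<rho>S qS)
    qed
    have "norm (G + of_real m0 * \<rho> 1 * r 0) \<le> \<bar>m - m0\<bar> * (2 * (C1 * (4 * M * N)) * (\<Sum>k. norm (\<rho> k)))"
    proof (rule green_estimate[OF \<rho>0 \<rho>rec _ rb \<rho>sum gs])
      show "of_real (real (Suc k) - of_int L + a\<^sup>2 / real (Suc k)) * r (Suc k) - of_real m * (r k + r (k + 2)) = g (Suc k)" for k
        using js unfolding jump_seq_def g_def by blast
    qed
    \<comment> \<open>The boundary term supplies exactly the missing mean \<open>q 0\<close>,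
      leaving the pairing of the jump with the initial vector of \<open>(W, V)\<close>.\<close>
    moreover have "G + of_real m0 * \<rho> 1 * r 0 = \<i> * (JX * w1 + JY * w2)"
    proof -
      have "of_real m0 * \<rho> 1 * r 0 = \<i> * q 0 * (of_real a * r 0)" unfolding q0 by (simp only: mult_ac)
      also have "of_real a * r 0 = JY" using js by (simp add: jump_seq_def)
      finally show ?thesis by (simp add: G_def algebra_simps)
    qed
    ultimately have gJ: "norm (JX * w1 + JY * w2) \<le> dm * (2 * (C1 * (4 * M * N)) * S)"
      by (simp add: norm_mult dm_def S_def)
    \<comment> \<open>Multiplied by \<open>e0\<close>, this is the part of
      \<open>2 * pi * (JX * w1 + JY * w2)\<close> that is of first order in \<open>\<eta>\<close>
      and \<open>b\<close>.\<close>
    define E where "E y1 y2 = \<i> * of_real \<eta> * (w1 * y1 - w2 * y2) + of_real b * (w1 * y2 + w2 * y1)" for y1 y2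
    have "2 * pi * (JX * w1 + JY * w2) = (2 * pi * JX) * w1 + (2 * pi * JY) * w2" by (simp add: algebra_simps)
    also have "\<dots> = of_real \<xi> * (x1 m * w1 + x2 m * w2) + of_real e0 * E (x1 m) (x2 m)"
      unfolding JX JY E_def by (simp add: algebra_simps)
    finally have "of_real e0 * E (x1 m) (x2 m) = 2 * pi * (JX * w1 + JY * w2) - of_real \<xi> * (x1 m * w1 + x2 m * w2)" by simp
    then have "norm (of_real e0 * E (x1 m) (x2 m)) \<le> norm (2 * pi * (JX * w1 + JY * w2)) + norm (of_real \<xi> * (x1 m * w1 + x2 m * w2))"
      by (simp only: norm_triangle_ineq4)
    then have "norm (E (x1 m) (x2 m)) \<le> 2 * pi * norm (JX * w1 + JY * w2) + \<bar>\<xi>\<bar> * norm (x1 m * w1 + x2 m * w2)"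
      by (simp add: norm_mult e0abs)
    also have "\<dots> \<le> 2 * pi * (dm * (2 * (C1 * (4 * M * N)) * S)) + (N * (2 * Lp * dm)) * (M * Wn)"
    proof (intro add_mono mult_mono gJ \<xi>N2)
      have "norm (x1 m * w1 + x2 m * w2) \<le> norm (x1 m) * norm w1 + norm (x2 m) * norm w2"
        by (rule order_trans[OF norm_triangle_ineq]) (simp add: norm_mult)
      also have "\<dots> \<le> M * norm w1 + M * norm w2" using xb[of m] by (intro add_mono mult_right_mono) auto
      finally show "norm (x1 m * w1 + x2 m * w2) \<le> M * Wn" by (simp add: Wn_def algebra_simps)
    qed (use N0 Lp0 dm0 in auto)
    finally have E1: "norm (E (x1 m) (x2 m)) \<le> 2 * pi * (dm * (2 * (C1 * (4 * M * N)) * S)) + (N * (2 * Lp * dm)) * (M * Wn)" .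
    have E2: "norm (E (x1 m) (x2 m) - E (x1 m0) (x2 m0)) \<le> N * (Wn * (Lx * dm))"
    proof -
      define y1 y2 where "y1 = x1 m - x1 m0" and "y2 = x2 m - x2 m0"
      have y: "norm y1 \<le> Lx * dm" "norm y2 \<le> Lx * dm" using xlip[of m] by (simp_all add: y1_def y2_def dm_def)
      have "E (x1 m) (x2 m) - E (x1 m0) (x2 m0) = E y1 y2" by (simp add: E_def y1_def y2_def algebra_simps)
      also have "norm (E y1 y2) \<le> \<bar>\<eta>\<bar> * norm (w1 * y1 - w2 * y2) + \<bar>b\<bar> * norm (w1 * y2 + w2 * y1)"
        unfolding E_def by (rule order_trans[OF norm_triangle_ineq]) (simp add: norm_mult)
      also have "\<dots> \<le> \<bar>\<eta>\<bar> * (Wn * (Lx * dm)) + \<bar>b\<bar> * (Wn * (Lx * dm))"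
      proof (intro add_mono mult_left_mono)
        have "norm (w1 * y1 - w2 * y2) \<le> norm w1 * norm y1 + norm w2 * norm y2"
          by (rule order_trans[OF norm_triangle_ineq4]) (simp add: norm_mult)
        also have "\<dots> \<le> norm w1 * (Lx * dm) + norm w2 * (Lx * dm)" using y by (intro add_mono mult_left_mono) auto
        finally show "norm (w1 * y1 - w2 * y2) \<le> Wn * (Lx * dm)" by (simp add: Wn_def algebra_simps)
        have "norm (w1 * y2 + w2 * y1) \<le> norm w1 * norm y2 + norm w2 * norm y1"
          by (rule order_trans[OF norm_triangle_ineq]) (simp add: norm_mult)
        also have "\<dots> \<le> norm w1 * (Lx * dm) + norm w2 * (Lx * dm)" using y by (intro add_mono mult_left_mono) auto
        finally show "norm (w1 * y2 + w2 * y1) \<le> Wn * (Lx * dm)" by (simp add: Wn_def algebra_simps)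
      qed auto
      finally show ?thesis by (simp add: N_def algebra_simps)
    qed
    have "norm (E (x1 m0) (x2 m0)) \<le> norm (E (x1 m) (x2 m)) + norm (E (x1 m) (x2 m) - E (x1 m0) (x2 m0))"
      using norm_triangle_ineq4[of "E (x1 m) (x2 m)" "E (x1 m) (x2 m) - E (x1 m0) (x2 m0)"] by simp
    also have "\<dots> \<le> C * dm * N"
      using E1 E2 by (simp add: C_def algebra_simps)
    finally show ?thesis by (simp only: E_def \<eta>_def b_def dm_def N_def)
  qed
  have "x1 m0 \<noteq> \<i> * x2 m0" "x1 m0 \<noteq> - \<i> * x2 m0" "w1 \<noteq> \<i> * w2" "w1 \<noteq> - \<i> * w2"
    using niso_v[of 1] niso_v[of "-1"] niso_w[of 1] niso_w[of "-1"] by simp_all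
  then show ?thesis using main d0 C0 unfolding l_def by blast
qed

text \<open>In the variables \<open>p = Im \<alpha> + \<beta>\<close> and
  \<open>q = Im \<alpha> - \<beta>\<close> the coefficients of the resonance relation factor into
  linear forms in the two initial vectors, and these are nonzero because neither vector is
  isotropic. The product \<open>p * q\<close> is the quantity whose sign is wanted.\<close>

lemma monodromy_sign_near:
  assumes a: "a > 0" and m0: "m0 \<noteq> 0" and b: "monb a l m0 = 0" and al: "Im (mona a l m0) = 0"
    and \<delta>0: "\<delta>0 > 0" "\<And>m. m \<noteq> m0 \<Longrightarrow> \<bar>m - m0\<bar> < \<delta>0 \<Longrightarrow> \<not> (monb a l m = 0 \<and> Im (mona a l m) = 0)"
  shows "\<exists>\<delta>>0. (\<forall>m. m \<noteq> m0 \<and> \<bar>m - m0\<bar> < \<delta> \<longrightarrow> \<bar>Im (mona a l m)\<bar> < \<bar>monb a l m\<bar>) \<or>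
     (\<forall>m. m \<noteq> m0 \<and> \<bar>m - m0\<bar> < \<delta> \<longrightarrow> \<bar>monb a l m\<bar> < \<bar>Im (mona a l m)\<bar>)"
proof -
  obtain L where L: "l = of_int L" "trivial_mon a L m0"
    using integer_of_trivial_monodromy[OF a m0 b al] by blast
  obtain v1 v2 w1 w2 C d where d: "d > 0" "C \<ge> 0" and nz: "v1 \<noteq> \<i> * v2" "v1 \<noteq> - \<i> * v2" "w1 \<noteq> \<i> * w2" "w1 \<noteq> - \<i> * w2"
    and rel: "\<And>m. \<bar>m - m0\<bar> < d \<Longrightarrow>
      norm (\<i> * of_real (Im (mona a l m)) * (w1 * v1 - w2 * v2) + of_real (monb a l m) * (w1 * v2 + w2 * v1))
      \<le> C * \<bar>m - m0\<bar> * (\<bar>Im (mona a l m)\<bar> + \<bar>monb a l m\<bar>)"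
    using resonance_relation[OF a m0 L(2)] unfolding L(1) by blast
  define c1 c2 where "c1 = \<i> * (w1 - \<i> * w2) * (v1 - \<i> * v2)" and "c2 = \<i> * (w1 + \<i> * w2) * (v1 + \<i> * v2)"
  have "c1 \<noteq> 0" "c2 \<noteq> 0"
    using nz by (auto simp: c1_def c2_def eq_neg_iff_add_eq_0)
  then obtain e where e: "e > 0" and dich:
    "(\<forall>p q::real. (p \<noteq> 0 \<or> q \<noteq> 0) \<and> norm (p * c1 + q * c2) \<le> e * (\<bar>p\<bar> + \<bar>q\<bar>) \<longrightarrow> p * q < 0) \<or>
     (\<forall>p q::real. (p \<noteq> 0 \<or> q \<noteq> 0) \<and> norm (p * c1 + q * c2) \<le> e * (\<bar>p\<bar> + \<bar>q\<bar>) \<longrightarrow> p * q > 0)"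
    using sign_dichotomy by metis
  \<comment> \<open>Passing to \<open>p\<close> and \<open>q\<close> doubles the relation, whence
    \<open>2 * C\<close>; adding 1 keeps the denominator positive.\<close>
  define \<delta> where "\<delta> = min (min \<delta>0 d) (e / (2 * C + 1))"
  have \<delta>: "\<delta> > 0" using \<delta>0 d e by (simp add: \<delta>_def)
  have key: "(p \<noteq> 0 \<or> q \<noteq> 0) \<and> norm (p * c1 + q * c2) \<le> e * (\<bar>p\<bar> + \<bar>q\<bar>)"
    if m: "m \<noteq> m0" "\<bar>m - m0\<bar> < \<delta>" and p: "p = Im (mona a l m) + monb a l m" and q: "q = Im (mona a l m) - monb a l m" for m p q
  proof
    define \<eta> b where "\<eta> = Im (mona a l m)" and "b = monb a l m"
    have pq: "p = \<eta> + b" "q = \<eta> - b" using p q by (simp_all add: \<eta>_def b_def)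
    show "p \<noteq> 0 \<or> q \<noteq> 0"
      using \<delta>0(2)[OF m(1)] m(2) by (auto simp: pq \<delta>_def \<eta>_def b_def)
    have N: "\<bar>\<eta>\<bar> + \<bar>b\<bar> \<le> \<bar>p\<bar> + \<bar>q\<bar>" unfolding pq by linarith
    have "p * c1 + q * c2 = 2 * (\<i> * of_real \<eta> * (w1 * v1 - w2 * v2) + of_real b * (w1 * v2 + w2 * v1))"
      by (simp add: pq c1_def c2_def algebra_simps)
    then have "norm (p * c1 + q * c2) = 2 * norm (\<i> * of_real \<eta> * (w1 * v1 - w2 * v2) + of_real b * (w1 * v2 + w2 * v1))"
      by (simp only: norm_mult norm_numeral)
    also have "\<dots> \<le> 2 * (C * \<bar>m - m0\<bar> * (\<bar>\<eta>\<bar> + \<bar>b\<bar>))"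
      using rel[of m] m(2) by (simp add: \<delta>_def \<eta>_def b_def)
    also have "\<dots> \<le> ((2 * C + 1) * \<bar>m - m0\<bar>) * (\<bar>\<eta>\<bar> + \<bar>b\<bar>)"
      by (simp add: algebra_simps)
    also have "\<dots> \<le> e * (\<bar>p\<bar> + \<bar>q\<bar>)"
    proof (intro mult_mono N)
      have "\<bar>m - m0\<bar> \<le> e / (2 * C + 1)" using m(2) by (simp add: \<delta>_def)
      then show "(2 * C + 1) * \<bar>m - m0\<bar> \<le> e" using d(2) by (simp add: field_simps)
    qed (use e in auto)
    finally show "norm (p * c1 + q * c2) \<le> e * (\<bar>p\<bar> + \<bar>q\<bar>)" .
  qed
  have sq: "(\<eta> + b) * (\<eta> - b) = \<bar>\<eta>\<bar>\<^sup>2 - \<bar>b\<bar>\<^sup>2" for \<eta> b :: real by (simp add: power2_eq_square algebra_simps)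
  have lt: "\<bar>x\<bar> < \<bar>y\<bar>" if "\<bar>x\<bar>\<^sup>2 < \<bar>y\<bar>\<^sup>2" for x y :: real
    using that by (rule power_less_imp_less_base) simp
  from dich show ?thesis
  proof
    assume *: "\<forall>p q::real. (p \<noteq> 0 \<or> q \<noteq> 0) \<and> norm (p * c1 + q * c2) \<le> e * (\<bar>p\<bar> + \<bar>q\<bar>) \<longrightarrow> p * q < 0"
    have "\<bar>Im (mona a l m)\<bar> < \<bar>monb a l m\<bar>" if "m \<noteq> m0" "\<bar>m - m0\<bar> < \<delta>" for m
    proof -
      have "(Im (mona a l m) + monb a l m) * (Im (mona a l m) - monb a l m) < 0"
        using * key[OF that refl refl] by blast
      then show ?thesis unfolding sq by (intro lt) simp
    qed
    then show ?thesis using \<delta> by blast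
  next
    assume *: "\<forall>p q::real. (p \<noteq> 0 \<or> q \<noteq> 0) \<and> norm (p * c1 + q * c2) \<le> e * (\<bar>p\<bar> + \<bar>q\<bar>) \<longrightarrow> p * q > 0"
    have "\<bar>monb a l m\<bar> < \<bar>Im (mona a l m)\<bar>" if "m \<noteq> m0" "\<bar>m - m0\<bar> < \<delta>" for m
    proof -
      have "(Im (mona a l m) + monb a l m) * (Im (mona a l m) - monb a l m) > 0"
        using * key[OF that refl refl] by blast
      then show ?thesis unfolding sq by (intro lt) simp
    qed
    then show ?thesis using \<delta> by blast
  qed
qed

theorem mainTheorem1:
  fixes \<omega> B0 A0 :: real
  assumes "\<omega> > 0"
    and "constriction \<omega> B0 A0"
  shows "\<exists>\<epsilon>>0.
           (\<exists>r. is_phase_lock_area \<omega> r \<and>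
              (\<forall>A\<in>{A0 - \<epsilon> .. A0 + \<epsilon>} - {A0}. (B0, A) \<in> interior (level_set \<omega> r)))
         \<or> (\<forall>A\<in>{A0 - \<epsilon> .. A0 + \<epsilon>} - {A0}. (B0, A) \<notin> phase_lock_union \<omega>)"
proof -
  interpret josephson \<omega> by unfold_locales (rule assms(1))
  obtain n \<epsilon> where A0: "A0 \<noteq> 0" and z: "be B0 A0 = 0" "Im (al B0 A0) = 0" and \<epsilon>: "\<epsilon> > 0"
    and lock: "is_phase_lock_area \<omega> (of_int n)"
    and nontriv: "\<And>A. A \<noteq> A0 \<Longrightarrow> \<bar>A - A0\<bar> < \<epsilon> \<Longrightarrow> \<not> (be B0 A = 0 \<and> Im (al B0 A) = 0)"
    and inside: "\<And>A. A \<noteq> A0 \<Longrightarrow> \<bar>A - A0\<bar> < \<epsilon> \<Longrightarrow> \<bar>Im (al B0 A)\<bar> < \<bar>be B0 A\<bar> \<Longrightarrow>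
      (B0, A) \<in> interior (level_set \<omega> (of_int n))"
    using monodromy_near_constriction[OF assms(2)] by blast
  define a l m0 where "a = 1 / (2 * \<omega>)" and "l = B0 / \<omega>" and "m0 = A0 / (2 * \<omega>)"
  have be: "be B0 A = monb a l (A / (2 * \<omega>))" and al: "al B0 A = mona a l (A / (2 * \<omega>))" for A
    by (simp_all add: be_def al_def a_def l_def)
  have scale: "\<bar>A / (2 * \<omega>) - m0\<bar> = \<bar>A - A0\<bar> / (2 * \<omega>)" for A
    using assms(1) by (simp add: m0_def flip: diff_divide_distrib)
  have "\<exists>\<delta>>0. (\<forall>m. m \<noteq> m0 \<and> \<bar>m - m0\<bar> < \<delta> \<longrightarrow> \<bar>Im (mona a l m)\<bar> < \<bar>monb a l m\<bar>)
    \<or> (\<forall>m. m \<noteq> m0 \<and> \<bar>m - m0\<bar> < \<delta> \<longrightarrow> \<bar>monb a l m\<bar> < \<bar>Im (mona a l m)\<bar>)"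
  proof (rule monodromy_sign_near)
    show "a > 0" "m0 \<noteq> 0" "\<epsilon> / (2 * \<omega>) > 0" using assms(1) A0 \<epsilon> by (simp_all add: a_def m0_def)
    show "monb a l m0 = 0" "Im (mona a l m0) = 0" using z by (simp_all add: be al m0_def)
    show "\<not> (monb a l m = 0 \<and> Im (mona a l m) = 0)"
      if "m \<noteq> m0" "\<bar>m - m0\<bar> < \<epsilon> / (2 * \<omega>)" for m
    proof -
      have m: "m = (2 * \<omega> * m) / (2 * \<omega>)" using assms(1) by simp
      have "\<bar>2 * \<omega> * m - A0\<bar> < \<epsilon>"
        using that(2) scale[of "2 * \<omega> * m"] assms(1) by (simp add: divide_less_cancel)
      moreover have "2 * \<omega> * m \<noteq> A0" using that(1) assms(1) by (auto simp: m0_def)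
      ultimately show ?thesis using nontriv[of "2 * \<omega> * m"] assms(1) by (simp add: be al)
    qed
  qed
  then obtain \<delta> where \<delta>: "\<delta> > 0"
    and dich: "(\<forall>m. m \<noteq> m0 \<and> \<bar>m - m0\<bar> < \<delta> \<longrightarrow> \<bar>Im (mona a l m)\<bar> < \<bar>monb a l m\<bar>)
    \<or> (\<forall>m. m \<noteq> m0 \<and> \<bar>m - m0\<bar> < \<delta> \<longrightarrow> \<bar>monb a l m\<bar> < \<bar>Im (mona a l m)\<bar>)"
    by blast
  \<comment> \<open>Halved because the segment is closed while both neighbourhoods are open; the
    factor \<open>2 * \<omega>\<close> converts a distance in \<open>m\<close> into one in
    \<open>A\<close>.\<close>
  define e where "e = min \<epsilon> (2 * \<omega> * \<delta>) / 2"
  have e: "e > 0" using \<epsilon> \<delta> assms(1) by (simp add: e_def)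
  have near: "A \<noteq> A0" "\<bar>A - A0\<bar> < \<epsilon>" "A / (2 * \<omega>) \<noteq> m0" "\<bar>A / (2 * \<omega>) - m0\<bar> < \<delta>"
    if "A \<in> {A0 - e .. A0 + e} - {A0}" for A
  proof -
    have d: "\<bar>A - A0\<bar> \<le> e" using that by auto
    have "e < \<epsilon>" "e < 2 * \<omega> * \<delta>" using \<epsilon> \<delta> assms(1) by (auto simp: e_def min_def)
    then show "A \<noteq> A0" "\<bar>A - A0\<bar> < \<epsilon>" using that d by auto
    show "\<bar>A / (2 * \<omega>) - m0\<bar> < \<delta>"
      unfolding scale using d \<open>e < 2 * \<omega> * \<delta>\<close> assms(1) by (simp add: divide_less_eq mult_ac)
    show "A / (2 * \<omega>) \<noteq> m0" using that assms(1) by (simp add: m0_def)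
  qed
  from dich show ?thesis
  proof
    assume "\<forall>m. m \<noteq> m0 \<and> \<bar>m - m0\<bar> < \<delta> \<longrightarrow> \<bar>Im (mona a l m)\<bar> < \<bar>monb a l m\<bar>"
    then have "(B0, A) \<in> interior (level_set \<omega> (of_int n))" if "A \<in> {A0 - e .. A0 + e} - {A0}" for A
      using inside[of A] near[OF that] by (simp add: be al)
    then show ?thesis using e lock by blast
  next
    assume "\<forall>m. m \<noteq> m0 \<and> \<bar>m - m0\<bar> < \<delta> \<longrightarrow> \<bar>monb a l m\<bar> < \<bar>Im (mona a l m)\<bar>"
    then have "elliptic B0 A" if "A \<in> {A0 - e .. A0 + e} - {A0}" for A
      using near[OF that] by (simp add: elliptic_def be al)
    then have "(B0, A) \<notin> phase_lock_union \<omega>" if "A \<in> {A0 - e .. A0 + e} - {A0}" for A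
      using that phase_lock_not_elliptic unfolding phase_lock_union_def by blast
    then show ?thesis using e by blast
  qed
qed

end
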